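(* Let $x>0$, let $r\in\mathbb{N}$ and let $\ell\in\mathbb{N}\cup\{0\}$ be arbitrary such that $\ell\ge 1-r$. Then the following hold around $t=1-r-\ell$. (1) For a fixed $s\in\mathbb{Z}$ with $s>r+\ell$, or a fixed $s\in\mathbb{C}\setminus\mathbb{Z}$, $$\Theta(r,s,t,x)=\binom{r+\ell-1}{\ell}x^{\ell}\frac{\zeta(s-\ell)}{(t-(1-r-\ell))}+\binom{r+\ell-1}{\ell}x^{\ell}\zeta(s-\ell)\left(\gamma+H_{r-1}-H_{r+\ell-1}\right)$$ $$\qquad+\sum_{\substack{k=0\\k\neq r-1}}^{r+\ell-1}\binom{r+\ell-1}{k}x^{r+\ell-1-k}\zeta(r-k)\zeta(1+k-\ell-r+s)+O(|t-(1-r-\ell)|).$$ (2) For a fixed $s\in\mathbb{Z}\setminus\mathbb{N}$ with $s\le r+\ell$, $$\Theta(r,s,t,x)=\binom{r+\ell-1}{\ell}x^{\ell}\frac{\zeta(s-\ell)}{(t-(1-r-\ell))}+\binom{r+\ell-1}{\ell}x^{\ell}\zeta(s-\ell)\left(\gamma+H_{r-1}-H_{r+\ell-1}\right)$$ $$\qquad+\sum_{\substack{k=0\\k\neq r-1}}^{r+\ell-1}\binom{r+\ell-1}{k}x^{r+\ell-1-k}\zeta(r-k)\zeta(1+k-\ell-r+s)+(-1)^{s-1}\frac{(r+\ell-1)!(-s)!}{(r+\ell-s)!}x^{s-1}\zeta(s-\ell)+O(|t-(1-r-\ell)|).$$ (3) For a fixed $s\in\mathbb{N}$ with $s\le r+\ell$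 and $s\neq\ell+1$, $$\Theta(r,s,t,x)=\binom{r+\ell-1}{\ell}x^{\ell}\frac{\zeta(s-\ell)}{(t-(1-r-\ell))}+\binom{r+\ell-1}{\ell}x^{\ell}\zeta(s-\ell)\left(\gamma+H_{r-1}-H_{r+\ell-1}\right)$$ $$\qquad+\binom{r+\ell-1}{s-1}x^{s-1}\frac{\zeta(s-\ell)}{(t-(1-r-\ell))}+\binom{r+\ell-1}{s-1}x^{s-1}\zeta(s-\ell)\left(\gamma+H_{s-1}-H_{r+\ell-1}-\log(x)\right)$$ $$\qquad+\sum_{\substack{k=0\\k\neq r-1\\k\neq r+\ell-s}}^{r+\ell-1}\binom{r+\ell-1}{k}x^{r+\ell-1-k}\zeta(r-k)\zeta(1+k-\ell-r+s)+O(|t-(1-r-\ell)|).$$ (4) For $s=\ell+1$, $$\Theta(r,s,t,x)=\binom{r+\ell-1}{\ell}\frac{2x^{\ell}}{(t-(1-r-\ell))^2}+\binom{r+\ell-1}{\ell}\frac{x^{\ell}\left(2\gamma+H_{\ell}+H_{r-1}-2H_{r+\ell-1}-\log(x)\right)}{(t-(1-r-\ell))}$$ $$\qquad+\frac13\binom{r+\ell-1}{\ell}x^{\ell}\Big(-\pi^2+3(\gamma+H_{\ell}-H_{r+\ell-1}-\log(x))(\gamma+H_{r-1}-H_{r+\ell-1})+3\psi'(r+\ell)\Big)$$ $$\qquad+\sum_{\substack{k=0\\k\neq r-1}}^{r+\ell-1}\binom{r+\ell-1}{k}x^{r+\ell-1-k}\zeta(r-k)\zeta(k-r+2)+O(|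t-(1-r-\ell)|).$$
   Context: $\mathbb{N}=\{1,2,3,\dots\}$. For $x>0$ and $(r,s,t)\in\mathbb{C}^3$ with $\Re(r+t)>1$, $\Re(s+t)>1$, $\Re(r+s+t)>2$, the generalized Mordell–Tornheim zeta function is the absolutely convergent series $\Theta(r,s,t,x)=\sum_{n=1}^{\infty}\sum_{m=1}^{\infty}\frac{1}{n^r m^s (n+mx)^t}$. For fixed $x>0$ it continues meromorphically to $(r,s,t)\in\mathbb{C}^3$, with singularities only on the hyperplanes $r+t=1-\ell$, $s+t=1-\ell$ ($\ell\in\mathbb{N}\cup\{0\}$) and $r+s+t=2$; $\Theta$ also denotes this continuation. For fixed $r,s$, it is considered as a meromorphic function of the single complex variable $t$; "around $t=t_0$" means as $t\to t_0$, $t\neq t_0$. $\zeta$ is the Riemann zeta function, $\gamma$ is Euler's constant, $\psi=\Gamma'/\Gamma$ is the digamma function, and $H_n=\sum_{i=1}^n 1/i$ with $H_0=0$. *)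

theory Defs
  imports
    "HOL-Complex_Analysis.Complex_Analysis"
    "HOL-Library.Landau_Symbols"
begin

text \<open>
  The Riemann zeta function, as the analytic continuation of its Dirichlet series to the complex
  plane without \<open>1\<close>.  The continuation is unique; its value at the pole \<open>1\<close> is unspecified.
\<close>

definition riemann_zeta :: "complex \<Rightarrow> complex" where
  "riemann_zeta = (SOME f. f holomorphic_on (- {1}) \<and>
     (\<forall>s. Re s > 1 \<longrightarrow> f s = (\<Sum>\<^sub>\<infinity>n\<in>{1::nat..}. 1 / of_nat n powr s)))"

definition mt_series :: "complex \<Rightarrow> complex \<Rightarrow> complex \<Rightarrow> real \<Rightarrow> complex" where
  "mt_series r s t x =
     (\<Sum>\<^sub>\<infinity>n\<in>{1::nat..}. \<Sum>\<^sub>\<infinity>m\<in>{1::nat..}.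
        1 / (of_nat n powr r * of_nat m powr s * (of_nat n + of_nat m * of_real x) powr t))"

definition mt_convergence_region :: "(complex \<times> complex \<times> complex) set" where
  "mt_convergence_region = {(r, s, t). Re (r + t) > 1 \<and> Re (s + t) > 1 \<and> Re (r + s + t) > 2}"

definition mt_singular_set :: "(complex \<times> complex \<times> complex) set" where
  "mt_singular_set = {(r, s, t). (\<exists>l::nat. r + t = 1 - of_nat l) \<or>
     (\<exists>l::nat. s + t = 1 - of_nat l) \<or> r + s + t = 2}"

text \<open>
  Holomorphy in three variables is expressed as holomorphy in each variable separately, which is
  the same by Hartogs' theorem.
\<close>

definition holomorphic3_on ::
  "(complex \<Rightarrow> complex \<Rightarrow> complex \<Rightarrow> complex) \<Rightarrow> (complex \<times> complex \<times> complex) set \<Rightarrow> bool" where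
  "holomorphic3_on F D \<longleftrightarrow>
     (\<forall>s t. (\<lambda>r. F r s t) holomorphic_on {r. (r, s, t) \<in> D}) \<and>
     (\<forall>r t. (\<lambda>s. F r s t) holomorphic_on {s. (r, s, t) \<in> D}) \<and>
     (\<forall>r s. (\<lambda>t. F r s t) holomorphic_on {t. (r, s, t) \<in> D})"

definition mt_continuation ::
  "real \<Rightarrow> (complex \<Rightarrow> complex \<Rightarrow> complex \<Rightarrow> complex) \<Rightarrow> bool" where
  "mt_continuation x F \<longleftrightarrow> holomorphic3_on F (- mt_singular_set) \<and>
     (\<forall>(r, s, t) \<in> mt_convergence_region. F r s t = mt_series r s t x)"

text \<open>
  For \<open>x > 0\<close>, any two continuations agree off the singular hyperplanes: for fixed \<open>r\<close> and \<open>s\<close>, the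
  points \<open>t\<close> off the hyperplanes form a connected open set, and those with large real part lie in
  the region of convergence.  So the choice below only affects the values on the hyperplanes.
\<close>

definition Theta :: "complex \<Rightarrow> complex \<Rightarrow> complex \<Rightarrow> real \<Rightarrow> complex" where
  "Theta r s t x = (SOME F. mt_continuation x F) r s t"

end

theory Submission
  imports Defs
begin

text \<open>
  With \<open>L\<^sub>s(u) = \<Sum>\<^sub>n n\<^sup>-\<^sup>s e\<^sup>-\<^sup>n\<^sup>u\<close>, the series is a Mellin transform:
  \<open>\<Gamma>(t) \<Theta>(r,s,t,x) = \<integral> u\<^sup>t\<^sup>-\<^sup>1 L\<^sub>r(u) L\<^sub>s(xu) du\<close> over \<open>u > 0\<close>.  Replacing the second factor by its expansion
  \<open>L\<^sub>s(u) = \<Gamma>(1-s) u\<^sup>s\<^sup>-\<^sup>1 + \<Sum>\<^sub>j\<^sub><\<^sub>K \<zeta>(s-j) (-u)\<^sup>j / j! + O(u\<^sup>K)\<close> turns \<open>\<Theta>\<close> into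
  \<open>\<Gamma>(1-s) \<Gamma>(s+t-1) x\<^sup>s\<^sup>-\<^sup>1 \<zeta>(r+s+t-1) / \<Gamma>(t)\<close>, plus the terms
  \<open>(-t choose j) x\<^sup>j \<zeta>(s-j) \<zeta>(r+t+j)\<close> for \<open>j < K\<close>, plus \<open>1/\<Gamma>(t)\<close> times an integral that converges in a half-space growing with \<open>K\<close>.
  This is the continuation; at \<open>s = j+1\<close> the poles of \<open>\<Gamma>(1-s)\<close> and \<open>\<zeta>(s-j)\<close> cancel and leave a
  derivative in \<open>s\<close>.  Near \<open>t = 1-r-\<ell>\<close> the factor \<open>1/\<Gamma>(t)\<close> vanishes, so only finitely many explicit
  terms contribute, and each of them is expanded.
\<close>

section \<open>Parametric integrals and the Mellin transform of a Laplace transform\<close>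

text \<open>Both \<open>Theta\<close> and \<open>riemann_zeta\<close> are picked by
  \<open>SOME\<close>, so nothing can be said about either until a function with the required
  properties exists. For \<open>Theta\<close> that function must be holomorphic in each variable off
  the hyperplanes, also across positive integers \<open>s\<close>, where single terms of the
  expansion blow up. This shapes the estimates: every bound on a remainder is uniform for
  \<open>s\<close> in compact sets, so that the remainder integral can be differentiated in
  \<open>s\<close> as well as in \<open>r\<close> and \<open>t\<close>. In the Mellin form
  \<open>t\<close> and \<open>x\<close> enter only through \<open>u^(t-1)\<close> and the rescaling
  \<open>x u\<close>, so the one asymptotic expansion to be proved is that of a single sum in one
  variable. The zeta function needs no separate treatment: its continuation is the constant term of
  this same expansion, and Euler's constant comes out when the expansion is compared at
  \<open>s = 1\<close> and \<open>u\<close> tends to \<open>0\<close>. The order \<open>K\<close> is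
  free above a bound; raising it moves one term from the integral to the explicit part. Uniqueness
  uses only the variable \<open>t\<close>, since for fixed \<open>r\<close> and \<open>s\<close> the
  points to be avoided are countable.\<close>

lemma integral_has_field_derivative_dominated:
  fixes f :: "complex \<Rightarrow> 'a \<Rightarrow> complex"
  assumes S: "open S" and z: "z \<in> S"
    and holo: "\<And>p. p \<in> space M \<Longrightarrow> (\<lambda>w. f w p) holomorphic_on S"
    and meas: "\<And>w. w \<in> S \<Longrightarrow> f w \<in> borel_measurable M"
    and dom: "\<exists>e>0. \<exists>G. integrable M G \<and> (\<forall>w\<in>ball z e. \<forall>p\<in>space M. norm (f w p) \<le> G p)"
  shows "((\<lambda>w. \<integral>p. f w p \<partial>M) has_field_derivative (\<integral>p. deriv (\<lambda>w. f w p) z \<partial>M)) (at z)"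
proof -
  from dom obtain e0 G where e0: "e0 > 0" "integrable M G"
    and G: "\<And>w p. w \<in> ball z e0 \<Longrightarrow> p \<in> space M \<Longrightarrow> norm (f w p) \<le> G p"
    by blast
  from S z obtain e1 where e1: "e1 > 0" "ball z e1 \<subseteq> S" by (auto simp: open_contains_ball)
  define e where "e = min e0 e1"
  have e: "e > 0" "ball z e \<subseteq> S" "ball z e \<subseteq> ball z e0" using e0 e1 by (auto simp: e_def)
  have int: "integrable M (f w)" if "w \<in> ball z e" for w
    by (rule Bochner_Integration.integrable_bound[OF e0(2)])
       (use that e meas G in \<open>auto intro!: AE_I2 order.trans[OF _ abs_ge_self]\<close>)
  \<comment> \<open>A disc of radius \<open>e/3\<close> about a point of \<open>ball z (e/2)\<close>
    stays inside \<open>ball z e\<close>. Cauchy's estimate on it turns the bound \<open>G\<close>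
    on \<open>f\<close> into the bound \<open>3 * G p / e\<close> on the derivative, and this
    dominates the difference quotients.\<close>
  have lip: "norm (f w p - f z p) \<le> (3 * G p / e) * norm (w - z)"
    if w: "w \<in> ball z (e/2)" and p: "p \<in> space M" for w p
  proof (rule field_differentiable_bound[where S = "ball z (e/2)" and f' = "deriv (\<lambda>w. f w p)"])
    fix y assume y: "y \<in> ball z (e/2)"
    have sub: "cball y (e/3) \<subseteq> ball z e"
    proof
      fix a assume "a \<in> cball y (e/3)"
      hence "dist z a \<le> dist z y + e/3"
        using dist_triangle[of z a y] by simp
      thus "a \<in> ball z e" using y e(1) by simp
    qed
    have h: "(\<lambda>w. f w p) holomorphic_on ball z e" using holo[OF p] e(2) by (rule holomorphic_on_subset)
    from y e have "y \<in> ball z e" by simp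
    show "((\<lambda>w. f w p) has_field_derivative deriv (\<lambda>w. f w p) y) (at y within ball z (e/2))"
      by (rule has_field_derivative_at_within, rule holomorphic_derivI[OF h]) (use \<open>y \<in> ball z e\<close> in auto)
    have "norm ((deriv ^^ 1) (\<lambda>w. f w p) y) \<le> fact 1 * G p / (e/3)^1"
    proof (rule Cauchy_inequality)
      show "(\<lambda>w. f w p) holomorphic_on ball y (e/3)"
        using h sub by (meson ball_subset_cball holomorphic_on_subset)
      show "continuous_on (cball y (e/3)) (\<lambda>w. f w p)"
        using h sub by (meson holomorphic_on_imp_continuous_on holomorphic_on_subset)
      fix x assume "norm (y - x) = e/3"
      hence "x \<in> cball y (e/3)" by (simp add: dist_norm)
      thus "norm (f x p) \<le> G p" using sub e(3) G p by blast
    qed (use e in auto)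
    thus "norm (deriv (\<lambda>w. f w p) y) \<le> 3 * G p / e" using e(1) by (simp add: field_simps)
  qed (use w e in auto)
  have "((\<lambda>w. ((\<integral>p. f w p \<partial>M) - (\<integral>p. f z p \<partial>M)) / (w - z)) \<longlongrightarrow>
           (\<integral>p. deriv (\<lambda>w. f w p) z \<partial>M)) (at z within ball z (e/2))"
    unfolding tendsto_at_iff_sequentially
  proof safe
    fix X :: "nat \<Rightarrow> complex"
    assume X: "\<forall>i. X i \<in> ball z (e/2) - {z}" and lim: "X \<longlonglongrightarrow> z"
    have Xb: "X i \<in> ball z e" for i using X[rule_format, of i] e by simp
    have zb: "z \<in> ball z e" using e by simp
    have limp: "(\<lambda>i. (f (X i) p - f z p) / (X i - z)) \<longlonglongrightarrow> deriv (\<lambda>w. f w p) z" if "p \<in> space M" for p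
    proof -
      have "((\<lambda>w. f w p) has_field_derivative deriv (\<lambda>w. f w p) z) (at z within ball z (e/2))"
        by (rule has_field_derivative_at_within, rule holomorphic_derivI[OF holo[OF that] S z])
      hence "((\<lambda>w. (f w p - f z p) / (w - z)) \<longlongrightarrow> deriv (\<lambda>w. f w p) z) (at z within ball z (e/2))"
        by (simp add: has_field_derivative_iff)
      thus ?thesis using X lim unfolding tendsto_at_iff_sequentially o_def by blast
    qed
    have m: "(\<lambda>p. (f (X i) p - f z p) / (X i - z)) \<in> borel_measurable M" for i
      by (intro borel_measurable_divide borel_measurable_diff meas) (use Xb zb e z in auto)
    have "(\<lambda>i. \<integral>p. (f (X i) p - f z p) / (X i - z) \<partial>M) \<longlonglongrightarrow> (\<integral>p. deriv (\<lambda>w. f w p) z \<partial>M)"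
    proof (rule integral_dominated_convergence[where w = "\<lambda>p. 3 * G p / e"])
      show "(\<lambda>p. deriv (\<lambda>w. f w p) z) \<in> borel_measurable M"
        by (rule borel_measurable_LIMSEQ_metric[where f = "\<lambda>i p. (f (X i) p - f z p) / (X i - z)"])
           (use m limp in auto)
      show "integrable M (\<lambda>p. 3 * G p / e)" using e0 by auto
      fix i show "AE p in M. norm ((f (X i) p - f z p) / (X i - z)) \<le> 3 * G p / e"
      proof (rule AE_I2)
        fix p assume p: "p \<in> space M"
        have "X i \<in> ball z (e/2)" "X i \<noteq> z" using X by auto
        with lip[OF this(1) p] show "norm ((f (X i) p - f z p) / (X i - z)) \<le> 3 * G p / e"
          by (simp add: norm_divide divide_le_eq)
      qed
    qed (use m limp in auto)
    moreover have "(\<lambda>i. \<integral>p. (f (X i) p - f z p) / (X i - z) \<partial>M) =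
       (\<lambda>w. ((\<integral>p. f w p \<partial>M) - (\<integral>p. f z p \<partial>M)) / (w - z)) \<circ> X"
      using int[OF Xb] int[OF zb] by (intro ext) simp
    ultimately show "((\<lambda>w. ((\<integral>p. f w p \<partial>M) - (\<integral>p. f z p \<partial>M)) / (w - z)) \<circ> X) \<longlonglongrightarrow>
           (\<integral>p. deriv (\<lambda>w. f w p) z \<partial>M)" by (simp only:)
  qed
  moreover have "at z within ball z (e/2) = at z" using e by (intro at_within_open) auto
  ultimately show ?thesis by (simp add: has_field_derivative_iff)
qed

lemma integral_holomorphic_dominated:
  fixes f :: "complex \<Rightarrow> 'a \<Rightarrow> complex"
  assumes "open S"
    and "\<And>p. p \<in> space M \<Longrightarrow> (\<lambda>w. f w p) holomorphic_on S"
    and "\<And>w. w \<in> S \<Longrightarrow> f w \<in> borel_measurable M"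
    and "\<And>z. z \<in> S \<Longrightarrow> \<exists>e>0. \<exists>G. integrable M G \<and> (\<forall>w\<in>ball z e. \<forall>p\<in>space M. norm (f w p) \<le> G p)"
  shows "(\<lambda>w. \<integral>p. f w p \<partial>M) holomorphic_on S"
  using integral_has_field_derivative_dominated[OF assms(1) _ assms(2,3,4)]
  by (meson assms(1) holomorphic_on_open)

section \<open>Gamma integrals and Mellin transforms on the positive half-line\<close>

abbreviation lpos :: "real measure" where "lpos \<equiv> restrict_space lborel {0<..}"

lemma sigma_finite_lpos: "sigma_finite_measure lpos"
  by (intro sigma_finite_measure_restrict_space) (auto intro: lborel.sigma_finite_measure_axioms)

lemma measurable_lpos: "f \<in> borel_measurable borel \<Longrightarrow> f \<in> borel_measurable lpos"
  by (intro measurable_restrict_space1) simp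

lemma integrable_lpos_iff:
  fixes f :: "real \<Rightarrow> 'a :: {banach, second_countable_topology}"
  shows "integrable lpos f \<longleftrightarrow> set_integrable lborel {0<..} f"
  by (simp add: integrable_restrict_space set_integrable_def)

lemma integral_lpos:
  fixes f :: "real \<Rightarrow> 'a :: {banach, second_countable_topology}"
  shows "integral\<^sup>L lpos f = (LINT y:{0<..}|lborel. f y)"
  by (simp add: integral_restrict_space set_lebesgue_integral_def)


lemma borel_measurable_powr_of_real [measurable]:
  "(\<lambda>y::real. complex_of_real y powr b) \<in> borel_measurable borel"
  by (intro powr_complex_measurable) auto

lemma Gamma_integral_scaled:
  fixes b :: complex and a :: real
  assumes b: "Re b > 0" and a: "a > 0"
  shows "integrable lpos (\<lambda>y. of_real y powr (b - 1) * exp (- of_real (a * y)))"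
    and "(\<integral>y. of_real y powr (b - 1) * exp (- of_real (a * y)) \<partial>lpos) = Gamma b * of_real a powr (- b)"
proof -
  have int: "set_integrable lborel {0<..} (\<lambda>y. of_real y powr (b - 1) * exp (- of_real (a * y)))"
    if "a > 0" for a :: real
  proof -
    have "integrable lebesgue (\<lambda>y. indicator {0<..} y *\<^sub>R (of_real y powr (b - 1) / of_real (exp (a * y)) :: complex))"
      using absolutely_integrable_Gamma_integral[OF b that] by (simp add: set_integrable_def)
    hence "integrable lborel (\<lambda>y. indicator {0<..} y *\<^sub>R (of_real y powr (b - 1) / of_real (exp (a * y)) :: complex))"
      by (subst (asm) integrable_completion) auto
    thus ?thesis unfolding set_integrable_def
      by (rule iffD1[OF Bochner_Integration.integrable_cong, rotated 2])
         (auto simp: exp_minus exp_of_real divide_inverse simp flip: of_real_mult)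
  qed
  show "integrable lpos (\<lambda>y. of_real y powr (b - 1) * exp (- of_real (a * y)))"
    using int[OF a] by (simp add: integrable_lpos_iff)
  \<comment> \<open>With the indicator built in, \<open>g\<close> lives on the whole line. The
    substitution \<open>a * y\<close> is then an affine change of variable for
    \<open>lborel\<close>, and the value for general \<open>a\<close> follows from the Gamma
    integral at \<open>a = 1\<close>.\<close>
  define g where "g = (\<lambda>a y. indicator {0<..} y *\<^sub>R (of_real y powr (b - 1) * exp (- of_real (a * y))) :: complex)"
  have "((\<lambda>t. of_real t powr (b - 1) / of_real (exp t)) has_integral Gamma b) {0<..}"
    by (rule Gamma_integral_complex'[OF b])
  also have "?this \<longleftrightarrow> ((\<lambda>t. of_real t powr (b - 1) * exp (- of_real (1 * t))) has_integral Gamma b) {0<..}"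
    by (rule has_integral_cong) (auto simp: exp_minus exp_of_real divide_inverse)
  finally have "(LINT y:{0<..}|lborel. of_real y powr (b - 1) * exp (- of_real (1 * y))) = Gamma b"
    using set_borel_integral_eq_integral(2)[OF int[of 1]] by (simp add: integral_unique)
  hence "Gamma b = integral\<^sup>L lborel (g 1)" by (simp add: g_def set_lebesgue_integral_def)
  also have "\<dots> = \<bar>a\<bar> *\<^sub>R (LBINT y. g 1 (0 + a * y))"
    by (rule lborel_integral_real_affine) (use a in auto)
  also have "(\<lambda>y. g 1 (0 + a * y)) = (\<lambda>y. of_real a powr (b - 1) * g a y)"
    using a by (intro ext) (auto simp: g_def indicator_def powr_times_real zero_less_mult_iff)
  also have "\<bar>a\<bar> *\<^sub>R (LBINT y. of_real a powr (b - 1) * g a y) = (of_real a * of_real a powr (b - 1)) * (LBINT y. g a y)"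
    using a by (simp add: scaleR_conv_of_real)
  also have "of_real a * of_real a powr (b - 1) = of_real a powr b"
    using a by (simp add: powr_diff)
  finally have "Gamma b = of_real a powr b * (LBINT y. g a y)" .
  hence "(LBINT y. g a y) = Gamma b * of_real a powr (- b)"
    using a by (simp add: powr_minus field_simps)
  thus "(\<integral>y. of_real y powr (b - 1) * exp (- of_real (a * y)) \<partial>lpos) = Gamma b * of_real a powr (- b)"
    by (simp add: integral_lpos g_def set_lebesgue_integral_def)
qed

lemma norm_powr_exp:
  assumes "y > 0"
  shows "norm (of_real y powr (b - 1) * exp (- of_real (a * y)) :: complex) = y powr (Re b - 1) * exp (- (a * y))"
  using assms by (simp add: norm_mult norm_powr_real_powr exp_of_real flip: of_real_mult of_real_minus)

lemma Gamma_integral_scaled_real: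
  fixes b :: real and a :: real
  assumes b: "b > 0" and a: "a > 0"
  shows "integrable lpos (\<lambda>y. y powr (b - 1) * exp (- (a * y)))"
    and "(\<integral>y. y powr (b - 1) * exp (- (a * y)) \<partial>lpos) = Gamma b * a powr (- b)"
proof -
  have eq: "of_real y powr (of_real b - 1) * exp (- of_real (a * y)) = complex_of_real (y powr (b - 1) * exp (- (a * y)))"
    if "y > 0" for y
  proof -
    have "exp (- complex_of_real (a * y)) = of_real (exp (- (a * y)))"
      by (metis exp_of_real of_real_minus)
    moreover have "of_real y powr (of_real b - 1) = complex_of_real (y powr (b - 1))"
      using that by (metis less_imp_le of_real_1 of_real_diff powr_of_real)
    ultimately show ?thesis by simp
  qed
  have "integrable lpos (\<lambda>y. of_real y powr (of_real b - 1) * exp (- complex_of_real (a * y)))"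
    using Gamma_integral_scaled(1)[of "of_real b" a] assms by simp
  also have "?this \<longleftrightarrow> integrable lpos (\<lambda>y. complex_of_real (y powr (b - 1) * exp (- (a * y))))"
    by (intro Bochner_Integration.integrable_cong refl, subst eq) (auto simp: space_restrict_space)
  finally show "integrable lpos (\<lambda>y. y powr (b - 1) * exp (- (a * y)))"
    by (simp add: complex_of_real_integrable_eq del: of_real_mult)
  have "complex_of_real (\<integral>y. y powr (b - 1) * exp (- (a * y)) \<partial>lpos) =
        (\<integral>y. complex_of_real (y powr (b - 1) * exp (- (a * y))) \<partial>lpos)"
    by (simp del: of_real_mult)
  also have "\<dots> = (\<integral>y. of_real y powr (of_real b - 1) * exp (- complex_of_real (a * y)) \<partial>lpos)"
    by (intro Bochner_Integration.integral_cong refl, subst eq) (auto simp: space_restrict_space)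
  also have "\<dots> = complex_of_real (Gamma b * a powr (- b))"
    using Gamma_integral_scaled(2)[of "of_real b" a] assms
    by (simp add: Gamma_complex_of_real powr_of_real flip: of_real_minus)
  finally show "(\<integral>y. y powr (b - 1) * exp (- (a * y)) \<partial>lpos) = Gamma b * a powr (- b)"
    by (simp only: of_real_eq_iff)
qed

text \<open>Fubini: for fixed \<open>p\<close> the \<open>y\<close>-integral of the norm is
  \<open>Gamma (Re b)\<close> times \<open>norm (c p) * v p powr (- Re b)\<close>, so
  \<open>int_c\<close> is what absolute integrability on the product takes. The measure
  \<open>M\<close> stays general because it is a counting measure for single and double sums, and
  Lebesgue measure when inverse powers are written as Laplace transforms.\<close>

lemma mellin_laplace:
  fixes c :: "'a \<Rightarrow> complex" and v :: "'a \<Rightarrow> real"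
  assumes M: "sigma_finite_measure M" and [measurable]: "c \<in> borel_measurable M" "v \<in> borel_measurable M"
    and v: "\<And>p. p \<in> space M \<Longrightarrow> v p > 0" and b: "Re b > 0"
    and int_c: "integrable M (\<lambda>p. c p * of_real (v p) powr (- b))"
    and F: "\<And>y. y > 0 \<Longrightarrow> (\<integral>p. c p * exp (- of_real (v p * y)) \<partial>M) = F y"
  shows "integrable lpos (\<lambda>y. of_real y powr (b - 1) * F y)"
    and "(\<integral>y. of_real y powr (b - 1) * F y \<partial>lpos) = Gamma b * (\<integral>p. c p * of_real (v p) powr (- b) \<partial>M)"
proof -
  have int: "integrable M (\<lambda>p. norm (c p) * v p powr (- Re b))"
    by (rule iffD1[OF Bochner_Integration.integrable_cong[OF refl] integrable_norm[OF int_c]])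
       (simp add: norm_mult norm_powr_real_powr less_imp_le[OF v])
  interpret M: sigma_finite_measure M by fact
  interpret L: sigma_finite_measure lpos by (rule sigma_finite_lpos)
  interpret P: pair_sigma_finite M lpos ..
  define h where "h = (\<lambda>p y. c p * (of_real y powr (b - 1) * exp (- complex_of_real (v p * y))))"
  have [measurable]: "(\<lambda>y. y) \<in> borel_measurable lpos" by (intro measurable_lpos) auto
  have [measurable]: "(\<lambda>y. complex_of_real y powr (b - 1)) \<in> borel_measurable lpos"
    by (intro measurable_lpos) auto
  have meas: "case_prod h \<in> borel_measurable (M \<Otimes>\<^sub>M lpos)"
    unfolding h_def by measurable
  have norm_h: "(\<integral>y. norm (h p y) \<partial>lpos) = Gamma (Re b) * (norm (c p) * v p powr (- Re b))"
    if "p \<in> space M" for p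
  proof -
    have "(\<integral>y. norm (h p y) \<partial>lpos) = (\<integral>y. norm (c p) * (y powr (Re b - 1) * exp (- (v p * y))) \<partial>lpos)"
      by (intro Bochner_Integration.integral_cong refl)
         (auto simp: h_def norm_mult[of "c p"] norm_powr_exp space_restrict_space simp del: of_real_mult)
    also have "\<dots> = norm (c p) * (Gamma (Re b) * v p powr (- Re b))"
      using Gamma_integral_scaled_real(2)[OF b v[OF that]] by simp
    finally show ?thesis by simp
  qed
  have int_h: "integrable (M \<Otimes>\<^sub>M lpos) (case_prod h)"
  proof (rule P.Fubini_integrable[OF meas])
    show "integrable M (\<lambda>p. \<integral>y. norm (case (p, y) of (p, y) \<Rightarrow> h p y) \<partial>lpos)"
      by (rule iffD2[OF Bochner_Integration.integrable_cong[OF refl] integrable_mult_right[OF int, of "Gamma (Re b)"]])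
         (simp add: norm_h)
    show "AE p in M. integrable lpos (\<lambda>y. case (p, y) of (p, y) \<Rightarrow> h p y)"
      by (rule AE_I2) (auto simp: h_def simp del: of_real_mult intro!: Bochner_Integration.integrable_mult_right Gamma_integral_scaled v b)
  qed
  have eq: "(\<integral>p. h p y \<partial>M) = of_real y powr (b - 1) * F y" if "y \<in> space lpos" for y
  proof -
    have "(\<integral>p. h p y \<partial>M) = (\<integral>p. of_real y powr (b - 1) * (c p * exp (- of_real (v p * y))) \<partial>M)"
      unfolding h_def by (simp add: mult_ac)
    thus ?thesis using F[of y] that by (simp add: space_restrict_space)
  qed
  show "integrable lpos (\<lambda>y. of_real y powr (b - 1) * F y)"
    by (rule iffD1[OF Bochner_Integration.integrable_cong[OF refl eq] P.integrable_snd[OF int_h]])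
  have "(\<integral>y. of_real y powr (b - 1) * F y \<partial>lpos) = (\<integral>y. (\<integral>p. h p y \<partial>M) \<partial>lpos)"
    by (rule Bochner_Integration.integral_cong[OF refl eq[symmetric]])
  also have "\<dots> = (\<integral>p. (\<integral>y. h p y \<partial>lpos) \<partial>M)"
    by (rule P.Fubini_integral[OF int_h])
  also have "\<dots> = (\<integral>p. Gamma b * (c p * of_real (v p) powr (- b)) \<partial>M)"
    by (intro Bochner_Integration.integral_cong refl)
       (simp add: h_def Gamma_integral_scaled(2)[OF b v] del: of_real_mult)
  finally show "(\<integral>y. of_real y powr (b - 1) * F y \<partial>lpos) = Gamma b * (\<integral>p. c p * of_real (v p) powr (- b) \<partial>M)"
    by simp
qed

lemma mellin_laplace_count:
  fixes c :: "'a \<Rightarrow> complex" and v :: "'a \<Rightarrow> real"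
  assumes "countable A" "\<And>p. p \<in> A \<Longrightarrow> v p > 0" "Re b > 0"
    and "integrable (count_space A) g" "\<And>p. p \<in> A \<Longrightarrow> c p * of_real (v p) powr (- b) = g p"
    and "\<And>y. y > 0 \<Longrightarrow> (\<integral>p. c p * exp (- of_real (v p * y)) \<partial>count_space A) = F y"
  shows "integrable lpos (\<lambda>y. of_real y powr (b - 1) * F y)"
    and "(\<integral>y. of_real y powr (b - 1) * F y \<partial>lpos) = Gamma b * (\<integral>p. g p \<partial>count_space A)"
proof -
  have eq: "(\<integral>p. c p * of_real (v p) powr (- b) \<partial>count_space A) = (\<integral>p. g p \<partial>count_space A)"
    using assms(5) by (intro Bochner_Integration.integral_cong) auto
  have "integrable (count_space A) (\<lambda>p. c p * of_real (v p) powr (- b))"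
    by (rule iffD2[OF Bochner_Integration.integrable_cong assms(4)]) (use assms(5) in auto)
  note M = mellin_laplace[OF sigma_finite_measure_count_space_countable[OF assms(1)] _ _ _ assms(3) this assms(6)]
  show "integrable lpos (\<lambda>y. of_real y powr (b - 1) * F y)"
    by (rule M) (use assms(2) in auto)
  show "(\<integral>y. of_real y powr (b - 1) * F y \<partial>lpos) = Gamma b * (\<integral>p. g p \<partial>count_space A)"
    unfolding eq[symmetric] by (rule M) (use assms(2) in auto)
qed

section \<open>The exponential sum\<close>

lemma powr_le_exp:
  fixes a e :: real
  assumes "e > 0"
  shows "\<exists>C\<ge>0. \<forall>y\<ge>1. y powr a \<le> C * exp (e * y)"
proof -
  define k where "k = nat \<lceil>\<bar>a\<bar>\<rceil>"
  have ak: "a \<le> real k" unfolding k_def by linarith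
  have "y powr a \<le> (fact k / e ^ k) * exp (e * y)" if y: "y \<ge> 1" for y
  proof -
    have "y powr a \<le> y powr real k" using ak y by (intro powr_mono) auto
    also have "\<dots> = y ^ k" using y by (simp add: powr_realpow)
    also have "(e * y) ^ k / fact k \<le> exp (e * y)"
    proof -
      have "(e * y) ^ k / fact k = (\<Sum>n\<in>{k}. (e * y) ^ n / fact n)" by simp
      also have "\<dots> \<le> (\<Sum>n. (e * y) ^ n / fact n)"
        by (intro sum_le_suminf) (use assms y summable_exp[of "e*y"] in \<open>auto simp: divide_inverse mult.commute\<close>)
      also have "\<dots> = exp (e * y)" by (simp add: exp_def divide_inverse mult.commute)
      finally show ?thesis .
    qed
    hence "y ^ k \<le> (fact k / e ^ k) * exp (e * y)"
      using assms by (simp add: field_simps power_mult_distrib)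
    finally show ?thesis .
  qed
  thus ?thesis using assms by (intro exI[of _ "fact k / e ^ k"]) auto
qed

abbreviation npos :: "nat measure" where "npos \<equiv> count_space {1..}"

lemma integrable_npos_exp:
  fixes x :: real
  assumes "x > 0"
  shows "integrable npos (\<lambda>n. exp (- (real n * x)))"
proof -
  have "summable (\<lambda>n. exp (-x) ^ n)" using assms by (intro summable_geometric) auto
  moreover have "exp (-x) ^ n = exp (- (real n * x))" for n
    by (subst exp_of_nat_mult[symmetric]) simp
  ultimately have "summable (\<lambda>n. exp (- (real n * x)))" by simp
  hence "integrable (count_space UNIV) (\<lambda>n. exp (- (real n * x)))"
    by (simp add: integrable_count_space_nat_iff)
  thus ?thesis by (rule abs_summable_on_subset[unfolded abs_summable_on_def]) auto
qed

lemma powr_exp_bound: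
  fixes x :: real
  assumes "x > 0"
  shows "\<exists>C\<ge>0. \<forall>y\<ge>1. y powr a * exp (- (y * x)) \<le> C * exp (- (y * (x / 2)))"
proof -
  obtain C where C: "C \<ge> 0" "\<And>y. y \<ge> 1 \<Longrightarrow> y powr a \<le> C * exp (x / 2 * y)"
    using powr_le_exp[of "x/2" a] assms by auto
  have "y powr a * exp (- (y * x)) \<le> C * exp (- (y * (x / 2)))" if "y \<ge> 1" for y
  proof -
    have "y powr a * exp (- (y * x)) \<le> C * exp (x / 2 * y) * exp (- (y * x))"
      using C(2)[OF that] by (intro mult_right_mono) auto
    also have "\<dots> = C * exp (x / 2 * y + (- (y * x)))" by (simp only: exp_add mult.assoc)
    also have "x / 2 * y + (- (y * x)) = - (y * (x / 2))" by (simp add: field_simps)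
    finally show ?thesis .
  qed
  thus ?thesis using C(1) by auto
qed

lemma integrable_npos_powr_exp:
  fixes x :: real
  assumes "x > 0"
  shows "integrable npos (\<lambda>n. real n powr a * exp (- (real n * x)))"
proof -
  obtain C where C: "C \<ge> 0" "\<And>y. y \<ge> 1 \<Longrightarrow> y powr a * exp (- (y * x)) \<le> C * exp (- (y * (x / 2)))"
    using powr_exp_bound[OF assms, of a] by auto
  show ?thesis
    by (rule Bochner_Integration.integrable_bound[OF
          integrable_mult_right[OF integrable_npos_exp[of "x/2"], of C]])
       (use assms C in \<open>auto intro!: AE_I2\<close>)
qed

text \<open>For \<open>Re z > 0\<close> this is the polylogarithm \<open>Li_s(exp (- z))\<close>.
  The Mellin integrals use it at real points only; complex \<open>z\<close> gives access to complex
  derivatives near \<open>0\<close>.\<close>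

definition lsum :: "complex \<Rightarrow> complex \<Rightarrow> complex" where
  "lsum s z = (\<integral>n. of_nat n powr (- s) * exp (- (of_nat n * z)) \<partial>npos)"

lemma norm_lsum_term:
  "n \<ge> 1 \<Longrightarrow> norm (of_nat n powr (- s) * exp (- (of_nat n * z)) :: complex) = real n powr (- Re s) * exp (- (real n * Re z))"
  by (simp add: norm_mult norm_powr_real_powr)

lemma lsum_term_integrable:
  assumes "Re z > 0"
  shows "integrable npos (\<lambda>n. of_nat n powr (- s) * exp (- (of_nat n * z)))"
  by (rule Bochner_Integration.integrable_bound[OF integrable_npos_powr_exp[OF assms, of "- Re s"]])
     (auto intro!: AE_I2 simp: norm_lsum_term simp del: norm_mult)

lemma norm_lsum_le:
  assumes "Re z > 0"
  shows "norm (lsum s z) \<le> (\<integral>n. real n powr (- Re s) * exp (- (real n * Re z)) \<partial>npos)"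
proof -
  have "norm (lsum s z) \<le> (\<integral>n. norm (of_nat n powr (- s) * exp (- (of_nat n * z)) :: complex) \<partial>npos)"
    unfolding lsum_def by (rule integral_norm_bound)
  also have "\<dots> = (\<integral>n. real n powr (- Re s) * exp (- (real n * Re z)) \<partial>npos)"
    by (intro Bochner_Integration.integral_cong refl norm_lsum_term) auto
  finally show ?thesis .
qed

lemma open_Re_gt: "open {z. Re z > a}"
  by (simp add: open_halfspace_Re_gt)

text \<open>The shift from \<open>s\<close> to \<open>s - 1\<close> drives all later inductions: the
  remainders are built to obey the same rule, so an expansion at \<open>s - 1\<close> integrates to
  one at \<open>s\<close>, up to a constant that the limit at \<open>u = 0\<close>
  determines.\<close>

lemma has_field_derivative_lsum:
  assumes "Re z > 0"
  shows "((\<lambda>z. lsum s z) has_field_derivative - lsum (s - 1) z) (at z)"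
proof -
  have "((\<lambda>z. \<integral>n. of_nat n powr (- s) * exp (- (of_nat n * z)) \<partial>npos) has_field_derivative
          (\<integral>n. deriv (\<lambda>z. of_nat n powr (- s) * exp (- (of_nat n * z))) z \<partial>npos)) (at z)"
  proof (rule integral_has_field_derivative_dominated)
    show "open {z. Re z > 0}" by (rule open_Re_gt)
    show "\<exists>e>0. \<exists>G. integrable npos G \<and> (\<forall>w\<in>ball z e. \<forall>n\<in>space npos.
            norm (of_nat n powr (- s) * exp (- (of_nat n * w)) :: complex) \<le> G n)"
    proof (intro exI[of _ "Re z / 2"] conjI exI[of _ "\<lambda>n. real n powr (- Re s) * exp (- (real n * (Re z / 2)))"] ballI)
      fix w n assume w: "w \<in> ball z (Re z / 2)" and n: "n \<in> space npos"
      have "Re z - Re w \<le> norm (z - w)" using complex_Re_le_cmod[of "z - w"] by simp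
      hence "Re z / 2 \<le> Re w" using w by (simp add: dist_norm)
      thus "norm (of_nat n powr (- s) * exp (- (of_nat n * w)) :: complex) \<le> real n powr (- Re s) * exp (- (real n * (Re z / 2)))"
        using n by (subst norm_lsum_term) (auto intro!: mult_left_mono)
    next
      show "integrable npos (\<lambda>n. real n powr (- Re s) * exp (- (real n * (Re z / 2))))"
        by (rule integrable_npos_powr_exp) (use assms in auto)
    qed (use assms in auto)
  qed (use assms in \<open>auto intro!: holomorphic_intros\<close>)
  also have "(\<integral>n. deriv (\<lambda>z. of_nat n powr (- s) * exp (- (of_nat n * z))) z \<partial>npos) =
             (\<integral>n. - (of_nat n powr (- (s - 1)) * exp (- (of_nat n * z))) \<partial>npos)"
  proof (intro Bochner_Integration.integral_cong refl DERIV_imp_deriv)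
    fix n assume "n \<in> space npos"
    hence [simp]: "n > 0" by simp
    have "of_nat n powr (- (s - 1)) = (of_nat n powr (- s) * of_nat n :: complex)"
      using powr_add[of "of_nat n :: complex" "-s" 1] by (simp add: algebra_simps)
    thus "((\<lambda>z. of_nat n powr (- s) * exp (- (of_nat n * z))) has_field_derivative
            - (of_nat n powr (- (s - 1)) * exp (- (of_nat n * z)))) (at z)"
      by (auto intro!: derivative_eq_intros)
  qed
  finally show ?thesis by (simp add: lsum_def)
qed

lemma holomorphic_lsum:
  assumes "Re z > 0"
  shows "(\<lambda>s. lsum s z) holomorphic_on UNIV"
  unfolding lsum_def
proof (rule integral_holomorphic_dominated)
  fix s :: complex
  show "\<exists>e>0. \<exists>G. integrable npos G \<and> (\<forall>w\<in>ball s e. \<forall>n\<in>space npos.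
            norm (of_nat n powr (- w) * exp (- (of_nat n * z)) :: complex) \<le> G n)"
  proof (intro exI[of _ 1] conjI exI[of _ "\<lambda>n. real n powr (1 - Re s) * exp (- (real n * Re z))"] ballI)
    fix w n assume w: "w \<in> ball s 1" and n: "n \<in> space npos"
    have "Re s - Re w \<le> norm (s - w)" using complex_Re_le_cmod[of "s - w"] by simp
    hence "- Re w \<le> 1 - Re s" using w by (simp add: dist_norm)
    thus "norm (of_nat n powr (- w) * exp (- (of_nat n * z)) :: complex) \<le> real n powr (1 - Re s) * exp (- (real n * Re z))"
      using n by (subst norm_lsum_term) (auto intro!: mult_right_mono powr_mono)
  next
    show "integrable npos (\<lambda>n. real n powr (1 - Re s) * exp (- (real n * Re z)))"
      by (rule integrable_npos_powr_exp) (use assms in auto)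
  qed auto
qed (auto intro!: holomorphic_intros)

text \<open>For \<open>n, u \<ge> 1\<close> one has \<open>n u \<ge> n/2 + u/2\<close>. The factor
  \<open>exp (- u / 2)\<close> therefore splits off and leaves a convergent sum free of
  \<open>u\<close>; since \<open>real n powr (- Re s)\<close> decreases in \<open>Re s\<close>, one
  constant serves a whole half-plane.\<close>

lemma lsum_exp_decay:
  "\<exists>C\<ge>0. \<forall>u\<ge>1. \<forall>s. Re s \<ge> a \<longrightarrow> norm (lsum s (of_real u)) \<le> C * exp (- u / 2)"
proof -
  define C where "C = (\<integral>n. real n powr (- a) * exp (- (real n * (1 / 2))) \<partial>npos)"
  have i: "integrable npos (\<lambda>n. real n powr (- a) * exp (- (real n * (1 / 2))))"
    by (rule integrable_npos_powr_exp) auto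
  have "C \<ge> 0" unfolding C_def by (rule integral_nonneg_AE) auto
  moreover have "norm (lsum s (of_real u)) \<le> C * exp (- u / 2)" if u: "u \<ge> 1" and s: "Re s \<ge> a" for u s
  proof -
    have "norm (lsum s (of_real u)) \<le> (\<integral>n. real n powr (- Re s) * exp (- (real n * u)) \<partial>npos)"
      using norm_lsum_le[of "of_real u" s] u by simp
    also have "\<dots> \<le> (\<integral>n. real n powr (- a) * exp (- (real n * (1 / 2))) * exp (- u / 2) \<partial>npos)"
    proof (rule integral_mono)
      show "integrable npos (\<lambda>n. real n powr (- Re s) * exp (- (real n * u)))"
        using u by (intro integrable_npos_powr_exp) auto
      show "integrable npos (\<lambda>n. real n powr (- a) * exp (- (real n * (1 / 2))) * exp (- u / 2))"
        using i by simp
      fix n assume "n \<in> space npos"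
      hence n: "real n \<ge> 1" by simp
      have "(2 * real n - 1) * u \<ge> (2 * real n - 1) * 1" using n u by (intro mult_left_mono) auto
      hence "- (real n * u) \<le> - (real n * (1/2)) + (- u / 2)" using n by (simp add: algebra_simps)
      hence "exp (- (real n * u)) \<le> exp (- (real n * (1/2))) * exp (- u / 2)"
        by (simp flip: exp_add)
      thus "real n powr (- Re s) * exp (- (real n * u)) \<le> real n powr (- a) * exp (- (real n * (1 / 2))) * exp (- u / 2)"
        unfolding mult.assoc using n s by (intro mult_mono powr_mono) auto
    qed
    also have "\<dots> = C * exp (- u / 2)" by (simp add: C_def)
    finally show ?thesis .
  qed
  ultimately show ?thesis by blast
qed

section \<open>The pole of the exponential sum at zero\<close>

lemma lsum_0:
  assumes "Re z > 0"
  shows "lsum 0 z = 1 / (exp z - 1)"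
proof -
  have q: "norm (exp (- z)) < 1" using assms by simp
  have "lsum 0 z = (\<integral>n. exp (- z) ^ n \<partial>npos)"
    unfolding lsum_def
    by (intro Bochner_Integration.integral_cong refl, subst exp_of_nat_mult[symmetric]) simp
  also have "\<dots> = infsetsum (\<lambda>n. exp (- z) ^ n) {1..}" by (simp add: infsetsum_def)
  also have "\<dots> = infsetsum (\<lambda>n. exp (- z) ^ n) (UNIV - {0})"
    by (rule infsetsum_cong) auto
  also have "\<dots> = infsetsum (\<lambda>n. exp (- z) ^ n) UNIV - infsetsum (\<lambda>n. exp (- z) ^ n) {0}"
    using q by (intro infsetsum_Diff) (auto simp: abs_summable_on_nat_iff' norm_power intro!: summable_geometric)
  also have "infsetsum (\<lambda>n. exp (- z) ^ n) UNIV = 1 / (1 - exp (- z))"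
    using q by (subst infsetsum_nat') (auto simp: abs_summable_on_nat_iff' norm_power suminf_geometric intro!: summable_geometric)
  also have "1 / (1 - exp (- z)) - infsetsum (\<lambda>n. exp (- z) ^ n) {0} = 1 / (exp z - 1)"
  proof -
    have "exp z \<noteq> 1" using assms by (metis exp_minus exp_zero inverse_1 norm_one less_irrefl q)
    thus ?thesis by (simp add: exp_minus field_simps)
  qed
  finally show ?thesis .
qed


text \<open>The singularity at \<open>0\<close> is removable and the next zeros of
  \<open>exp z - 1\<close> are at distance \<open>2 pi\<close>, outside the disc. Removing a
  singularity twice gives the function: first \<open>E z = (exp z - 1) / z\<close>, which has no
  zero in the disc, then the difference quotient of \<open>1 / E\<close> at
  \<open>0\<close>.\<close>

lemma exp_reciprocal_minus_pole:
  "\<exists>f. f holomorphic_on ball 0 2 \<and> (\<forall>z\<in>ball 0 2 - {0}. f z = 1 / (exp z - 1) - 1 / (z::complex))"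
proof -
  define E where "E = (\<lambda>z::complex. if z = 0 then deriv exp 0 else (exp z - exp 0) / (z - 0))"
  have E: "E holomorphic_on ball 0 2"
    unfolding E_def by (rule pole_lemma_open) (auto intro!: holomorphic_intros)
  have E0: "E 0 = 1" using DERIV_imp_deriv[OF DERIV_exp[of "0::complex"]] by (simp add: E_def)
  have exp1: "exp z \<noteq> 1" if z: "z \<in> ball 0 2 - {0::complex}" for z
  proof
    assume "exp z = 1"
    then obtain n :: int where n: "Re z = 0" "Im z = of_int (2 * n) * pi" by (auto simp: exp_eq_1)
    have "\<bar>Im z\<bar> < 2" using z abs_Im_le_cmod[of z] by simp
    have "n = 0"
    proof (rule ccontr)
      assume "n \<noteq> 0"
      hence "\<bar>real_of_int (2 * n)\<bar> \<ge> 2" by linarith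
      hence "\<bar>real_of_int (2 * n)\<bar> * pi \<ge> 2 * 3" using pi_gt3 by (intro mult_mono) auto
      moreover have "\<bar>Im z\<bar> = \<bar>real_of_int (2 * n)\<bar> * pi" by (simp add: n(2) abs_mult)
      ultimately show False using \<open>\<bar>Im z\<bar> < 2\<close> by linarith
    qed
    with n z show False by (simp add: complex_eq_iff)
  qed
  have E1: "E z \<noteq> 0" if "z \<in> ball 0 2" for z using exp1[of z] that E0 by (cases "z = 0") (auto simp: E_def)
  have "(\<lambda>z. 1 / E z) holomorphic_on ball 0 2"
    using E E1 by (intro holomorphic_intros)
  from pole_lemma_open[OF this open_ball, of 0] show ?thesis
  proof (intro exI conjI ballI)
    fix z :: complex assume z: "z \<in> ball 0 2 - {0}"
    thus "(if z = 0 then deriv (\<lambda>z. 1 / E z) 0 else (1 / E z - 1 / E 0) / (z - 0)) = 1 / (exp z - 1) - 1 / z"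
      using exp1[OF z] E0 by (simp add: E_def divide_simps)
  qed
qed

text \<open>Up to the sign \<open>(-1)^k\<close>, the difference is the \<open>k\<close>-th
  derivative of \<open>1/(exp z - 1) - 1/z\<close>. It is bounded on \<open>(0, 1]\<close> because
  that function is holomorphic near \<open>0\<close>; for \<open>y \<ge> 1\<close> the sum decays
  exponentially and the power is of order \<open>y^(-k-1)\<close>. The weight on the right is small
  enough at infinity to be integrable against \<open>y^(s+k-1)\<close> whenever
  \<open>- k < Re s < 1\<close>.\<close>

lemma lsum_minus_pole_bound:
  "\<exists>C\<ge>0. \<forall>y>0. norm (lsum (- of_nat k) (of_real y) - fact k / of_real y ^ Suc k) \<le> C / (1 + y) ^ Suc k"
proof -
  obtain f :: "complex \<Rightarrow> complex" where f: "f holomorphic_on ball 0 2"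
    "\<And>z. z \<in> ball 0 2 - {0} \<Longrightarrow> f z = 1 / (exp z - 1) - 1 / z"
    using exp_reciprocal_minus_pole by blast
  define U where "U = ball 0 2 \<inter> {z::complex. Re z > 0}"
  have U: "open U" unfolding U_def by (intro open_Int open_ball open_Re_gt)
  have hd: "(deriv ^^ k) f z = (-1) ^ k * (lsum (- of_nat k) z - fact k / z ^ Suc k)" if "z \<in> U" for z
    using that
  proof (induction k arbitrary: z)
    case 0
    hence "z \<noteq> 0" by (auto simp: U_def)
    thus ?case using f(2)[of z] 0 by (auto simp: U_def lsum_0)
  next
    case (Suc k)
    have z: "Re z > 0" "z \<noteq> 0" using Suc.prems by (auto simp: U_def)
    have "(deriv ^^ Suc k) f z = deriv ((deriv ^^ k) f) z" by simp
    also have "\<dots> = deriv (\<lambda>z. (-1) ^ k * (lsum (- of_nat k) z - fact k / z ^ Suc k)) z"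
      by (intro deriv_cong_ev refl eventually_mono[OF eventually_nhds_in_open[OF U Suc.prems]] Suc.IH)
    also have "\<dots> = (-1) ^ k * (- lsum (- of_nat k - 1) z - (- (fact k * (of_nat (Suc k) * z ^ k)) / (z ^ Suc k * z ^ Suc k)))"
    proof (rule DERIV_imp_deriv, rule DERIV_cmult, rule DERIV_diff)
      show "(lsum (- of_nat k) has_field_derivative - lsum (- of_nat k - 1) z) (at z)"
        by (rule has_field_derivative_lsum[OF z(1)])
      have "((\<lambda>z. fact k / z ^ Suc k) has_field_derivative
              (0 * z ^ Suc k - fact k * (of_nat (Suc k) * (1 * z ^ (Suc k - Suc 0)))) / (z ^ Suc k * z ^ Suc k)) (at z)"
        using z by (intro DERIV_divide DERIV_const DERIV_power DERIV_ident power_not_zero)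
      thus "((\<lambda>z. fact k / z ^ Suc k) has_field_derivative - (fact k * (of_nat (Suc k) * z ^ k)) / (z ^ Suc k * z ^ Suc k)) (at z)"
        by (simp only: mult_zero_left mult_1_left diff_0 diff_Suc_Suc diff_zero)
    qed
    also have "- (fact k * (of_nat (Suc k) * z ^ k)) / (z ^ Suc k * z ^ Suc k) = - (fact (Suc k) / z ^ Suc (Suc k))"
      using z by (simp add: field_simps)
    also have "- of_nat k - 1 = (- of_nat (Suc k) :: complex)" by simp
    finally have "(deriv ^^ Suc k) f z = (-1) ^ k * (- lsum (- of_nat (Suc k)) z - - (fact (Suc k) / z ^ Suc (Suc k)))" .
    moreover have "c * (- a - - b) = (- 1 * c) * (a - b)" for a b c :: complex
      by (simp add: algebra_simps)
    ultimately show ?case by (simp only: power_Suc)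
  qed
  have "(deriv ^^ k) f holomorphic_on ball 0 2" by (intro holomorphic_higher_deriv f open_ball)
  hence "continuous_on (cball 0 1) ((deriv ^^ k) f)"
    by (intro holomorphic_on_imp_continuous_on) (auto elim: holomorphic_on_subset)
  hence "bounded ((deriv ^^ k) f ` cball 0 1)"
    by (intro compact_imp_bounded compact_continuous_image) auto
  then obtain B where B: "B > 0" "\<And>z. z \<in> cball 0 1 \<Longrightarrow> norm ((deriv ^^ k) f z) \<le> B"
    by (auto simp: bounded_pos)
  obtain C where C: "C \<ge> 0" "\<And>u. u \<ge> 1 \<Longrightarrow> norm (lsum (- of_nat k) (of_real u)) \<le> C * exp (- u / 2)"
    using lsum_exp_decay[of "- real k"] by fastforce
  obtain D where D: "D \<ge> 0" "\<And>y. y \<ge> 1 \<Longrightarrow> y powr (real (Suc k)) \<le> D * exp (1 / 2 * y)"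
    using powr_le_exp[of "1/2" "real (Suc k)"] by auto
  define C' where "C' = B * 2 ^ Suc k + (C * (D * exp (1/2)) + fact k * 2 ^ Suc k)"
  have "norm (lsum (- of_nat k) (of_real y) - fact k / of_real y ^ Suc k) \<le> C' / (1 + y) ^ Suc k" if y: "y > 0" for y
  proof (cases "y \<le> 1")
    case True
    have "norm (lsum (- of_nat k) (of_real y) - fact k / of_real y ^ Suc k) = norm ((deriv ^^ k) f (of_real y))"
      using hd[of "of_real y"] y True by (simp add: U_def norm_mult norm_power)
    also have "\<dots> \<le> B" using y True by (intro B) auto
    also have "\<dots> * (1 + y) ^ Suc k \<le> B * 2 ^ Suc k"
      using y True B by (intro mult_left_mono power_mono) auto
    hence "B \<le> B * 2 ^ Suc k / (1 + y) ^ Suc k"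
      using y by (subst pos_le_divide_eq) auto
    also have "\<dots> \<le> C' / (1 + y) ^ Suc k"
      using y C(1) D(1) by (intro divide_right_mono) (auto simp: C'_def)
    finally show ?thesis .
  next
    case False
    hence y1: "y \<ge> 1" by simp
    have "(1 + y) ^ Suc k \<le> D * exp (1 / 2 * (1 + y))"
      using D(2)[of "1 + y"] y powr_realpow[of "1 + y" "Suc k"] by (simp only:)
    also have "\<dots> = D * exp (1/2) * exp (y / 2)" by (simp add: exp_add[symmetric] field_simps)
    finally have 1: "exp (- y / 2) * (1 + y) ^ Suc k \<le> D * exp (1/2)"
      by (simp add: exp_minus field_simps)
    have "norm (lsum (- of_nat k) (of_real y)) * (1 + y) ^ Suc k \<le> C * exp (- y / 2) * (1 + y) ^ Suc k"
      using y y1 by (intro mult_right_mono C) auto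
    also have "\<dots> \<le> C * (D * exp (1/2))"
      unfolding mult.assoc by (intro mult_left_mono) (use 1 C in \<open>auto simp: mult_ac\<close>)
    finally have 2: "norm (lsum (- of_nat k) (of_real y)) \<le> C * (D * exp (1/2)) / (1 + y) ^ Suc k"
      using y by (subst pos_le_divide_eq) auto
    have "fact k * (1 + y) ^ Suc k \<le> fact k * (2 * y) ^ Suc k"
      using y1 by (intro mult_left_mono power_mono) auto
    also have "(2 * y) ^ Suc k = 2 ^ Suc k * y ^ Suc k" by (rule power_mult_distrib)
    finally have 3: "fact k / y ^ Suc k \<le> fact k * 2 ^ Suc k / (1 + y) ^ Suc k"
      using y by (simp add: divide_simps mult_ac del: power_Suc)
    have "norm (lsum (- of_nat k) (of_real y) - fact k / of_real y ^ Suc k) \<le>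
          norm (lsum (- of_nat k) (of_real y)) + norm (fact k / of_real y ^ Suc k :: complex)"
      by (rule norm_triangle_ineq4)
    also have "norm (fact k / of_real y ^ Suc k :: complex) = fact k / y ^ Suc k"
      using y by (simp add: norm_divide norm_power norm_mult del: power_Suc)
    also have "norm (lsum (- of_nat k) (of_real y)) + fact k / y ^ Suc k \<le>
                 C * (D * exp (1/2)) / (1 + y) ^ Suc k + fact k * 2 ^ Suc k / (1 + y) ^ Suc k"
      by (intro add_mono 2 3)
    also have "\<dots> = (C * (D * exp (1/2)) + fact k * 2 ^ Suc k) / (1 + y) ^ Suc k"
      by (simp add: add_divide_distrib)
    also have "\<dots> \<le> C' / (1 + y) ^ Suc k"
      using y B(1) by (intro divide_right_mono) (auto simp: C'_def)
    finally show ?thesis .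
  qed
  moreover have "C' \<ge> 0" using B C D by (auto simp: C'_def)
  ultimately show ?thesis by blast
qed


text \<open>Despite its name this is what remains of \<open>lsum\<close> once the leading singular
  term is subtracted.\<close>

definition lpole :: "complex \<Rightarrow> real \<Rightarrow> complex" where
  "lpole s u = lsum s (of_real u) - Gamma (1 - s) * of_real u powr (s - 1)"

text \<open>A Beta integral. Since \<open>k! / (u+y)^(k+1)\<close> is the Laplace transform of
  \<open>v^k exp (- u v)\<close>, it is one more instance of \<open>mellin_laplace\<close>, with
  Lebesgue measure in \<open>v\<close> as the outer measure.\<close>

lemma mellin_inverse_power:
  assumes u: "u > 0" and b: "0 < Re b" "Re b < real k + 1"
  shows "integrable lpos (\<lambda>y. of_real y powr (b - 1) * (fact k / of_real (u + y) ^ Suc k))"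
    and "(\<integral>y. of_real y powr (b - 1) * (fact k / of_real (u + y) ^ Suc k) \<partial>lpos) =
           Gamma b * (Gamma (of_nat k + 1 - b) * of_real u powr (b - of_nat k - 1))"
proof -
  define c where "c = (\<lambda>v. of_real v powr of_nat k * exp (- complex_of_real (u * v)))"
  have c1: "c v * of_real v powr (- b) = of_real v powr (of_nat k + 1 - b - 1) * exp (- complex_of_real (u * v))"
    if "v > 0" for v
    using that by (simp add: c_def powr_diff powr_minus field_simps)
  have inner: "(\<integral>v. c v * exp (- of_real (v * y)) \<partial>lpos) = fact k / of_real (u + y) ^ Suc k" if "y > 0" for y
  proof -
    have "(\<integral>v. c v * exp (- of_real (v * y)) \<partial>lpos) =
          (\<integral>v. of_real v powr ((of_nat k + 1) - 1) * exp (- of_real ((u + y) * v)) \<partial>lpos)"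
      by (intro Bochner_Integration.integral_cong refl)
         (simp add: c_def exp_add[symmetric] algebra_simps flip: exp_add)
    also have "\<dots> = Gamma (of_nat k + 1) * of_real (u + y) powr (- (of_nat k + 1))"
      by (rule Gamma_integral_scaled) (use u that in auto)
    also have "Gamma (of_nat k + 1 :: complex) = fact k" using Gamma_fact[of k, where ?'a = complex] by (simp add: add_ac)
    also have "of_real (u + y) powr (- (of_nat k + 1)) = 1 / (of_real (u + y) ^ Suc k :: complex)"
    proof -
      have "complex_of_real (u + y) \<noteq> 0" using u that by (metis add_pos_pos less_irrefl of_real_eq_0_iff)
      hence "of_real (u + y) powr (of_nat (Suc k)) = (of_real (u + y) ^ Suc k :: complex)"
        by (rule powr_nat'[OF disjI1])
      moreover have "of_real (u + y) powr (- (of_nat k + 1)) = inverse (of_real (u + y) powr (of_nat (Suc k)) :: complex)"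
        unfolding powr_minus[symmetric] by (simp add: add_ac)
      ultimately show ?thesis by (simp add: divide_inverse)
    qed
    finally show ?thesis by simp
  qed
  have m: "c \<in> borel_measurable lpos" "(\<lambda>v. v) \<in> borel_measurable lpos"
    unfolding c_def by (intro measurable_lpos; measurable)+
  have int0: "integrable lpos (\<lambda>v. of_real v powr (of_nat k + 1 - b - 1) * exp (- complex_of_real (u * v)))"
    by (intro Gamma_integral_scaled) (use u b in auto)
  have int: "integrable lpos (\<lambda>v. c v * of_real v powr (- b))"
    by (rule iffD2[OF Bochner_Integration.integrable_cong[OF refl c1] int0]) (simp add: space_restrict_space)
  note M = mellin_laplace[OF sigma_finite_lpos m _ b(1) int inner]
  show "integrable lpos (\<lambda>y. of_real y powr (b - 1) * (fact k / of_real (u + y) ^ Suc k))"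
    by (rule M) (auto simp: space_restrict_space)
  have "(\<integral>y. of_real y powr (b - 1) * (fact k / of_real (u + y) ^ Suc k) \<partial>lpos) = Gamma b * (\<integral>v. c v * of_real v powr (- b) \<partial>lpos)"
    by (rule M) (auto simp: space_restrict_space)
  also have "(\<integral>v. c v * of_real v powr (- b) \<partial>lpos) =
             (\<integral>v. of_real v powr (of_nat k + 1 - b - 1) * exp (- complex_of_real (u * v)) \<partial>lpos)"
    by (intro Bochner_Integration.integral_cong refl c1) (auto simp: space_restrict_space)
  also have "\<dots> = Gamma (of_nat k + 1 - b) * of_real u powr (- (of_nat k + 1 - b))"
    by (rule Gamma_integral_scaled) (use b u in auto)
  finally show "(\<integral>y. of_real y powr (b - 1) * (fact k / of_real (u + y) ^ Suc k) \<partial>lpos) =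
           Gamma b * (Gamma (of_nat k + 1 - b) * of_real u powr (b - of_nat k - 1))"
    by (simp add: algebra_simps)
qed

text \<open>A Weyl fractional integral of order \<open>b\<close>: it raises the exponent from
  \<open>- k\<close> to \<open>b - k\<close> and so interpolates between the integer exponents,
  where the sum is elementary.\<close>

lemma mellin_lsum_shift:
  assumes u: "u > 0" and b: "0 < Re b"
  shows "integrable lpos (\<lambda>y. of_real y powr (b - 1) * lsum (- of_nat k) (of_real (u + y)))"
    and "(\<integral>y. of_real y powr (b - 1) * lsum (- of_nat k) (of_real (u + y)) \<partial>lpos) = Gamma b * lsum (b - of_nat k) (of_real u)"
proof -
  define c where "c = (\<lambda>n::nat. of_nat n powr of_nat k * exp (- (of_nat n * complex_of_real u)))"
  have inner: "(\<integral>n. c n * exp (- of_real (real n * y)) \<partial>npos) = lsum (- of_nat k) (of_real (u + y))" for y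
    unfolding lsum_def c_def
    by (intro Bochner_Integration.integral_cong refl) (simp add: algebra_simps flip: exp_add)
  have c1: "c n * of_real (real n) powr (- b) = of_nat n powr (- (b - of_nat k)) * exp (- (of_nat n * of_real u))" if "n \<in> {1..}" for n
    using that by (simp add: c_def powr_diff powr_minus field_simps)
  note M = mellin_laplace_count[OF _ _ b lsum_term_integrable c1 inner]
  show "integrable lpos (\<lambda>y. of_real y powr (b - 1) * lsum (- of_nat k) (of_real (u + y)))"
    "(\<integral>y. of_real y powr (b - 1) * lsum (- of_nat k) (of_real (u + y)) \<partial>lpos) = Gamma b * lsum (b - of_nat k) (of_real u)"
    unfolding lsum_def[of "b - of_nat k"] by (rule M; use u in simp)+
qed

text \<open>
  Writing \<open>n\<^sup>-\<^sup>s\<close> as \<open>1/\<Gamma>(s+k)\<close> times \<open>\<integral> y\<^sup>s\<^sup>+\<^sup>k\<^sup>-\<^sup>1 n\<^sup>k e\<^sup>-\<^sup>n\<^sup>y dy\<close> reduces the behaviour at \<open>u = 0\<close> for a general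
  exponent \<open>s\<close> to the exponent \<open>-k\<close>, where the sum is a derivative of \<open>1/(e\<^sup>u-1)\<close>.
\<close>

lemma lpole_integral:
  assumes u: "u > 0" and s: "- real k < Re s" "Re s < 1"
  shows "Gamma (s + of_nat k) * lpole s u =
     (\<integral>y. of_real y powr (s + of_nat k - 1) * (lsum (- of_nat k) (of_real (u + y)) - fact k / of_real (u + y) ^ Suc k) \<partial>lpos)"
  \<comment> \<open>At \<open>b = s + k\<close> the inverse-power integral yields
    \<open>Gamma (1 - s) * u powr (s - 1)\<close> times \<open>Gamma (s + k)\<close>: precisely the
    singular term that \<open>lpole\<close> subtracts.\<close>
  using mellin_lsum_shift[OF u, of "s + of_nat k" k] mellin_inverse_power[OF u, of "s + of_nat k" k] s
  by (simp add: lpole_def ring_distribs Bochner_Integration.integral_diff algebra_simps)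

lemma powr_between:
  fixes y :: real
  assumes "y > 0" "a \<le> c" "c \<le> b"
  shows "y powr c \<le> y powr a + y powr b"
proof (cases "y \<le> 1")
  case True
  hence "y powr c \<le> y powr a" using assms by (intro powr_mono') auto
  thus ?thesis by (simp add: add_increasing2)
next
  case False
  hence "y powr c \<le> y powr b" using assms by (intro powr_mono) auto
  thus ?thesis by (simp add: add_increasing)
qed

lemma compact_Re_bounds:
  assumes "compact K" "K \<noteq> {}" 
  obtains s0 s1 where "s0 \<in> K" "s1 \<in> K" "\<And>s. s \<in> K \<Longrightarrow> Re s0 \<le> Re s" "\<And>s. s \<in> K \<Longrightarrow> Re s \<le> Re s1"
proof -
  have c: "continuous_on K Re" by (intro continuous_intros)
  from continuous_attains_inf[OF assms c] continuous_attains_sup[OF assms c] show ?thesis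
    using that by blast
qed

text \<open>Uniformity over compact sets of \<open>s\<close> is what later allows differentiation in
  \<open>s\<close> under the integral. The integrand of the representation is dominated by the sum
  of its majorants at the smallest and the largest real part, and the factor
  \<open>Gamma (s + k)\<close> is divided out by the entire function \<open>rGamma\<close>.\<close>

lemma lpole_bounded:
  assumes K: "compact K" "K \<subseteq> {s. Re s < 1}"
  shows "\<exists>C\<ge>0. \<forall>s\<in>K. \<forall>u>0. norm (lpole s u) \<le> C"
proof (cases "K = {}")
  case False
  obtain s0 s1 where s: "s0 \<in> K" "s1 \<in> K" "\<And>s. s \<in> K \<Longrightarrow> Re s0 \<le> Re s" "\<And>s. s \<in> K \<Longrightarrow> Re s \<le> Re s1"
    using compact_Re_bounds[OF K(1) False] by blast
  \<comment> \<open>One \<open>k\<close> for all of \<open>K\<close>: the integral representation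
    requires \<open>- k < Re s\<close>.\<close>
  obtain k :: nat where k: "real k > - Re s0" using reals_Archimedean2 by blast
  obtain C where C: "C \<ge> 0" "\<And>y. y > 0 \<Longrightarrow> norm (lsum (- of_nat k) (of_real y) - fact k / of_real y ^ Suc k) \<le> C / (1 + y) ^ Suc k"
    using lsum_minus_pole_bound[of k] by auto
  have "bounded ((\<lambda>s. rGamma (s + of_nat k)) ` K)"
    by (intro compact_imp_bounded compact_continuous_image K holomorphic_on_imp_continuous_on holomorphic_intros)
  then obtain B where B: "B > 0" "\<And>s. s \<in> K \<Longrightarrow> norm (rGamma (s + of_nat k)) \<le> B"
    by (auto simp: bounded_pos)
  define G where "G = (\<lambda>y. C * (y powr (Re s0 + k - 1) * (1 / (1 + y) ^ Suc k) + y powr (Re s1 + k - 1) * (1 / (1 + y) ^ Suc k)))"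
  have int: "integrable lpos (\<lambda>y. y powr (a + k - 1) * (1 / (1 + y) ^ Suc k))" if a: "- real k < a" "a < 1" for a
  proof -
    have "integrable lpos (\<lambda>y. inverse (fact k) * norm (of_real y powr (of_real (a + k) - 1) * (fact k / of_real (1 + y) ^ Suc k) :: complex))"
      by (intro integrable_norm integrable_mult_right mellin_inverse_power) (use a in auto)
    thus ?thesis
      by (rule iffD1[OF Bochner_Integration.integrable_cong, rotated 2])
         (auto simp: space_restrict_space norm_mult norm_divide norm_power norm_powr_real_powr
               simp del: power_Suc of_real_add)
  qed
  have "Re s0 < 1" "Re s1 < 1" "Re s0 \<le> Re s1" using s K by auto
  hence intG: "integrable lpos G"
    unfolding G_def using k by (intro integrable_mult_right Bochner_Integration.integrable_add int) auto
  have "norm (lpole s u) \<le> B * (\<integral>y. G y \<partial>lpos)" if sK: "s \<in> K" and u: "u > 0" for s u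
  proof -
    have sr: "- real k < Re s" "Re s < 1" using s(3)[OF sK] k sK K by auto
    have nz: "rGamma (s + of_nat k) * Gamma (s + of_nat k) = 1"
    proof -
      have "s + of_nat k \<notin> \<int>\<^sub>\<le>\<^sub>0" using sr by (auto elim!: nonpos_Ints_cases simp: complex_eq_iff)
      thus ?thesis by (simp add: rGamma_inverse_Gamma Gamma_eq_zero_iff)
    qed
    define J where "J = (\<integral>y. of_real y powr (s + of_nat k - 1) * (lsum (- of_nat k) (of_real (u + y)) - fact k / of_real (u + y) ^ Suc k) \<partial>lpos)"
    have "lpole s u = rGamma (s + of_nat k) * (Gamma (s + of_nat k) * lpole s u)"
      using nz by (simp flip: mult.assoc)
    also have "Gamma (s + of_nat k) * lpole s u = J" unfolding J_def by (rule lpole_integral[OF u sr])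
    finally have "norm (lpole s u) = norm (rGamma (s + of_nat k)) * norm J" by (simp add: norm_mult)
    moreover have "norm J \<le> (\<integral>y. G y \<partial>lpos)"
    proof -
      have "norm J \<le> (\<integral>y. norm (of_real y powr (s + of_nat k - 1) * (lsum (- of_nat k) (of_real (u + y)) - fact k / of_real (u + y) ^ Suc k)) \<partial>lpos)"
        unfolding J_def by (rule integral_norm_bound)
      also have "\<dots> \<le> (\<integral>y. G y \<partial>lpos)"
      proof (rule integral_mono'[OF intG])
        fix y assume "y \<in> space lpos"
        hence y: "y > 0" by (simp add: space_restrict_space)
        have "y powr (Re s + k - 1) \<le> y powr (Re s0 + k - 1) + y powr (Re s1 + k - 1)"
          using s(3,4)[OF sK] y by (intro powr_between) auto
        moreover have "norm (lsum (- of_nat k) (of_real (u + y)) - fact k / of_real (u + y) ^ Suc k) \<le> C * (1 / (1 + y) ^ Suc k)"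
        proof -
          \<comment> \<open>Dropping \<open>u\<close> from the denominator makes the majorant
            \<open>G\<close> independent of \<open>u\<close>, hence the bound holds for all
            \<open>u > 0\<close> at once.\<close>
          have "norm (lsum (- of_nat k) (of_real (u + y)) - fact k / of_real (u + y) ^ Suc k) \<le> C / (1 + (u + y)) ^ Suc k"
            using u y by (intro C) auto
          also have "\<dots> \<le> C / (1 + y) ^ Suc k"
            using u y C(1) by (intro divide_left_mono power_mono mult_pos_pos zero_less_power) auto
          finally show ?thesis by simp
        qed
        ultimately have "norm (of_real y powr (s + of_nat k - 1) * (lsum (- of_nat k) (of_real (u + y)) - fact k / of_real (u + y) ^ Suc k))
          \<le> (y powr (Re s0 + k - 1) + y powr (Re s1 + k - 1)) * (C * (1 / (1 + y) ^ Suc k))"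
          using y unfolding norm_mult by (intro mult_mono) (auto simp: norm_powr_real_powr)
        also have "\<dots> = G y" by (simp add: G_def algebra_simps)
        finally show "norm (of_real y powr (s + of_nat k - 1) * (lsum (- of_nat k) (of_real (u + y)) - fact k / of_real (u + y) ^ Suc k)) \<le> G y" .
      qed (use C(1) in \<open>auto simp: G_def space_restrict_space intro!: mult_nonneg_nonneg add_nonneg_nonneg\<close>)
      finally show ?thesis .
    qed
    ultimately show ?thesis using B(2)[OF sK] B(1) by (simp add: mult_mono)
  qed
  moreover have "B * (\<integral>y. G y \<partial>lpos) \<ge> 0"
    using B C(1) by (intro mult_nonneg_nonneg integral_nonneg_AE AE_I2)
      (auto simp: G_def space_restrict_space intro!: mult_nonneg_nonneg add_nonneg_nonneg)
  ultimately show ?thesis by blast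
qed auto

section \<open>Remainders and the zeta function\<close>

text \<open>
  The remainder of order \<open>K\<close> is a \<open>K\<close>-fold integral of \<^term>\<open>lpole\<close> at \<open>s - K\<close>.  In this form it is
  visibly holomorphic at \<open>s = 1, \<dots>, K\<close>, where the terms of the expansion themselves have poles.
\<close>

fun lrem :: "nat \<Rightarrow> complex \<Rightarrow> real \<Rightarrow> complex" where
  "lrem 0 s u = lpole s u"
| "lrem (Suc K) s u = - (\<integral>y. indicator {..u} y *\<^sub>R lrem K (s - 1) y \<partial>lpos)"

lemma measurable_lpos_continuous:
  "continuous_on {0<..} f \<Longrightarrow> f \<in> borel_measurable lpos"
  using borel_measurable_continuous_on_restrict[of "{0<..}" f]
  by (simp cong: measurable_cong_sets add: sets_restrict_space)

lemma has_vector_derivative_lsum: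
  assumes "u > 0"
  shows "((\<lambda>u. lsum s (of_real u)) has_vector_derivative - lsum (s - 1) (of_real u)) (at u)"
  by (rule has_vector_derivative_real_field[OF has_field_derivative_lsum]) (use assms in auto)

lemma has_vector_derivative_powr_of_real:
  fixes u :: real and c :: complex
  assumes "u > 0"
  shows "((\<lambda>u. of_real u powr c) has_vector_derivative c * of_real u powr (c - 1)) (at u)"
proof -
  have "complex_of_real u \<notin> \<real>\<^sub>\<le>\<^sub>0" using assms by (auto simp: complex_nonpos_Reals_iff)
  thus ?thesis
    by (intro has_vector_derivative_real_field has_field_derivative_powr)
qed

lemma continuous_lpole: "continuous_on {0<..} (lpole s)"
proof -
  have 1: "continuous_on {0<..} (\<lambda>u. lsum s (of_real u))"
    by (rule continuous_on_vector_derivative[where f' = "\<lambda>u. - lsum (s - 1) (of_real u)"])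
       (simp add: has_vector_derivative_at_within has_vector_derivative_lsum)
  have 2: "continuous_on {0<..} (\<lambda>u. complex_of_real u powr (s - 1))"
    by (rule continuous_on_vector_derivative[where f' = "\<lambda>u. (s - 1) * of_real u powr (s - 1 - 1)"])
       (rule has_vector_derivative_at_within, rule has_vector_derivative_powr_of_real, simp)
  show ?thesis unfolding lpole_def[abs_def] by (intro continuous_intros 1 2)
qed

lemma holomorphic_lpole:
  assumes "u > 0"
  shows "(\<lambda>s. lpole s u) holomorphic_on {s. Re s < 1}"
proof -
  have "1 - s \<notin> \<int>\<^sub>\<le>\<^sub>0" if "Re s < 1" for s
    using that by (auto elim!: nonpos_Ints_cases simp: complex_eq_iff)
  moreover have "(\<lambda>s. lsum s (of_real u)) holomorphic_on {s. Re s < 1}"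
    by (rule holomorphic_on_subset[OF holomorphic_lsum]) (use assms in auto)
  ultimately show ?thesis
    unfolding lpole_def[abs_def] using assms by (intro holomorphic_intros) auto
qed

text \<open>One integration step of the remainder. The growth bound gains a power of
  \<open>u\<close>; the factor \<open>1 / (K + 1)\<close> that integration would also give is
  discarded.\<close>

lemma has_vector_derivative_integral_lpos:
  fixes f :: "real \<Rightarrow> complex"
  assumes cont: "continuous_on {0<..} f" and bound: "\<And>u. u > 0 \<Longrightarrow> norm (f u) \<le> C * u ^ K" and u: "u > 0"
  shows "((\<lambda>u. \<integral>y. indicator {..u} y *\<^sub>R f y \<partial>lpos) has_vector_derivative f u) (at u)"
    and "norm (\<integral>y. indicator {..u} y *\<^sub>R f y \<partial>lpos) \<le> C * u ^ Suc K"
    and "integrable lpos (\<lambda>y. indicator {..u} y *\<^sub>R f y)"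
proof -
  have C: "C \<ge> 0" using order.trans[OF norm_ge_zero bound[of 1]] by simp
  have m: "f \<in> borel_measurable lpos" by (rule measurable_lpos_continuous[OF cont])
  have eq: "integral\<^sup>L lpos (\<lambda>y. indicator {..v} y *\<^sub>R f y) = (LINT y:{0<..v}|lborel. f y)" for v
    unfolding integral_lpos set_lebesgue_integral_def
    by (intro Bochner_Integration.integral_cong) (auto simp: indicator_def)
  have domi: "integrable lpos (\<lambda>y. indicator {..v} y *\<^sub>R (C * v ^ K))" for v
    unfolding integrable_lpos_iff set_integrable_def
  proof (rule Bochner_Integration.integrable_cong[THEN iffD1, OF refl])
    show "integrable lborel (\<lambda>y. indicator {0<..v} y *\<^sub>R (C * v ^ K))"
    proof (intro integrable_scaleR_left integrable_real_indicator)
      show "emeasure lborel {0<..v} < \<infinity>" by (rule emeasure_bounded_finite) simp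
    qed auto
  qed (auto simp: indicator_def)
  have bd: "norm (indicator {..v} y *\<^sub>R f y) \<le> indicator {..v} y *\<^sub>R (C * v ^ K)" if "y \<in> space lpos" for y v
  proof -
    have y: "y > 0" using that by (simp add: space_restrict_space)
    show ?thesis
    proof (cases "y \<le> v")
      case True
      have "norm (f y) \<le> C * y ^ K" by (rule bound[OF y])
      also have "\<dots> \<le> C * v ^ K" using True y C by (intro mult_left_mono power_mono) auto
      finally show ?thesis using True by simp
    qed auto
  qed
  have mi: "(\<lambda>y. indicator {..v} y *\<^sub>R f y) \<in> borel_measurable lpos" for v
    by (intro borel_measurable_scaleR m measurable_lpos) auto
  have int: "integrable lpos (\<lambda>y. indicator {..v} y *\<^sub>R f y)" for v
  proof (rule Bochner_Integration.integrable_bound[OF domi[of v] mi], rule AE_I2)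
    fix y :: real assume "y \<in> space lpos"
    from bd[OF this, of v] show "norm (indicator {..v} y *\<^sub>R f y) \<le> norm (indicator {..v} y *\<^sub>R (C * v ^ K))"
      by (rule order.trans) (simp only: real_norm_def abs_ge_self)
  qed
  show "integrable lpos (\<lambda>y. indicator {..u} y *\<^sub>R f y)" by (rule int)
  have intb: "set_integrable lborel {0<..v} f" for v
    using int[of v] unfolding integrable_lpos_iff set_integrable_def
    by (rule Bochner_Integration.integrable_cong[THEN iffD1, OF refl, rotated]) (auto simp: indicator_def)
  have "norm (\<integral>y. indicator {..u} y *\<^sub>R f y \<partial>lpos) \<le> (\<integral>y. norm (indicator {..u} y *\<^sub>R f y) \<partial>lpos)"
    by (rule integral_norm_bound)
  also have "\<dots> \<le> (\<integral>y. indicator {..u} y *\<^sub>R (C * u ^ K) \<partial>lpos)"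
    by (rule integral_mono[OF integrable_norm[OF int] domi bd])
  also have "\<dots> = (\<integral>y. indicator {0<..u} y *\<^sub>R (C * u ^ K) \<partial>lborel)"
    unfolding integral_lpos set_lebesgue_integral_def
    by (intro Bochner_Integration.integral_cong) (auto simp: indicator_def)
  also have "\<dots> = C * u ^ Suc K" using u by simp
  finally show "norm (\<integral>y. indicator {..u} y *\<^sub>R f y \<partial>lpos) \<le> C * u ^ Suc K" .
  \<comment> \<open>\<open>f\<close> is continuous only on the open half-line, so the part up to
    \<open>a\<close> is kept as a constant and the fundamental theorem is applied on
    \<open>[a, u + 1]\<close>, which contains \<open>u\<close> in its interior.\<close>
  define a where "a = u / 2"
  have a: "0 < a" "a < u" using u by (auto simp: a_def)
  have split: "(\<integral>y. indicator {..v} y *\<^sub>R f y \<partial>lpos) = (LINT y:{0<..a}|lborel. f y) + (LBINT y=a..v. f y)"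
    if "v \<ge> a" for v
  proof -
    have "{0<..v} = {0<..a} \<union> {a<..v}" using a that by auto
    moreover have "set_integrable lborel {a<..v} f"
      using intb[of v] by (rule set_integrable_subset) (use a in auto)
    ultimately have "(LINT y:{0<..v}|lborel. f y) = (LINT y:{0<..a}|lborel. f y) + (LINT y:{a<..v}|lborel. f y)"
      using intb[of a] by (simp add: set_integral_Un)
    thus ?thesis unfolding eq using interval_integral_Ioc[of a v f] that by simp
  qed
  have "((\<lambda>v. LBINT y=a..v. f y) has_vector_derivative f u) (at u within {a..u+1})"
    by (rule interval_integral_FTC2[of a a "u+1"])
       (use a in \<open>auto intro!: continuous_on_subset[OF cont]\<close>)
  hence "((\<lambda>v. LBINT y=a..v. f y) has_vector_derivative f u) (at u within {a<..<u+1})"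
    by (rule has_vector_derivative_within_subset) auto
  hence "((\<lambda>v. LBINT y=a..v. f y) has_vector_derivative f u) (at u)"
    using a by (subst (asm) at_within_open) auto
  hence "((\<lambda>v. (LINT y:{0<..a}|lborel. f y) + (LBINT y=a..v. f y)) has_vector_derivative f u) (at u)"
    by (auto intro!: derivative_eq_intros)
  thus "((\<lambda>u. \<integral>y. indicator {..u} y *\<^sub>R f y \<partial>lpos) has_vector_derivative f u) (at u)"
    by (rule has_vector_derivative_transform_within_open[where S = "{a<..}"])
       (use a split in auto)
qed

text \<open>The three properties are proved together: for the next integral, continuity gives
  measurability, and the bound on compact sets of \<open>s\<close> is the domination under which
  holomorphy passes through the integral.\<close>

lemma lrem_props:
  shows lrem_continuous: "Re s < real K + 1 \<Longrightarrow> continuous_on {0<..} (lrem K s)"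
    and lrem_bounded: "compact T \<Longrightarrow> T \<subseteq> {s. Re s < real K + 1} \<Longrightarrow>
           \<exists>C\<ge>0. \<forall>s\<in>T. \<forall>u>0. norm (lrem K s u) \<le> C * u ^ K"
    and lrem_holomorphic: "u > 0 \<Longrightarrow> (\<lambda>s. lrem K s u) holomorphic_on {s. Re s < real K + 1}"
proof (induction K arbitrary: s T u)
  case 0
  {
    case 1 thus ?case using continuous_lpole by simp
  next
    case 2 thus ?case using lpole_bounded[of T] by simp
  next
    case 3 thus ?case using holomorphic_lpole[of u] by simp
  }
next
  case (Suc K)
  have bnd1: "\<exists>C. \<forall>u>0. norm (lrem K s u) \<le> C * u ^ K" if "Re s < real K + 1" for s
    using Suc.IH(2)[of "{s}"] that by auto
  {
    case 1
    hence s1: "Re (s - 1) < real K + 1" by simp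
    obtain C where C: "\<And>u. u > 0 \<Longrightarrow> norm (lrem K (s - 1) u) \<le> C * u ^ K" using bnd1[OF s1] by auto
    have "((\<lambda>u. - (\<integral>y. indicator {..u} y *\<^sub>R lrem K (s - 1) y \<partial>lpos)) has_vector_derivative - lrem K (s - 1) u) (at u)"
      if "u > 0" for u
      by (rule has_vector_derivative_minus, rule has_vector_derivative_integral_lpos(1)[OF Suc.IH(1)[OF s1] C that])
    thus ?case
      by (intro continuous_on_vector_derivative[where f' = "\<lambda>u. - lrem K (s - 1) u"])
         (simp add: has_vector_derivative_at_within)
  next
    case 2
    have "compact ((\<lambda>s. s - 1) ` T)" by (intro compact_continuous_image continuous_intros 2)
    moreover have "(\<lambda>s. s - 1) ` T \<subseteq> {s. Re s < real K + 1}" using 2 by auto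
    ultimately obtain C where C: "C \<ge> 0" "\<And>s u. s \<in> T \<Longrightarrow> u > 0 \<Longrightarrow> norm (lrem K (s - 1) u) \<le> C * u ^ K"
      using Suc.IH(2)[of "(\<lambda>s. s - 1) ` T"] by auto
    have "norm (lrem (Suc K) s u) \<le> C * u ^ Suc K" if "s \<in> T" "u > 0" for s u
    proof -
      have "Re (s - 1) < real K + 1" using that 2 by auto
      thus ?thesis
        using has_vector_derivative_integral_lpos(2)[OF Suc.IH(1) C(2)[OF that(1)] that(2)] by simp
    qed
    thus ?case using C(1) by blast
  next
    case 3
    have "(\<lambda>s. \<integral>y. indicator {..u} y *\<^sub>R lrem K (s - 1) y \<partial>lpos) holomorphic_on {s. Re s < real (Suc K) + 1}"
    proof (rule integral_holomorphic_dominated)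
      show "open {s. Re s < real (Suc K) + 1}" by (rule open_halfspace_Re_lt)
      fix s assume s: "s \<in> {s. Re s < real (Suc K) + 1}"
      show "(\<lambda>y. indicator {..u} y *\<^sub>R lrem K (s - 1) y) \<in> borel_measurable lpos"
        using s by (intro borel_measurable_scaleR measurable_lpos_continuous[OF Suc.IH(1)] measurable_lpos) auto
      obtain e where e: "e > 0" "cball s e \<subseteq> {s. Re s < real (Suc K) + 1}"
        using s open_halfspace_Re_lt[of "real (Suc K) + 1"] by (meson open_contains_cball)
      have "compact ((\<lambda>s. s - 1) ` cball s e)" by (intro compact_continuous_image continuous_intros) auto
      moreover have "(\<lambda>s. s - 1) ` cball s e \<subseteq> {s. Re s < real K + 1}" using e(2) by auto
      ultimately obtain C where C: "C \<ge> 0" "\<And>w y. w \<in> cball s e \<Longrightarrow> y > 0 \<Longrightarrow> norm (lrem K (w - 1) y) \<le> C * y ^ K"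
        using Suc.IH(2)[of "(\<lambda>s. s - 1) ` cball s e"] by blast
      show "\<exists>e>0. \<exists>G. integrable lpos G \<and> (\<forall>w\<in>ball s e. \<forall>y\<in>space lpos.
              norm (indicator {..u} y *\<^sub>R lrem K (w - 1) y) \<le> G y)"
      proof (intro exI[of _ e] conjI exI[of _ "\<lambda>y. norm (indicator {..u} y *\<^sub>R complex_of_real (C * y ^ K))"] ballI e)
        show "integrable lpos (\<lambda>y. norm (indicator {..u} y *\<^sub>R complex_of_real (C * y ^ K)))"
          by (intro integrable_norm has_vector_derivative_integral_lpos(3)[where C = C and K = K] continuous_intros)
             (use C(1) \<open>u > 0\<close> in \<open>auto simp: norm_mult norm_power\<close>)
        fix w y assume "w \<in> ball s e" "y \<in> space lpos"
        thus "norm (indicator {..u} y *\<^sub>R lrem K (w - 1) y) \<le> norm (indicator {..u} y *\<^sub>R complex_of_real (C * y ^ K))"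
          using C(2)[of w y] C(1) by (auto simp: space_restrict_space indicator_def norm_mult norm_power)
      qed
    next
      fix y :: real assume "y \<in> space lpos"
      hence y: "y > 0" by (simp add: space_restrict_space)
      have "(\<lambda>w. lrem K w y) \<circ> (\<lambda>s. s - 1) holomorphic_on {s. Re s < real (Suc K) + 1}"
        by (rule holomorphic_on_compose_gen[OF _ Suc.IH(3)[OF y]]) (auto intro!: holomorphic_intros)
      thus "(\<lambda>w. indicator {..u} y *\<^sub>R lrem K (w - 1) y) holomorphic_on {s. Re s < real (Suc K) + 1}"
        unfolding scaleR_conv_of_real by (intro holomorphic_intros) (simp add: o_def)
    qed
    thus ?case by (simp add: holomorphic_on_minus)
  }
qed

lemma has_vector_derivative_lrem_Suc:
  assumes "Re s < real K + 2" "u > 0"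
  shows "(lrem (Suc K) s has_vector_derivative - lrem K (s - 1) u) (at u)"
proof -
  have s: "Re (s - 1) < real K + 1" using assms by simp
  obtain C where C: "\<And>u. u > 0 \<Longrightarrow> norm (lrem K (s - 1) u) \<le> C * u ^ K"
    using lrem_bounded[of "{s - 1}" K] s by auto
  have "((\<lambda>u. - (\<integral>y. indicator {..u} y *\<^sub>R lrem K (s - 1) y \<partial>lpos)) has_vector_derivative - lrem K (s - 1) u) (at u)"
    by (intro has_vector_derivative_minus has_vector_derivative_integral_lpos(1)[OF lrem_continuous[OF s] C assms(2)])
  thus ?thesis by (simp add: lrem.simps(2)[abs_def])
qed

text \<open>This determines the constants of integration below. Order \<open>0\<close> differs:
  \<open>lpole s\<close> has the zeta value as its limit.\<close>

lemma lrem_tendsto_0: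
  assumes "Re s < real K + 1" "K > 0"
  shows "(lrem K s \<longlongrightarrow> 0) (at_right 0)"
proof -
  obtain C where C: "\<And>u. u > 0 \<Longrightarrow> norm (lrem K s u) \<le> C * u ^ K"
    using lrem_bounded[of "{s}" K] assms by auto
  show ?thesis
  proof (rule Lim_null_comparison)
    show "\<forall>\<^sub>F u in at_right 0. norm (lrem K s u) \<le> C * u ^ K"
      using C by (auto simp: eventually_at_right_less eventually_at_filter)
    have "((\<lambda>u. C * u ^ K) \<longlongrightarrow> C * 0 ^ K) (at_right (0::real))" by (intro tendsto_intros)
    moreover have "C * 0 ^ K = 0" using assms(2) by simp
    ultimately show "((\<lambda>u. C * u ^ K) \<longlongrightarrow> 0) (at_right 0)" by (simp only:)
  qed
qed


section \<open>Continuation of the zeta function from the Dirichlet series\<close>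

lemma dirichlet_integrable:
  assumes "Re s > 1"
  shows "integrable npos (\<lambda>n. of_nat n powr (- s))"
proof -
  have "summable (\<lambda>n. norm (of_nat n powr (- s) :: complex))"
    using summable_real_powr_iff[of "- Re s"] assms by (simp add: norm_powr_real_powr)
  hence "integrable (count_space UNIV) (\<lambda>n::nat. of_nat n powr (- s) :: complex)"
    by (simp add: integrable_count_space_nat_iff)
  thus ?thesis by (rule abs_summable_on_subset[unfolded abs_summable_on_def]) auto
qed

lemma dirichlet_integral_eq:
  assumes "Re s > 1"
  shows "(\<integral>n. of_nat n powr (- s) \<partial>npos) = (\<Sum>\<^sub>\<infinity>n\<in>{1::nat..}. 1 / of_nat n powr s)"
proof -
  have "(\<integral>n. of_nat n powr (- s) \<partial>npos) = infsetsum (\<lambda>n. of_nat n powr (- s)) {1..}"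
    by (simp add: infsetsum_def)
  also have "\<dots> = infsum (\<lambda>n. of_nat n powr (- s)) {1..}"
    by (rule infsetsum_infsum) (use dirichlet_integrable[OF assms] in \<open>simp add: abs_summable_on_def\<close>)
  finally show ?thesis by (simp add: powr_minus divide_inverse)
qed

lemma holomorphic_dirichlet: "(\<lambda>s. \<integral>n. of_nat n powr (- s) \<partial>npos) holomorphic_on {s. Re s > 1}"
proof (rule integral_holomorphic_dominated)
  fix s :: complex assume s: "s \<in> {s. Re s > 1}"
  define e where "e = (Re s - 1) / 2"
  have e: "e > 0" using s by (simp add: e_def)
  show "\<exists>e>0. \<exists>G. integrable npos G \<and> (\<forall>w\<in>ball s e. \<forall>n\<in>space npos. norm (of_nat n powr (- w) :: complex) \<le> G n)"
  proof (intro exI[of _ e] conjI exI[of _ "\<lambda>n. norm (of_nat n powr (- of_real (1 + e)) :: complex)"] ballI e)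
    show "integrable npos (\<lambda>n. norm (of_nat n powr (- of_real (1 + e)) :: complex))"
      by (intro integrable_norm dirichlet_integrable) (use e in simp)
    fix w n assume w: "w \<in> ball s e" and n: "n \<in> space npos"
    have "Re s - Re w \<le> norm (s - w)" using complex_Re_le_cmod[of "s - w"] by simp
    hence "1 + e \<le> Re w" using w by (simp add: dist_norm e_def field_simps)
    thus "norm (of_nat n powr (- w) :: complex) \<le> norm (of_nat n powr (- of_real (1 + e)) :: complex)"
      using n powr_mono[of "- Re w" "- (1 + e)" "real n"] by (simp add: norm_powr_real_powr)
  qed
qed (auto intro!: holomorphic_intros open_Re_gt)

lemma lsum_tendsto_dirichlet:
  assumes "Re s > 1"
  shows "((\<lambda>u. lsum s (of_real u)) \<longlongrightarrow> (\<integral>n. of_nat n powr (- s) \<partial>npos)) (at_right 0)"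
  unfolding tendsto_at_iff_sequentially o_def
proof safe
  fix X :: "nat \<Rightarrow> real" assume X: "\<forall>i. X i \<in> {0<..} - {0}" "X \<longlonglongrightarrow> 0"
  show "(\<lambda>i. lsum s (of_real (X i))) \<longlonglongrightarrow> (\<integral>n. of_nat n powr (- s) \<partial>npos)"
    unfolding lsum_def
  proof (rule integral_dominated_convergence[where w = "\<lambda>n. norm (of_nat n powr (- s) :: complex)"])
    show "AE n in npos. (\<lambda>i. of_nat n powr (- s) * exp (- (of_nat n * complex_of_real (X i)))) \<longlonglongrightarrow> of_nat n powr (- s)"
    proof (rule AE_I2)
      fix n :: nat
      have "(\<lambda>i. of_nat n powr (- s) * exp (- (of_nat n * complex_of_real (X i)))) \<longlonglongrightarrow> of_nat n powr (- s) * exp (- (of_nat n * of_real 0))"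
        by (intro tendsto_intros X)
      thus "(\<lambda>i. of_nat n powr (- s) * exp (- (of_nat n * complex_of_real (X i)))) \<longlonglongrightarrow> of_nat n powr (- s)" by simp
    qed
    show "AE n in npos. norm (of_nat n powr (- s) * exp (- (of_nat n * complex_of_real (X i)))) \<le> norm (of_nat n powr (- s) :: complex)" for i
    proof (rule AE_I2)
      fix n :: nat
      have "X i > 0" using X by auto
      thus "norm (of_nat n powr (- s) * exp (- (of_nat n * complex_of_real (X i)))) \<le> norm (of_nat n powr (- s) :: complex)"
        by (simp add: norm_mult mult_left_le)
    qed
  qed (auto intro!: integrable_norm dirichlet_integrable assms simp del: One_nat_def)
qed

lemma powr_tendsto_0:
  assumes "Re c > 0"
  shows "((\<lambda>u. complex_of_real u powr c) \<longlongrightarrow> 0) (at_right 0)"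
proof (rule Lim_null_comparison)
  show "\<forall>\<^sub>F u in at_right 0. norm (complex_of_real u powr c) \<le> u powr Re c"
    by (auto simp: eventually_at_filter norm_powr_real_powr)
  show "((\<lambda>u::real. u powr Re c) \<longlongrightarrow> 0) (at_right 0)"
    using assms by (intro tendsto_powr'[THEN tendsto_eq_rhs] tendsto_intros) (auto simp: eventually_at_filter)
qed

lemma one_minus_nonpos_Ints_iff: "1 - s \<in> \<int>\<^sub>\<le>\<^sub>0 \<longleftrightarrow> s \<in> of_nat ` {1..}" for s :: complex
proof
  assume "1 - s \<in> \<int>\<^sub>\<le>\<^sub>0"
  then obtain n where n: "1 - s = - of_nat n" by (auto elim!: nonpos_Ints_cases')
  hence "s = of_nat (Suc n)" by (simp add: algebra_simps)
  thus "s \<in> of_nat ` {1..}" by (intro image_eqI[of _ _ "Suc n"]) auto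
next
  assume "s \<in> of_nat ` {1..}"
  then obtain n where n: "n \<ge> 1" "s = of_nat n" by auto
  hence "1 - s = - of_nat (n - 1)" by (simp add: of_nat_diff)
  thus "1 - s \<in> \<int>\<^sub>\<le>\<^sub>0" by (metis minus_of_nat_in_nonpos_Ints)
qed

lemma constant_by_derivative:
  fixes f :: "real \<Rightarrow> complex"
  assumes "\<And>u. u > 0 \<Longrightarrow> (f has_vector_derivative 0) (at u)"
  obtains c where "\<And>u. u > 0 \<Longrightarrow> f u = c"
proof -
  have "\<exists>c. \<forall>u\<in>{0<..}. f u = c"
    using has_vector_derivative_zero_constant[of "{0<..}" f] assms
    by (metis convex_real_interval(3) greaterThan_iff has_vector_derivative_at_within)
  thus ?thesis using that by auto
qed

lemma constant_tendsto:
  fixes f :: "real \<Rightarrow> complex"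
  assumes "\<And>u. u > 0 \<Longrightarrow> f u = c" "(f \<longlongrightarrow> l) (at_right 0)"
  shows "c = l"
proof -
  have "(f \<longlongrightarrow> c) (at_right 0)"
    by (rule tendsto_eventually) (use assms(1) in \<open>auto simp: eventually_at_filter\<close>)
  with assms(2) show ?thesis using tendsto_unique trivial_limit_at_right_real by blast
qed

text \<open>
  The constant term of the expansion of order \<open>1\<close>; it does not depend on \<open>u\<close> and continues the zeta
  function to \<open>Re s < 2\<close>.
\<close>

definition zeta_aux :: "complex \<Rightarrow> real \<Rightarrow> complex" where
  "zeta_aux s u = lsum s (of_real u) - Gamma (1 - s) * of_real u powr (s - 1) - lrem 1 s u"

lemma has_vector_derivative_Gamma_powr:
  fixes s :: complex and u :: real
  assumes "s \<notin> of_nat ` {1..}" "u > 0"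
  shows "((\<lambda>u. Gamma (1 - s) * of_real u powr (s - 1)) has_vector_derivative
           - (Gamma (1 - (s - 1)) * of_real u powr (s - 1 - 1))) (at u)"
proof -
  have "((\<lambda>u. Gamma (1 - s) * of_real u powr (s - 1)) has_vector_derivative
          Gamma (1 - s) * ((s - 1) * of_real u powr (s - 1 - 1))) (at u)"
    by (intro has_vector_derivative_mult_right has_vector_derivative_powr_of_real assms)
  moreover have eq: "Gamma (1 - (s - 1)) = (1 - s) * Gamma (1 - s)"
    using Gamma_plus1[of "1 - s"] assms(1) by (simp add: one_minus_nonpos_Ints_iff algebra_simps)
  moreover have "Gamma (1 - s) * ((s - 1) * of_real u powr (s - 1 - 1)) = - (Gamma (1 - (s - 1)) * of_real u powr (s - 1 - 1))"
    unfolding eq by (simp add: algebra_simps)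
  ultimately show ?thesis by simp
qed

lemma Re_of_nat_image: "s \<in> of_nat ` {1..} \<Longrightarrow> Re s < 2 \<Longrightarrow> s = 1" for s :: complex
proof (elim imageE)
  fix n :: nat assume "s = of_nat n" "n \<in> {1..}" "Re s < 2"
  hence "real n < 2" "n \<ge> 1" by auto
  hence "n = 1" by linarith
  thus "s = 1" using \<open>s = of_nat n\<close> by simp
qed

text \<open>The derivative in \<open>u\<close> vanishes identically: differentiating
  \<open>lrem 1 s\<close> gives \<open>- lpole (s - 1)\<close>, and this is exactly the combined
  derivative of the other two terms.\<close>

lemma zeta_aux_const:
  assumes "Re s < 2" "s \<noteq> 1" "u > 0" "v > 0"
  shows "zeta_aux s u = zeta_aux s v"
proof -
  have sN: "s \<notin> of_nat ` {1..}" using Re_of_nat_image[of s] assms by auto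
  have "(zeta_aux s has_vector_derivative 0) (at u)" if u: "u > 0" for u
  proof -
    have "((\<lambda>u. lsum s (of_real u) - Gamma (1 - s) * of_real u powr (s - 1) - lrem 1 s u) has_vector_derivative
       (- lsum (s - 1) (of_real u) - - (Gamma (1 - (s - 1)) * of_real u powr (s - 1 - 1)) - - lrem 0 (s - 1) u)) (at u)"
      unfolding One_nat_def
      by (intro has_vector_derivative_diff has_vector_derivative_lsum has_vector_derivative_Gamma_powr
                has_vector_derivative_lrem_Suc u sN) (use assms in auto)
    thus ?thesis by (simp add: zeta_aux_def[abs_def] lpole_def)
  qed
  then obtain c where "\<And>u. u > 0 \<Longrightarrow> zeta_aux s u = c" using constant_by_derivative by blast
  thus ?thesis using assms by simp
qed

text \<open>The constant is found by letting \<open>u\<close> tend to \<open>0\<close>. In this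
  strip \<open>u powr (s - 1)\<close> and the remainder vanish in the limit, while
  \<open>lsum\<close> tends to the Dirichlet series.\<close>

lemma zeta_aux_eq_dirichlet:
  assumes "1 < Re s" "Re s < 2" "u > 0"
  shows "zeta_aux s u = (\<integral>n. of_nat n powr (- s) \<partial>npos)"
proof (rule constant_tendsto[of "zeta_aux s"])
  show "zeta_aux s v = zeta_aux s u" if "v > 0" for v
    by (rule zeta_aux_const) (use assms that in auto)
  have "(zeta_aux s \<longlongrightarrow> (\<integral>n. of_nat n powr (- s) \<partial>npos) - Gamma (1 - s) * 0 - 0) (at_right 0)"
    unfolding zeta_aux_def[abs_def]
    by (intro tendsto_intros lsum_tendsto_dirichlet powr_tendsto_0 lrem_tendsto_0) (use assms in auto)
  thus "(zeta_aux s \<longlongrightarrow> (\<integral>n. of_nat n powr (- s) \<partial>npos)) (at_right 0)" by simp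
qed

lemma holomorphic_zeta_aux:
  assumes "u > 0"
  shows "(\<lambda>s. zeta_aux s u) holomorphic_on {s. Re s < 2} - {1}"
proof -
  have 1: "1 - s \<notin> \<int>\<^sub>\<le>\<^sub>0" if "s \<in> {s. Re s < 2} - {1}" for s
    using that Re_of_nat_image[of s] by (auto simp: one_minus_nonpos_Ints_iff)
  have 2: "(\<lambda>s. lsum s (of_real u)) holomorphic_on {s. Re s < 2} - {1}"
    by (rule holomorphic_on_subset[OF holomorphic_lsum]) (use assms in auto)
  have 3: "(\<lambda>s. lrem 1 s u) holomorphic_on {s. Re s < 2} - {1}"
    by (rule holomorphic_on_subset[OF lrem_holomorphic]) (use assms in auto)
  show ?thesis unfolding zeta_aux_def using assms 1 by (intro holomorphic_intros 2 3) auto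
qed

text \<open>A witness for the choice in \<open>riemann_zeta\<close> is glued from the Dirichlet
  series on \<open>Re s > 1\<close> and \<open>zeta_aux s 1\<close> on \<open>Re s < 2\<close>. They
  agree on the common strip, and the two domains cover the plane without \<open>1\<close>.\<close>

lemma riemann_zeta_spec:
  shows holomorphic_riemann_zeta: "riemann_zeta holomorphic_on - {1}"
    and riemann_zeta_dirichlet: "Re s > 1 \<Longrightarrow> riemann_zeta s = (\<integral>n. of_nat n powr (- s) \<partial>npos)"
proof -
  define f where "f = (\<lambda>s. if s \<in> {s. Re s > 1} then (\<integral>n. of_nat n powr (- s) \<partial>npos) else zeta_aux s 1)"
  have "f holomorphic_on {s. Re s > 1} \<union> ({s. Re s < 2} - {1})"
    unfolding f_def
  proof (rule holomorphic_on_If_Un)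
    show "(\<lambda>s. \<integral>n. of_nat n powr (- s) \<partial>npos) holomorphic_on {s. Re s > 1}"
      by (rule holomorphic_dirichlet)
    show "(\<lambda>s. zeta_aux s 1) holomorphic_on {s. Re s < 2} - {1}" by (rule holomorphic_zeta_aux) simp
    show "open ({s. Re s < 2} - {1})" by (intro open_Diff open_halfspace_Re_lt) auto
  qed (auto intro!: open_Re_gt zeta_aux_eq_dirichlet[symmetric] simp del: One_nat_def)
  also have "{s. Re s > 1} \<union> ({s. Re s < 2} - {1}) = - {1}" by auto
  finally have "f holomorphic_on - {1} \<and>
     (\<forall>s. Re s > 1 \<longrightarrow> f s = (\<Sum>\<^sub>\<infinity>n\<in>{1::nat..}. 1 / of_nat n powr s))"
    by (auto simp: f_def dirichlet_integral_eq simp del: One_nat_def)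
  hence "riemann_zeta holomorphic_on - {1} \<and>
     (\<forall>s. Re s > 1 \<longrightarrow> riemann_zeta s = (\<Sum>\<^sub>\<infinity>n\<in>{1::nat..}. 1 / of_nat n powr s))"
    unfolding riemann_zeta_def
    by (rule someI[where P = "\<lambda>f. f holomorphic_on - {1} \<and>
     (\<forall>s. Re s > 1 \<longrightarrow> f s = (\<Sum>\<^sub>\<infinity>n\<in>{1::nat..}. 1 / of_nat n powr s))"])
  thus "riemann_zeta holomorphic_on - {1}"
    "Re s > 1 \<Longrightarrow> riemann_zeta s = (\<integral>n. of_nat n powr (- s) \<partial>npos)"
    by (auto simp: dirichlet_integral_eq simp del: One_nat_def)
qed

lemma riemann_zeta_eq_aux:
  assumes "Re s < 2" "s \<noteq> 1" "u > 0"
  shows "riemann_zeta s = zeta_aux s u"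
proof (rule analytic_continuation_open[where f = riemann_zeta and g = "\<lambda>s. zeta_aux s u" and z = s
         and s = "{s. 1 < Re s} \<inter> {s. Re s < 2}" and s' = "{s. Re s < 2} - {1}"])
  show "connected ({s. Re s < 2} - {1})"
    by (intro connected_open_delete convex_connected convex_halfspace_Re_lt open_halfspace_Re_lt) auto
  show "{s. 1 < Re s} \<inter> {s. Re s < 2} \<noteq> {}" proof -
    have "3/2 \<in> {s. 1 < Re s} \<inter> {s. Re s < 2}" by simp
    thus "{s. 1 < Re s} \<inter> {s. Re s < 2} \<noteq> {}" by blast
  qed
  show "riemann_zeta holomorphic_on {s. Re s < 2} - {1}"
    by (rule holomorphic_on_subset[OF holomorphic_riemann_zeta]) auto
  show "(\<lambda>s. zeta_aux s u) holomorphic_on {s. Re s < 2} - {1}" by (rule holomorphic_zeta_aux) fact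
qed (use assms in \<open>auto intro!: open_Int open_Diff open_Re_gt open_halfspace_Re_lt simp: riemann_zeta_dirichlet zeta_aux_eq_dirichlet\<close>)

section \<open>The expansion of the exponential sum at zero\<close>

lemma lsum_expansion_1:
  assumes "Re s < 2" "s \<noteq> 1" "u > 0"
  shows "lsum s (of_real u) = Gamma (1 - s) * of_real u powr (s - 1) + riemann_zeta s + lrem 1 s u"
  using riemann_zeta_eq_aux[OF assms] by (simp add: zeta_aux_def)

lemma has_vector_derivative_minus_power:
  fixes a :: complex and u :: real
  shows "((\<lambda>u. a * (- of_real u) ^ Suc j / fact (Suc j)) has_vector_derivative - (a * (- of_real u) ^ j / fact j)) (at u)"
proof -
  have "((\<lambda>z. a * (- z) ^ Suc j / fact (Suc j)) has_field_derivative
          (a * (of_nat (Suc j) * (- 1 * (- of_real u) ^ (Suc j - Suc 0)))) / fact (Suc j)) (at (of_real u))"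
    by (intro DERIV_cdivide DERIV_cmult DERIV_power DERIV_minus DERIV_ident)
  hence "((\<lambda>u. a * (- of_real u) ^ Suc j / fact (Suc j)) has_vector_derivative
          (a * (of_nat (Suc j) * (- 1 * (- of_real u) ^ (Suc j - Suc 0)))) / fact (Suc j)) (at u)"
    by (rule has_vector_derivative_real_field)
  also have "(a * (of_nat (Suc j) * (- 1 * (- of_real u) ^ (Suc j - Suc 0)))) / fact (Suc j) = - (a * (- of_real u) ^ j / fact j)"
  proof -
    have "b * (c * (- 1 * p)) / (c * f) = - (b * p / f)" if "c \<noteq> 0" for b c p f :: complex
      using that by simp
    note alg = this
    have "fact (Suc j) = (of_nat (Suc j) * fact j :: complex)" by (rule fact_Suc)
    thus ?thesis using alg[OF of_nat_neq_0[of j]] by (metis diff_Suc_Suc diff_zero)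
  qed
  finally show ?thesis .
qed

lemma minus_power_tendsto_0:
  "((\<lambda>u. a * (- complex_of_real u) ^ Suc j / fact (Suc j)) \<longlongrightarrow> 0) (at_right 0)"
proof -
  have "((\<lambda>u. a * (- complex_of_real u) ^ Suc j / fact (Suc j)) \<longlongrightarrow> a * (- complex_of_real 0) ^ Suc j / fact (Suc j)) (at_right 0)"
    by (intro tendsto_intros fact_nonzero)
  thus ?thesis by simp
qed

text \<open>By induction, the \<open>u\<close>-derivative of the claim at \<open>s\<close> is the
  claim at \<open>s - 1\<close>, and the constant is \<open>0\<close> since all terms vanish at
  \<open>0\<close>. The condition on \<open>s\<close> keeps the zeta argument to the left of
  \<open>1\<close>. Positive integers \<open>s\<close> up to \<open>K\<close> are included, so the
  order can be raised at these points too.\<close>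

lemma lrem_diff:
  assumes "Re s < real K + 1" "u > 0"
  shows "lrem K s u - lrem (Suc K) s u = riemann_zeta (s - of_nat K) * (- of_real u) ^ K / fact K"
  using assms
proof (induction K arbitrary: s u)
  case 0
  hence "Re s < 2" "s \<noteq> 1" by auto
  from lsum_expansion_1[OF this 0(2)] show ?case by (simp add: lpole_def)
next
  case (Suc K)
  define z where "z = riemann_zeta (s - of_nat (Suc K))"
  define d where "d = (\<lambda>u. lrem (Suc K) s u - lrem (Suc (Suc K)) s u - z * (- of_real u) ^ Suc K / fact (Suc K))"
  have "(d has_vector_derivative 0) (at u)" if u: "u > 0" for u
  proof -
    have "lrem K (s - 1) u - lrem (Suc K) (s - 1) u = z * (- of_real u) ^ K / fact K"
      using Suc.IH[of "s - 1" u] Suc.prems(1) u by (simp add: z_def algebra_simps)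
    hence e: "0 = - lrem K (s - 1) u - - lrem (Suc K) (s - 1) u - - (z * (- of_real u) ^ K / fact K)"
      by (simp add: algebra_simps)
    show ?thesis
      unfolding d_def e
      by (intro has_vector_derivative_diff has_vector_derivative_lrem_Suc has_vector_derivative_minus_power u)
         (use Suc.prems(1) in auto)
  qed
  then obtain c where c: "\<And>u. u > 0 \<Longrightarrow> d u = c" using constant_by_derivative by blast
  have lim: "(d \<longlongrightarrow> 0 - 0 - 0) (at_right 0)"
    unfolding d_def by (intro tendsto_diff lrem_tendsto_0 minus_power_tendsto_0) (use Suc.prems(1) in auto)
  have "c = 0" using constant_tendsto[OF c lim] by simp
  with c[OF Suc.prems(2)] show ?case by (simp add: d_def z_def del: lrem.simps power_Suc of_nat_Suc fact_Suc)
qed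

text \<open>Positive integers are excluded because there \<open>Gamma (1 - s)\<close> and one zeta
  value are both at a pole.\<close>

lemma lsum_expansion:
  assumes "s \<notin> of_nat ` {1..}" "Re s < real K + 1" "u > 0"
  shows "lsum s (of_real u) = Gamma (1 - s) * of_real u powr (s - 1) +
           (\<Sum>j<K. riemann_zeta (s - of_nat j) * (- of_real u) ^ j / fact j) + lrem K s u"
  using assms
proof (induction K arbitrary: s u)
  case 0
  thus ?case by (simp add: lpole_def)
next
  case (Suc K)
  \<comment> \<open>If the order \<open>K\<close> is already admissible, \<open>lrem_diff\<close>
    splits off one more term. Otherwise the expansion at \<open>s - 1\<close> is integrated; for
    \<open>K > 0\<close> this means \<open>Re s > 1\<close>, so the limit at \<open>u = 0\<close>
    exists and identifies the constant. \<open>K = 0\<close> is the expansion of order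
    \<open>1\<close>.\<close>
  consider "Re s < real K + 1" | "K = 0" | "K > 0" "Re s \<ge> real K + 1" by force
  thus ?case
  proof cases
    case 1
    from lrem_diff[OF 1 Suc.prems(3)] have "lrem K s u = riemann_zeta (s - of_nat K) * (- of_real u) ^ K / fact K + lrem (Suc K) s u"
      by (simp add: algebra_simps)
    with Suc.IH[OF Suc.prems(1) 1 Suc.prems(3)] show ?thesis
      by (simp add: algebra_simps del: lrem.simps)
  next
    case 2
    have "s \<noteq> 1" using Suc.prems(1) by (metis atLeast_iff imageI of_nat_1 order_refl)
    thus ?thesis using lsum_expansion_1[of s u] Suc.prems 2 by simp
  next
    case 3
    define a where "a = (\<lambda>j. riemann_zeta (s - of_nat (Suc j)))"
    have sum: "(\<Sum>j<Suc K. riemann_zeta (s - of_nat j) * (- of_real u) ^ j / fact j) =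
        riemann_zeta s + (\<Sum>j<K. a j * (- of_real u) ^ Suc j / fact (Suc j))" for u
      by (subst sum.lessThan_Suc_shift) (simp add: a_def)
    define d where "d = (\<lambda>u. lsum s (of_real u) - Gamma (1 - s) * of_real u powr (s - 1) -
         (riemann_zeta s + (\<Sum>j<K. a j * (- of_real u) ^ Suc j / fact (Suc j))) - lrem (Suc K) s u)"
    have "(d has_vector_derivative 0) (at u)" if u: "u > 0" for u
    proof -
      have "s - 1 \<notin> of_nat ` {1..}"
      proof
        assume "s - 1 \<in> of_nat ` {1..}"
        then obtain n where "s - 1 = of_nat n" by auto
        hence "s = of_nat (Suc n)" by (simp add: algebra_simps)
        hence "s \<in> of_nat ` {1..}" by (rule image_eqI) auto
        thus False using Suc.prems(1) by contradiction
      qed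
      from Suc.IH[OF this _ u] Suc.prems(2)
      have e: "0 = - lsum (s - 1) (of_real u) - - (Gamma (1 - (s - 1)) * of_real u powr (s - 1 - 1)) -
               (0 + (\<Sum>j<K. - (a j * (- of_real u) ^ j / fact j))) - - lrem K (s - 1) u"
        by (simp add: sum_negf a_def algebra_simps)
      have "(d has_vector_derivative (- lsum (s - 1) (of_real u) - - (Gamma (1 - (s - 1)) * of_real u powr (s - 1 - 1)) -
               (0 + (\<Sum>j<K. - (a j * (- of_real u) ^ j / fact j))) - - lrem K (s - 1) u)) (at u)"
        unfolding d_def
        by (intro has_vector_derivative_diff has_vector_derivative_lsum has_vector_derivative_Gamma_powr
              has_vector_derivative_lrem_Suc has_vector_derivative_minus_power has_vector_derivative_add
              has_vector_derivative_const has_vector_derivative_sum u Suc.prems(1))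
           (use Suc.prems(2) in auto)
      thus ?thesis by (simp only: e[symmetric])
    qed
    then obtain c where c: "\<And>u. u > 0 \<Longrightarrow> d u = c" using constant_by_derivative by blast
    have lim: "(d \<longlongrightarrow> riemann_zeta s - Gamma (1 - s) * 0 - (riemann_zeta s + (\<Sum>j<K. 0)) - 0) (at_right 0)"
      unfolding d_def
      by (intro tendsto_intros lrem_tendsto_0 minus_power_tendsto_0 powr_tendsto_0
            lsum_tendsto_dirichlet[THEN tendsto_eq_rhs])
         (use Suc.prems(2) 3 in \<open>auto simp: riemann_zeta_dirichlet\<close>)
    have "c = 0" using constant_tendsto[OF c lim] by simp
    with c[OF Suc.prems(3)] show ?thesis by (simp add: d_def sum algebra_simps del: lrem.simps sum.lessThan_Suc)
  qed
qed

section \<open>The constant term of zeta at its pole\<close>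

lemma lsum_1: "u > 0 \<Longrightarrow> lsum 1 (of_real u) = - of_real (ln (1 - exp (- u)))"
proof -
  assume u: "u > 0"
  define q where "q = complex_of_real (exp (- u))"
  have q: "norm q < 1" using u by (simp add: q_def)
  have "integrable npos (\<lambda>n. of_nat n powr (- 1) * exp (- (of_nat n * complex_of_real u)))"
    by (rule lsum_term_integrable) (use u in auto)
  hence s: "Infinite_Set_Sum.abs_summable_on (\<lambda>n. of_nat n powr (- 1) * exp (- (of_nat n * complex_of_real u))) {1..}"
    by (simp add: abs_summable_on_def)
  have "lsum 1 (of_real u) = (\<Sum>n. if n \<in> {1..} then of_nat n powr (- 1) * exp (- (of_nat n * complex_of_real u)) else 0)"
    unfolding lsum_def using infsetsum_nat[OF s] by (simp add: infsetsum_def)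
  also have "\<dots> = (\<Sum>n. - (- ((- (- q)) ^ n) / of_nat n))"
  proof (rule suminf_cong)
    fix n :: nat
    have "exp (- (of_nat n * complex_of_real u)) = q ^ n"
      unfolding q_def exp_of_real[symmetric] by (subst exp_of_nat_mult[symmetric]) simp
    thus "(if n \<in> {1..} then of_nat n powr (- 1) * exp (- (of_nat n * complex_of_real u)) else 0) =
            - (- ((- (- q)) ^ n) / of_nat n)"
      by (auto simp: powr_minus divide_inverse not_le)
  qed
  also have "\<dots> = - ln (1 + (- q))"
    using sums_minus[OF Ln_series'[of "- q"]] q by (intro sums_unique[symmetric]) simp
  also have "1 + (- q) = of_real (1 - exp (- u))" by (simp add: q_def)
  also have "ln \<dots> = of_real (ln (1 - exp (- u)))" using u by (intro Ln_of_real) simp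
  finally show ?thesis .
qed

lemma ln_plus_lsum_1_tendsto: "((\<lambda>u. of_real (ln u) + lsum 1 (of_real u)) \<longlongrightarrow> 0) (at_right 0)"
proof -
  have "((\<lambda>u::real. 1 - exp (- u)) has_real_derivative 1) (at 0)"
    by (auto intro!: derivative_eq_intros)
  hence "((\<lambda>u::real. (1 - exp (- u)) / u) \<longlongrightarrow> 1) (at 0)"
    by (simp add: has_field_derivative_iff)
  hence "((\<lambda>u::real. (1 - exp (- u)) / u) \<longlongrightarrow> 1) (at_right 0)"
    by (rule filterlim_mono) (auto simp: at_le)
  hence "((\<lambda>u::real. complex_of_real (- ln ((1 - exp (- u)) / u))) \<longlongrightarrow> of_real (- ln 1)) (at_right 0)"
    by (intro tendsto_intros) auto
  moreover have "\<forall>\<^sub>F u in at_right 0. complex_of_real (- ln ((1 - exp (- u)) / u)) = of_real (ln u) + lsum 1 (of_real u)"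
    unfolding eventually_at_filter by (intro always_eventually) (auto simp: lsum_1 ln_div)
  ultimately show ?thesis by (simp add: filterlim_cong)
qed

text \<open>For every fixed \<open>u\<close>, the order-one expansion expresses the limit as
  \<open>euler_mascheroni + ln u + lsum 1 u - lrem 1 1 u\<close>. A limit is unique, so this value
  does not depend on \<open>u\<close>; letting \<open>u\<close> tend to \<open>0\<close> leaves
  Euler's constant, because \<open>lsum 1 u = - ln (1 - exp (- u))\<close>.\<close>

lemma zeta_minus_pole_tendsto: "((\<lambda>s. riemann_zeta s - 1 / (s - 1)) \<longlongrightarrow> euler_mascheroni) (at 1)"
proof -
  define f where "f = (\<lambda>s. riemann_zeta s - 1 / (s - 1))"
  have lim: "(f \<longlongrightarrow> euler_mascheroni + of_real (ln u) + lsum 1 (of_real u) - lrem 1 1 u) (at 1)" if u: "u > 0" for u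
  proof -
    have ev: "\<forall>\<^sub>F s in at 1. s \<in> {s. Re s < 2} - {1::complex}"
      by (rule eventually_at_in_open) (auto intro!: open_halfspace_Re_lt)
    \<comment> \<open>With \<open>w = 1 - s\<close>, the pole part of
      \<open>Gamma (1 - s) * u powr (s - 1)\<close> becomes a difference quotient at
      \<open>w = 0\<close>; its limit is \<open>Digamma 1 - ln u\<close>.\<close>
    have "((\<lambda>w. Gamma (1 + w) * complex_of_real u powr (- w)) has_field_derivative
             (Gamma 1 * Digamma 1 * 1 - of_real (ln u) * Gamma 1)) (at 0)"
    proof -
      have "of_real u powr (- w) = exp (- w * of_real (ln u))" for w :: complex
        using u by (simp add: powr_def Ln_of_real)
      thus ?thesis by (auto intro!: derivative_eq_intros)
    qed
    hence "((\<lambda>w. (Gamma (1 + w) * complex_of_real u powr (- w) - 1) / w) \<longlongrightarrow> - euler_mascheroni - of_real (ln u)) (at 0)"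
      using u by (simp add: has_field_derivative_iff)
    moreover have "filterlim (\<lambda>s. 1 - s) (at 0) (at (1::complex))"
      by (intro filterlim_atI tendsto_eq_intros) (auto simp: eventually_at_filter)
    ultimately have "((\<lambda>s. (Gamma (1 + (1 - s)) * complex_of_real u powr (- (1 - s)) - 1) / (1 - s)) \<longlongrightarrow> - euler_mascheroni - of_real (ln u)) (at 1)"
      by (rule filterlim_compose)
    hence "((\<lambda>s. - ((Gamma (1 + (1 - s)) * complex_of_real u powr (- (1 - s)) - 1) / (1 - s)) + lsum s (of_real u) - lrem 1 s u)
         \<longlongrightarrow> - (- euler_mascheroni - of_real (ln u)) + lsum 1 (of_real u) - lrem 1 1 u) (at 1)"
    proof (intro tendsto_intros)
      have "isCont (\<lambda>s. lsum s (of_real u)) 1"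
        using holomorphic_on_imp_continuous_on[OF holomorphic_lsum[of "of_real u"]] u
        by (simp add: continuous_on_eq_continuous_at)
      thus "((\<lambda>s. lsum s (of_real u)) \<longlongrightarrow> lsum 1 (of_real u)) (at 1)" by (simp add: isCont_def)
      have "continuous_on {s. Re s < 2} (\<lambda>s. lrem 1 s u)"
        using holomorphic_on_imp_continuous_on[OF lrem_holomorphic[of u 1]] u by (simp del: One_nat_def)
      hence "isCont (\<lambda>s. lrem 1 s u) 1"
        by (rule continuous_on_interior) (simp add: interior_open open_halfspace_Re_lt)
      thus "((\<lambda>s. lrem 1 s u) \<longlongrightarrow> lrem 1 1 u) (at 1)" by (simp add: isCont_def)
    qed
    moreover have "\<forall>\<^sub>F s in at 1. - ((Gamma (1 + (1 - s)) * complex_of_real u powr (- (1 - s)) - 1) / (1 - s)) + lsum s (of_real u) - lrem 1 s u = f s"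
      using ev
    proof eventually_elim
      case (elim s)
      hence s: "Re s < 2" "s \<noteq> 1" by auto
      have "1 - s \<notin> \<int>\<^sub>\<le>\<^sub>0" using Re_of_nat_image[of s] s by (auto simp: one_minus_nonpos_Ints_iff)
      hence G: "Gamma (1 + (1 - s)) = (1 - s) * Gamma (1 - s)"
        using Gamma_plus1[of "1 - s"] by (simp add: add_ac)
      show ?case
        unfolding G f_def using lsum_expansion_1[OF s u] s(2) by (simp add: divide_simps) (simp add: algebra_simps)
    qed
    ultimately show ?thesis by (simp add: filterlim_cong algebra_simps)
  qed
  obtain c where c: "(f \<longlongrightarrow> c) (at 1)" using lim[of 1] by auto
  have eq: "euler_mascheroni + of_real (ln u) + lsum 1 (of_real u) - lrem 1 1 u = c" if "u > 0" for u
    using tendsto_unique[OF _ lim[OF that] c] by simp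
  have "((\<lambda>u. euler_mascheroni + (of_real (ln u) + lsum 1 (of_real u)) - lrem 1 1 u) \<longlongrightarrow> euler_mascheroni + 0 - 0) (at_right 0)"
    by (intro tendsto_intros ln_plus_lsum_1_tendsto lrem_tendsto_0) auto
  hence "c = euler_mascheroni + 0 - 0"
    by (rule constant_tendsto[rotated]) (use eq in \<open>simp add: algebra_simps del: One_nat_def\<close>)
  with c show ?thesis by (simp add: f_def)
qed

section \<open>The Mellin transform of the remainder\<close>

lemma norm_lsum_of_real:
  assumes "u > 0"
  shows "norm (lsum (of_real a) (of_real u)) = (\<integral>n. real n powr (- a) * exp (- (real n * u)) \<partial>npos)"
proof -
  have "lsum (of_real a) (of_real u) = (\<integral>n. complex_of_real (real n powr (- a) * exp (- (real n * u))) \<partial>npos)"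
    unfolding lsum_def
  proof (intro Bochner_Integration.integral_cong refl)
    fix n
    have "of_nat n powr (- of_real a) = complex_of_real (real n powr (- a))"
      by (metis of_nat_0_le_iff of_real_minus of_real_of_nat_eq powr_of_real)
    thus "of_nat n powr (- of_real a) * exp (- (of_nat n * complex_of_real u)) = complex_of_real (real n powr (- a) * exp (- (real n * u)))"
      by (simp flip: exp_of_real)
  qed
  also have "\<dots> = complex_of_real (\<integral>n. real n powr (- a) * exp (- (real n * u)) \<partial>npos)"
    by (rule integral_complex_of_real)
  also have "norm \<dots> = (\<integral>n. real n powr (- a) * exp (- (real n * u)) \<partial>npos)"
    by (simp del: One_nat_def add: integral_nonneg_AE)
  finally show ?thesis .
qed

text \<open>At a real exponent the terms are positive, so the majorant is again a value of
  \<open>lsum\<close>, and its integrability against powers of \<open>u\<close> is an instance of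
  the Mellin transform below.\<close>

lemma norm_lsum_mono:
  assumes "u > 0" "a \<le> Re r"
  shows "norm (lsum r (of_real u)) \<le> norm (lsum (of_real a) (of_real u))"
proof -
  have "norm (lsum r (of_real u)) \<le> (\<integral>n. real n powr (- Re r) * exp (- (real n * u)) \<partial>npos)"
    using norm_lsum_le[of "of_real u" r] assms by simp
  also have "\<dots> \<le> (\<integral>n. real n powr (- a) * exp (- (real n * u)) \<partial>npos)"
    by (intro integral_mono integrable_npos_powr_exp mult_right_mono powr_mono) (use assms in auto)
  finally show ?thesis by (simp only: norm_lsum_of_real[OF assms(1)])
qed

lemma mellin_lsum:
  assumes "Re b > 0" "Re (r + b) > 1"
  shows "integrable lpos (\<lambda>u. of_real u powr (b - 1) * lsum r (of_real u))"
    and "(\<integral>u. of_real u powr (b - 1) * lsum r (of_real u) \<partial>lpos) = Gamma b * riemann_zeta (r + b)"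
proof -
  define c where "c = (\<lambda>n::nat. of_nat n powr (- r) :: complex)"
  have inner: "(\<integral>n. c n * exp (- of_real (real n * u)) \<partial>npos) = lsum r (of_real u)" for u
    unfolding lsum_def c_def by simp
  have c1: "c n * of_real (real n) powr (- b) = of_nat n powr (- (r + b))" if "n \<in> {1..}" for n
    using that by (simp add: c_def powr_diff powr_minus field_simps powr_add)
  note M = mellin_laplace_count[OF _ _ assms(1) dirichlet_integrable[OF assms(2)] c1 inner]
  show "integrable lpos (\<lambda>u. of_real u powr (b - 1) * lsum r (of_real u))"
    "(\<integral>u. of_real u powr (b - 1) * lsum r (of_real u) \<partial>lpos) = Gamma b * riemann_zeta (r + b)"
    unfolding riemann_zeta_dirichlet[OF assms(2)] by (rule M; simp)+
qed

abbreviation mt_integrand :: "nat \<Rightarrow> complex \<Rightarrow> complex \<Rightarrow> complex \<Rightarrow> real \<Rightarrow> real \<Rightarrow> complex" where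
  "mt_integrand K r s t x u \<equiv> of_real u powr (t - 1) * (lsum r (of_real u) * lrem K s (x * u))"

definition mt_rem :: "nat \<Rightarrow> complex \<Rightarrow> complex \<Rightarrow> complex \<Rightarrow> real \<Rightarrow> complex" where
  "mt_rem K r s t x = (\<integral>u. mt_integrand K r s t x u \<partial>lpos)"

text \<open>The first condition is where \<open>lrem K\<close> is controlled. As
  \<open>lrem K s (x * u)\<close> is of order \<open>u^K\<close>, the other two say that
  \<open>u^(t-1+K) * lsum r u\<close> is integrable at \<open>0\<close>; at infinity
  \<open>lsum\<close> decays exponentially.\<close>

definition mt_dom :: "nat \<Rightarrow> (complex \<times> complex \<times> complex) set" where
  "mt_dom K = {(r, s, t). Re s < real K + 1 \<and> Re t + real K > 0 \<and> Re (r + t) + real K > 1}"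

lemma mt_rem_dominated:
  assumes "(r0, s0, t0) \<in> mt_dom K" "x > 0"
  shows "\<exists>e>0. \<exists>G. integrable lpos G \<and> (\<forall>r\<in>ball r0 e. \<forall>s\<in>ball s0 e. \<forall>t\<in>ball t0 e. \<forall>u\<in>space lpos.
           norm (mt_integrand K r s t x u) \<le> G u)"
proof -
  \<comment> \<open>Both \<open>r\<close> and \<open>t\<close> may move by \<open>e\<close>, so
    \<open>Re (r + t)\<close> may drop by \<open>2 * e\<close>; hence the quarter in the last
    entry.\<close>
  define e where "e = min ((real K + 1 - Re s0) / 2) (min ((Re t0 + real K) / 2) ((Re (r0 + t0) + real K - 1) / 4))"
  have e: "e > 0" "e < real K + 1 - Re s0" "e < Re t0 + real K" "2 * e < Re (r0 + t0) + real K - 1"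
    using assms(1) by (auto simp: e_def mt_dom_def min_def)
  have ReD: "Re w - e \<le> Re z" "Re z \<le> Re w + e" if "z \<in> cball w e" for z w
    using that abs_Re_le_cmod[of "w - z"] by (auto simp: dist_norm)
  have "cball s0 e \<subseteq> {s. Re s < real K + 1}" using ReD(2) e(2) by fastforce
  then obtain C where C: "C \<ge> 0" "\<And>s u. s \<in> cball s0 e \<Longrightarrow> u > 0 \<Longrightarrow> norm (lrem K s u) \<le> C * u ^ K"
    using lrem_bounded[of "cball s0 e" K] by auto
  define a b1 b2 where "a = Re r0 - e" and "b1 = Re t0 - e + real K" and "b2 = Re t0 + e + real K"
  have int: "integrable lpos (\<lambda>u. u powr (b - 1) * norm (lsum (of_real a) (of_real u)))" if "b > 0" "a + b > 1" for b
  proof -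
    have "integrable lpos (\<lambda>u. norm (of_real u powr (of_real b - 1) * lsum (of_real a) (of_real u)))"
      by (intro integrable_norm mellin_lsum) (use that in auto)
    thus ?thesis
      by (rule iffD1[OF Bochner_Integration.integrable_cong[OF refl], rotated])
         (auto simp: norm_mult norm_powr_real_powr space_restrict_space)
  qed
  define G where "G = (\<lambda>u. C * x ^ K * (u powr (b1 - 1) * norm (lsum (of_real a) (of_real u)) + u powr (b2 - 1) * norm (lsum (of_real a) (of_real u))))"
  have "integrable lpos G"
    unfolding G_def by (intro integrable_mult_right Bochner_Integration.integrable_add int)
      (use e in \<open>auto simp: a_def b1_def b2_def\<close>)
  moreover have "norm (mt_integrand K r s t x u) \<le> G u"
    if "r \<in> ball r0 e" "s \<in> ball s0 e" "t \<in> ball t0 e" "u \<in> space lpos" for r s t u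
  proof -
    have u: "u > 0" using that by (simp add: space_restrict_space)
    have "norm (mt_integrand K r s t x u) =
          u powr (Re t - 1) * (norm (lsum r (of_real u)) * norm (lrem K s (x * u)))"
      using u by (simp add: norm_mult norm_powr_real_powr)
    also have "\<dots> \<le> u powr (Re t - 1) * (norm (lsum (of_real a) (of_real u)) * (C * (x * u) ^ K))"
      using ReD(1)[of r r0] that u assms(2)
      by (intro mult_left_mono mult_mono norm_lsum_mono C) (auto simp: a_def)
    also have "\<dots> = C * x ^ K * ((u powr (Re t - 1) * u powr real K) * norm (lsum (of_real a) (of_real u)))"
      using u by (simp add: power_mult_distrib powr_realpow)
    also have "u powr (Re t - 1) * u powr real K = u powr (Re t - 1 + real K)" by (simp add: powr_add)
    also have "C * x ^ K * (u powr (Re t - 1 + real K) * norm (lsum (of_real a) (of_real u))) \<le>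
               C * x ^ K * ((u powr (b1 - 1) + u powr (b2 - 1)) * norm (lsum (of_real a) (of_real u)))"
      using ReD[of t t0] that u assms(2) C(1)
      by (intro mult_left_mono mult_right_mono powr_between) (auto simp: b1_def b2_def)
    also have "\<dots> = G u" by (simp add: G_def algebra_simps)
    finally show ?thesis .
  qed
  ultimately show ?thesis using e(1) by blast
qed

lemma mt_integrand_measurable:
  assumes "Re s < real K + 1" "x > 0"
  shows "(\<lambda>u. mt_integrand K r s t x u) \<in> borel_measurable lpos"
proof -
  have 1: "continuous_on {0<..} (\<lambda>u. lsum r (of_real u))"
    by (rule continuous_on_vector_derivative[where f' = "\<lambda>u. - lsum (r - 1) (of_real u)"])
       (simp add: has_vector_derivative_at_within has_vector_derivative_lsum)
  have 2: "continuous_on {0<..} (\<lambda>u. lrem K s (x * u))"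
    by (rule continuous_on_compose2[OF lrem_continuous[OF assms(1)]]) (use assms(2) in \<open>auto intro!: continuous_intros\<close>)
  show ?thesis
    by (intro borel_measurable_times measurable_lpos_continuous[OF 1] measurable_lpos_continuous[OF 2] measurable_lpos)
       auto
qed

lemma mt_rem_integrable:
  assumes "(r, s, t) \<in> mt_dom K" "x > 0"
  shows "integrable lpos (\<lambda>u. mt_integrand K r s t x u)"
proof -
  obtain e G where "e > 0" "integrable lpos G"
    and G: "\<forall>r'\<in>ball r e. \<forall>s'\<in>ball s e. \<forall>t'\<in>ball t e. \<forall>u\<in>space lpos.
      norm (mt_integrand K r' s' t' x u) \<le> G u"
    using mt_rem_dominated[OF assms] by blast
  have "norm (mt_integrand K r s t x u) \<le> norm (G u)" if "u \<in> space lpos" for u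
    using G that \<open>e > 0\<close> by (auto intro: order.trans[OF _ abs_ge_self])
  note bd = this
  show ?thesis
    by (rule Bochner_Integration.integrable_bound[OF \<open>integrable lpos G\<close>])
       (use assms bd in \<open>auto intro!: AE_I2 mt_integrand_measurable simp: mt_dom_def\<close>)
qed

lemma open_mt_dom_slices:
  "open {r. (r, s, t) \<in> mt_dom K}" "open {s. (r, s, t) \<in> mt_dom K}" "open {t. (r, s, t) \<in> mt_dom K}"
  unfolding mt_dom_def by (auto intro!: open_Collect_conj open_Collect_less continuous_intros)

text \<open>The majorant holds near a point in all three parameters simultaneously, so holomorphic
  arguments can be substituted. Keeping two of them constant gives holomorphy in each single
  variable.\<close>

lemma mt_rem_holomorphic_compose:
  assumes x: "x > 0" and V: "open V" and dom: "\<And>z. z \<in> V \<Longrightarrow> (R z, S z, T z) \<in> mt_dom K"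
    and holo: "R holomorphic_on V" "S holomorphic_on V" "T holomorphic_on V"
  shows "(\<lambda>z. mt_rem K (R z) (S z) (T z) x) holomorphic_on V"
  unfolding mt_rem_def
proof (rule integral_holomorphic_dominated[OF V])
  fix z assume z: "z \<in> V"
  show "(\<lambda>u. mt_integrand K (R z) (S z) (T z) x u) \<in> borel_measurable lpos"
    using dom[OF z] by (intro mt_integrand_measurable x) (simp add: mt_dom_def)
  obtain e G where e: "e > 0" "integrable lpos G"
    and G: "\<forall>r\<in>ball (R z) e. \<forall>s\<in>ball (S z) e. \<forall>t\<in>ball (T z) e. \<forall>u\<in>space lpos. norm (mt_integrand K r s t x u) \<le> G u"
    using mt_rem_dominated[OF dom[OF z] x] by blast
  have "\<exists>d>0. \<forall>w\<in>ball z d. f w \<in> ball (f z) e" if "f holomorphic_on V" for f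
  proof -
    have "isCont f z" using holomorphic_on_imp_continuous_on[OF that] V z by (simp add: continuous_on_eq_continuous_at)
    then obtain d where "d > 0" "\<forall>w. dist w z < d \<longrightarrow> dist (f w) (f z) < e"
      unfolding continuous_at_eps_delta using e(1) by blast
    thus ?thesis by (intro exI[of _ d]) (simp add: dist_commute)
  qed
  from this[OF holo(1)] this[OF holo(2)] this[OF holo(3)] obtain d1 d2 d3 where d: "d1 > 0" "d2 > 0" "d3 > 0"
    "\<forall>w\<in>ball z d1. R w \<in> ball (R z) e" "\<forall>w\<in>ball z d2. S w \<in> ball (S z) e" "\<forall>w\<in>ball z d3. T w \<in> ball (T z) e" by blast
  show "\<exists>e>0. \<exists>G. integrable lpos G \<and> (\<forall>w\<in>ball z e. \<forall>u\<in>space lpos. norm (mt_integrand K (R w) (S w) (T w) x u) \<le> G u)"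
    by (intro exI[of _ "min d1 (min d2 d3)"] exI[of _ G] conjI ballI G[rule_format] e) (use d in auto)
next
  fix u assume "u \<in> space lpos"
  hence u: "u > 0" by (simp add: space_restrict_space)
  have "(\<lambda>r. lsum r (of_real u)) \<circ> R holomorphic_on V"
    by (rule holomorphic_on_compose_gen[OF holo(1) holomorphic_lsum]) (use u in auto)
  moreover have "(\<lambda>s. lrem K s (x * u)) \<circ> S holomorphic_on V"
    by (rule holomorphic_on_compose_gen[OF holo(2) lrem_holomorphic]) (use u x dom in \<open>auto simp: mt_dom_def\<close>)
  ultimately show "(\<lambda>z. mt_integrand K (R z) (S z) (T z) x u) holomorphic_on V"
    using u by (intro holomorphic_intros holo) (auto simp: o_def)
qed

lemma mt_rem_holomorphic:
  assumes x: "x > 0"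
  shows "(\<lambda>r. mt_rem K r s t x) holomorphic_on {r. (r, s, t) \<in> mt_dom K}"
    and "(\<lambda>s. mt_rem K r s t x) holomorphic_on {s. (r, s, t) \<in> mt_dom K}"
    and "(\<lambda>t. mt_rem K r s t x) holomorphic_on {t. (r, s, t) \<in> mt_dom K}"
  by (rule mt_rem_holomorphic_compose; (intro x open_mt_dom_slices holomorphic_on_const holomorphic_on_ident)?; simp)+

lemma mt_dom_Suc: "(r, s, t) \<in> mt_dom K \<Longrightarrow> (r, s, t) \<in> mt_dom (Suc K)"
  by (auto simp: mt_dom_def)

text \<open>The two integrands differ by a single power \<open>u^K\<close> times
  \<open>lsum r u\<close>, whose Mellin transform is known under the conditions of
  \<open>mt_dom K\<close>.\<close>

lemma mt_rem_diff:
  assumes d: "(r, s, t) \<in> mt_dom K" and x: "x > 0"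
  shows "mt_rem K r s t x - mt_rem (Suc K) r s t x =
           riemann_zeta (s - of_nat K) * (- of_real x) ^ K / fact K * (Gamma (t + of_nat K) * riemann_zeta (r + t + of_nat K))"
proof -
  have dr: "Re s < real K + 1" "Re (t + of_nat K) > 0" "Re (r + (t + of_nat K)) > 1"
    using d by (auto simp: mt_dom_def)
  define c where "c = riemann_zeta (s - of_nat K) * (- of_real x) ^ K / fact K"
  have "mt_rem K r s t x - mt_rem (Suc K) r s t x =
     (\<integral>u. mt_integrand K r s t x u -
           mt_integrand (Suc K) r s t x u \<partial>lpos)"
    unfolding mt_rem_def
    by (rule Bochner_Integration.integral_diff[symmetric]; intro mt_rem_integrable mt_dom_Suc d x)
  also have "\<dots> = (\<integral>u. c * (of_real u powr (t + of_nat K - 1) * lsum r (of_real u)) \<partial>lpos)"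
  proof (intro Bochner_Integration.integral_cong refl)
    fix u assume "u \<in> space lpos"
    hence u: "u > 0" by (simp add: space_restrict_space)
    have "of_real u powr (t + of_nat K - 1) = of_real u powr (t - 1) * (of_real u powr (of_nat K) :: complex)"
      unfolding powr_add[symmetric] by (simp add: algebra_simps)
    also have "of_real u powr (of_nat K) = (of_real u ^ K :: complex)" using u by (simp add: powr_nat')
    finally have p: "of_real u powr (t + of_nat K - 1) = of_real u powr (t - 1) * (of_real u ^ K :: complex)" .
    have "(- complex_of_real (x * u)) ^ K = (- of_real x) ^ K * of_real u ^ K"
      by (simp flip: power_mult_distrib)
    with lrem_diff[OF dr(1), of "x * u"] u x
    have "lrem K s (x * u) - lrem (Suc K) s (x * u) = c * of_real u ^ K" by (simp add: c_def del: lrem.simps)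
    thus "mt_integrand K r s t x u -
           mt_integrand (Suc K) r s t x u =
          c * (of_real u powr (t + of_nat K - 1) * lsum r (of_real u))"
      unfolding p by (simp add: algebra_simps flip: right_diff_distrib del: lrem.simps)
  qed
  also have "\<dots> = c * (Gamma (t + of_nat K) * riemann_zeta (r + (t + of_nat K)))"
    by (simp add: mellin_lsum(2)[OF dr(2,3)])
  finally show ?thesis by (simp add: c_def add_ac)
qed

section \<open>The Mordell--Tornheim series\<close>

abbreviation ppos :: "(nat \<times> nat) measure" where "ppos \<equiv> count_space ({1..} \<times> {1..})"

definition mt_term :: "complex \<Rightarrow> complex \<Rightarrow> complex \<Rightarrow> real \<Rightarrow> nat \<times> nat \<Rightarrow> complex" where
  "mt_term r s t x = (\<lambda>(n, m). (of_nat n powr (- r) * of_nat m powr (- s)) * of_real (real n + real m * x) powr (- t))"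

lemma norm_mt_term:
  assumes "n \<ge> 1" "m \<ge> 1" "x > 0"
  shows "norm (mt_term r s t x (n, m)) = (real n powr (- Re r) * real m powr (- Re s)) * (real n + real m * x) powr (- Re t)"
proof -
  have "real n + real m * x > 0" using assms by (simp add: add_pos_pos)
  thus ?thesis using assms by (simp add: mt_term_def norm_mult norm_powr_real_powr del: of_real_add of_real_mult)
qed

text \<open>\<open>N\<close> is the larger index. After \<open>N powr (- (1 + e))\<close> is split
  off, the excess exponent \<open>a + \<tau> - 1 - e\<close> is nonnegative, so it can be moved from
  \<open>N\<close> to \<open>M\<close>; the last hypothesis makes the resulting exponent of
  \<open>M\<close> at least \<open>1 + e\<close>.\<close>

lemma powr_majorant_aux:
  fixes a b \<tau> e N M :: real
  assumes "N \<ge> M" "M \<ge> 1" "e \<le> a + \<tau> - 1" "2 * e \<le> a + b + \<tau> - 2"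
  shows "N powr (- a) * M powr (- b) * N powr (- \<tau>) \<le> N powr (- (1 + e)) * M powr (- (1 + e))"
proof -
  have "N powr (- a) * M powr (- b) * N powr (- \<tau>) = N powr (- (1 + e)) * (N powr (- (a + \<tau> - 1 - e)) * M powr (- b))"
  proof -
    have "N powr (- (1 + e)) * N powr (- (a + \<tau> - 1 - e)) = N powr (- a) * N powr (- \<tau>)"
      unfolding powr_add[symmetric] by (simp add: algebra_simps)
    thus ?thesis by (simp add: mult_ac)
  qed
  also have "\<dots> \<le> N powr (- (1 + e)) * (M powr (- (a + \<tau> - 1 - e)) * M powr (- b))"
    using assms by (intro mult_left_mono mult_right_mono powr_mono2') auto
  also have "M powr (- (a + \<tau> - 1 - e)) * M powr (- b) = M powr (- (a + \<tau> - 1 - e) - b)"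
    unfolding powr_add[symmetric] by simp
  also have "N powr (- (1 + e)) * M powr (- (a + \<tau> - 1 - e) - b) \<le> N powr (- (1 + e)) * M powr (- (1 + e))"
    using assms by (intro mult_left_mono powr_mono) auto
  finally show ?thesis .
qed

text \<open>The linear form \<open>n + m x\<close> is comparable to \<open>max n m\<close>, between
  the factors \<open>min 1 x\<close> and \<open>1 + x\<close>. Replacing it by the maximum leaves
  two symmetric cases according to which index is larger, and both are bounded by a product of
  convergent series.\<close>

lemma mt_majorant:
  fixes \<rho> \<sigma> \<tau> x :: real
  assumes "\<rho> + \<tau> > 1" "\<sigma> + \<tau> > 1" "\<rho> + \<sigma> + \<tau> > 2" "x > 0"
  obtains C e where "C \<ge> 0" "e > 0"
    "\<And>n m :: nat. n \<ge> 1 \<Longrightarrow> m \<ge> 1 \<Longrightarrow>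
       real n powr (- \<rho>) * real m powr (- \<sigma>) * (real n + real m * x) powr (- \<tau>) \<le>
       C * (real n powr (- (1 + e)) * real m powr (- (1 + e)))"
proof -
  define e where "e = min (\<rho> + \<tau> - 1) (min (\<sigma> + \<tau> - 1) ((\<rho> + \<sigma> + \<tau> - 2) / 2))"
  have e: "e > 0" "e \<le> \<rho> + \<tau> - 1" "e \<le> \<sigma> + \<tau> - 1" "2 * e \<le> \<rho> + \<sigma> + \<tau> - 2"
    using assms by (auto simp: e_def min_def)
  define c1 c2 where "c1 = min 1 x" and "c2 = 1 + x"
  have c: "c1 > 0" "c2 > 0" using assms by (auto simp: c1_def c2_def)
  \<comment> \<open>The sign of \<open>\<tau>\<close> decides which of the two comparison factors is
    the relevant one; the sum covers both.\<close>
  define C where "C = c1 powr (- \<tau>) + c2 powr (- \<tau>)"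
  have "real n powr (- \<rho>) * real m powr (- \<sigma>) * (real n + real m * x) powr (- \<tau>) \<le>
       C * (real n powr (- (1 + e)) * real m powr (- (1 + e)))" if n: "n \<ge> 1" and m: "m \<ge> 1" for n m
  proof -
    define q y where "q = max (real n) (real m)" and "y = real n + real m * x"
    have q: "q \<ge> 1" using n by (auto simp: q_def)
    have "c1 * q \<le> y"
    proof (cases "n \<ge> m")
      case True
      have "c1 * real n \<le> 1 * real n" by (intro mult_right_mono) (auto simp: c1_def)
      also have "\<dots> \<le> y" using assms by (auto simp: y_def)
      finally show ?thesis using True by (auto simp: q_def max_def)
    next
      case False
      have "c1 * real m \<le> x * real m" by (intro mult_right_mono) (auto simp: c1_def)
      also have "\<dots> \<le> y" using assms by (auto simp: y_def)
      finally show ?thesis using False by (simp add: q_def max_def)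
    qed
    moreover have "y \<le> c2 * q"
    proof -
      have "real m * x \<le> q * x" using assms by (intro mult_right_mono) (auto simp: q_def)
      moreover have "real n \<le> q" by (simp add: q_def)
      ultimately show ?thesis by (simp add: y_def c2_def algebra_simps)
    qed
    ultimately have z: "c1 \<le> y / q" "y / q \<le> c2" using q by (auto simp: field_simps)
    have "(y / q) powr (- \<tau>) \<le> C"
    proof (cases "\<tau> \<ge> 0")
      case True
      hence "(y / q) powr (- \<tau>) \<le> c1 powr (- \<tau>)" using z c by (intro powr_mono2') auto
      thus ?thesis by (simp add: C_def add_increasing2)
    next
      case False
      hence "(y / q) powr (- \<tau>) \<le> c2 powr (- \<tau>)" using z c by (intro powr_mono2) auto
      thus ?thesis by (simp add: C_def add_increasing)
    qed
    moreover have "y powr (- \<tau>) = (y / q) powr (- \<tau>) * q powr (- \<tau>)"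
    proof -
      have "y / q > 0" using z(1) c(1) by linarith
      thus ?thesis using q powr_mult[of "y / q" q "- \<tau>"] by simp
    qed
    ultimately have yq: "y powr (- \<tau>) \<le> C * q powr (- \<tau>)"
      by (simp add: mult_right_mono)
    have "real n powr (- \<rho>) * real m powr (- \<sigma>) * y powr (- \<tau>) \<le>
          real n powr (- \<rho>) * real m powr (- \<sigma>) * (C * q powr (- \<tau>))"
      by (intro mult_left_mono yq) auto
    also have "\<dots> = C * (real n powr (- \<rho>) * real m powr (- \<sigma>) * q powr (- \<tau>))" by (simp add: mult_ac)
    also have "real n powr (- \<rho>) * real m powr (- \<sigma>) * q powr (- \<tau>) \<le> real n powr (- (1 + e)) * real m powr (- (1 + e))"
    proof (cases "n \<ge> m")
      case True
      hence "q = real n" by (simp add: q_def)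
      thus ?thesis using powr_majorant_aux[of "real m" "real n" e \<rho> \<tau> \<sigma>] m e True
        by (simp add: algebra_simps)
    next
      case False
      thus ?thesis using powr_majorant_aux[of "real n" "real m" e \<sigma> \<tau> \<rho>] n e
        by (simp add: q_def max_def mult_ac)
    qed
    hence "C * (real n powr (- \<rho>) * real m powr (- \<sigma>) * q powr (- \<tau>)) \<le> C * (real n powr (- (1 + e)) * real m powr (- (1 + e)))"
      by (intro mult_left_mono) (auto simp: C_def)
    finally show ?thesis by (simp add: y_def)
  qed
  moreover have "C \<ge> 0" by (simp add: C_def)
  ultimately show ?thesis using e(1) that by blast
qed

lemma npos_product:
  fixes f g :: "nat \<Rightarrow> complex"
  assumes "integrable npos f" "integrable npos g"
  shows "integrable ppos (\<lambda>(n, m). f n * g m)"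
    and "(\<integral>(n, m). f n * g m \<partial>ppos) = (\<integral>n. f n \<partial>npos) * (\<integral>m. g m \<partial>npos)"
  using abs_summable_on_product[where f = f and g = g and A = "{1..}" and B = "{1..}"]
    infsetsum_product[where f = f and g = g and A = "{1..}" and B = "{1..}"] assms
  by (simp_all add: abs_summable_on_def infsetsum_def)

lemma mt_term_integrable:
  assumes "(r, s, t) \<in> mt_convergence_region" "x > 0"
  shows "integrable ppos (mt_term r s t x)"
proof -
  obtain C e where C: "C \<ge> 0" "e > 0"
    "\<And>n m :: nat. n \<ge> 1 \<Longrightarrow> m \<ge> 1 \<Longrightarrow>
       real n powr (- Re r) * real m powr (- Re s) * (real n + real m * x) powr (- Re t) \<le>
       C * (real n powr (- (1 + e)) * real m powr (- (1 + e)))"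
    using mt_majorant[of "Re r" "Re t" "Re s" x] assms by (auto simp: mt_convergence_region_def)
  define f where "f = (\<lambda>n. complex_of_nat n powr (- of_real (1 + e)))"
  have "integrable npos f" unfolding f_def by (rule dirichlet_integrable) (use C in simp)
  hence i: "integrable ppos (\<lambda>p. of_real C * (case p of (n, m) \<Rightarrow> f n * f m))"
    by (intro integrable_mult_right npos_product)
  show ?thesis
  proof (rule Bochner_Integration.integrable_bound[OF i], simp, rule AE_I2)
    fix p :: "nat \<times> nat" assume p: "p \<in> space ppos"
    obtain n m where nm: "p = (n, m)" by force
    have n: "n \<ge> 1" "m \<ge> 1" using p nm by auto
    have "norm (mt_term r s t x p) \<le> C * (real n powr (- (1 + e)) * real m powr (- (1 + e)))"
      unfolding nm using norm_mt_term[OF n assms(2)] C(3)[OF n] by simp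
    also have "\<dots> = norm (of_real C * (case p of (n, m) \<Rightarrow> f n * f m))"
      using C(1) n by (simp add: nm f_def norm_mult norm_powr_real_powr)
    finally show "norm (mt_term r s t x p) \<le> norm (of_real C * (case p of (n, m) \<Rightarrow> f n * f m))" .
  qed
qed

lemma mt_series_eq_integral:
  assumes "(r, s, t) \<in> mt_convergence_region" "x > 0"
  shows "mt_series r s t x = (\<integral>p. mt_term r s t x p \<partial>ppos)"
proof -
  have abs: "Infinite_Set_Sum.abs_summable_on (mt_term r s t x) ({1..} \<times> {1..})"
    using mt_term_integrable[OF assms] by (simp add: abs_summable_on_def)
  hence "mt_term r s t x summable_on ({1..} \<times> {1..})"
    using abs_summable_equivalent abs_summable_summable by blast
  hence "infsum (mt_term r s t x) ({1..} \<times> {1..}) = (\<Sum>\<^sub>\<infinity>n\<in>{1..}. \<Sum>\<^sub>\<infinity>m\<in>{1..}. mt_term r s t x (n, m))"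
    by (rule infsum_Sigma_banach[symmetric])
  also have "\<dots> = mt_series r s t x"
    unfolding mt_series_def
    by (intro infsum_cong) (simp add: mt_term_def powr_minus divide_inverse)
  finally show ?thesis using infsetsum_infsum[OF abs] by (simp add: infsetsum_def)
qed

lemma mt_term_mono:
  assumes "Re r' \<le> Re r" "Re s' \<le> Re s" "Re t' \<le> Re t" "x > 0" "p \<in> space ppos"
  shows "norm (mt_term r s t x p) \<le> norm (mt_term r' s' t' x p)"
proof -
  obtain n m where nm: "p = (n, m)" "n \<ge> 1" "m \<ge> 1" using assms(5) by (cases p) auto
  have y: "real n + real m * x \<ge> 1" using nm assms(4) by (simp add: add_increasing2)
  show ?thesis unfolding nm(1) norm_mt_term[OF nm(2,3) assms(4)]
    using assms nm y by (intro mult_mono powr_mono) auto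
qed

text \<open>Terms increase in norm when real parts of the exponents decrease, so the terms at the
  shifted point \<open>(r, s - e, t - e)\<close> dominate. Variation in \<open>s\<close> and
  \<open>t\<close> suffices for comparing the series with the continuation.\<close>

lemma mt_region_dominated:
  assumes "(r, s, t) \<in> mt_convergence_region" "x > 0"
  shows "\<exists>e>0. \<exists>G. integrable ppos G \<and> (\<forall>s'\<in>ball s e. \<forall>t'\<in>ball t e. \<forall>p\<in>space ppos.
           norm (mt_term r s' t' x p) \<le> G p)"
proof -
  \<comment> \<open>The shift by \<open>e\<close> in both \<open>s\<close> and \<open>t\<close>
    lowers \<open>s + t\<close> and \<open>r + s + t\<close> by \<open>2 * e\<close>; a third of the
    margin keeps the inequalities strict.\<close>
  define e where "e = min (Re (r + t) - 1) (min (Re (s + t) - 1) (Re (r + s + t) - 2)) / 3"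
  have e: "e > 0" "3 * e \<le> Re (r + t) - 1" "3 * e \<le> Re (s + t) - 1" "3 * e \<le> Re (r + s + t) - 2"
    using assms(1) by (auto simp: e_def mt_convergence_region_def)
  have "(r, s - of_real e, t - of_real e) \<in> mt_convergence_region"
    using e by (auto simp: mt_convergence_region_def)
  hence i: "integrable ppos (\<lambda>p. norm (mt_term r (s - of_real e) (t - of_real e) x p))"
    by (intro integrable_norm mt_term_integrable assms)
  have ReD: "Re w - e \<le> Re z" if "z \<in> ball w e" for z w
    using that abs_Re_le_cmod[of "w - z"] by (auto simp: dist_norm)
  show ?thesis
    by (intro exI[of _ e] conjI exI[of _ "\<lambda>p. norm (mt_term r (s - of_real e) (t - of_real e) x p)"] ballI mt_term_mono i)
       (use e ReD assms in auto)
qed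

lemma mt_term_holomorphic:
  assumes "x > 0" "p \<in> space ppos"
  shows "(\<lambda>s. mt_term r s t x p) holomorphic_on A" "(\<lambda>t. mt_term r s t x p) holomorphic_on A"
proof -
  obtain n m where nm: "p = (n, m)" "n \<ge> 1" "m \<ge> 1" using assms(2) by (cases p) auto
  have "real n + real m * x \<noteq> 0" using nm assms(1) by (simp add: add_pos_pos less_imp_neq[symmetric])
  thus "(\<lambda>s. mt_term r s t x p) holomorphic_on A" "(\<lambda>t. mt_term r s t x p) holomorphic_on A"
    using nm by (auto simp: mt_term_def intro!: holomorphic_intros simp del: of_real_add of_real_mult)
qed

lemma open_region_slices:
  "open {s. (r, s, t) \<in> mt_convergence_region}" "open {t. (r, s, t) \<in> mt_convergence_region}"
  unfolding mt_convergence_region_def by (auto intro!: open_Collect_conj open_Collect_less continuous_intros)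

lemma mt_series_holomorphic:
  assumes x: "x > 0"
  shows "(\<lambda>s. mt_series r s t x) holomorphic_on {s. (r, s, t) \<in> mt_convergence_region}" (is ?s)
    and "(\<lambda>t. mt_series r s t x) holomorphic_on {t. (r, s, t) \<in> mt_convergence_region}" (is ?t)
proof -
  have dom: "\<exists>e>0. \<exists>G. integrable ppos G \<and> (\<forall>s'\<in>ball s e. \<forall>p\<in>space ppos. norm (mt_term r s' t x p) \<le> G p)"
    "\<exists>e>0. \<exists>G. integrable ppos G \<and> (\<forall>t'\<in>ball t e. \<forall>p\<in>space ppos. norm (mt_term r s t' x p) \<le> G p)"
    if "(r, s, t) \<in> mt_convergence_region" for s t
    using mt_region_dominated[OF that x] by (meson centre_in_ball)+
  have "(\<lambda>s. \<integral>p. mt_term r s t x p \<partial>ppos) holomorphic_on {s. (r, s, t) \<in> mt_convergence_region}"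
    by (rule integral_holomorphic_dominated)
       (use dom(1) mt_term_holomorphic(1)[OF x] in \<open>auto intro: open_region_slices\<close>)
  thus ?s by (rule holomorphic_transform) (simp add: mt_series_eq_integral x)
  have "(\<lambda>t. \<integral>p. mt_term r s t x p \<partial>ppos) holomorphic_on {t. (r, s, t) \<in> mt_convergence_region}"
    by (rule integral_holomorphic_dominated)
       (use dom(2) mt_term_holomorphic(2)[OF x] in \<open>auto intro: open_region_slices\<close>)
  thus ?t by (rule holomorphic_transform) (simp add: mt_series_eq_integral x)
qed

lemma mellin_lsum_product:
  assumes d: "(r, s, t) \<in> mt_convergence_region" and x: "x > 0" and t: "Re t > 0"
  shows "integrable lpos (\<lambda>u. of_real u powr (t - 1) * (lsum r (of_real u) * lsum s (of_real (x * u))))"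
    and "(\<integral>u. of_real u powr (t - 1) * (lsum r (of_real u) * lsum s (of_real (x * u))) \<partial>lpos) = Gamma t * mt_series r s t x"
proof -
  define c where "c = (\<lambda>(n::nat, m::nat). complex_of_nat n powr (- r) * of_nat m powr (- s))"
  define v where "v = (\<lambda>(n::nat, m::nat). real n + real m * x)"
  have inner: "(\<integral>p. c p * exp (- of_real (v p * u)) \<partial>ppos) = lsum r (of_real u) * lsum s (of_real (x * u))" if u: "u > 0" for u
  proof -
    have "lsum r (of_real u) * lsum s (of_real (x * u)) =
          (\<integral>(n, m). (of_nat n powr (- r) * exp (- (of_nat n * of_real u))) * (of_nat m powr (- s) * exp (- (of_nat m * of_real (x * u)))) \<partial>ppos)"
      unfolding lsum_def by (rule npos_product(2)[symmetric]) (rule lsum_term_integrable, use u x in simp)+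
    also have "\<dots> = (\<integral>p. c p * exp (- of_real (v p * u)) \<partial>ppos)"
      by (intro Bochner_Integration.integral_cong refl)
         (auto simp: c_def v_def algebra_simps exp_add[symmetric] simp flip: exp_add)
    finally show ?thesis ..
  qed
  have c1: "c p * of_real (v p) powr (- t) = mt_term r s t x p" for p
    by (cases p) (simp add: c_def v_def mt_term_def)
  note M = mellin_laplace_count[OF _ _ t mt_term_integrable[OF d x] c1 inner]
  show "integrable lpos (\<lambda>u. of_real u powr (t - 1) * (lsum r (of_real u) * lsum s (of_real (x * u))))"
    "(\<integral>u. of_real u powr (t - 1) * (lsum r (of_real u) * lsum s (of_real (x * u))) \<partial>lpos) = Gamma t * mt_series r s t x"
    unfolding mt_series_eq_integral[OF d x] by (rule M; use x in \<open>auto simp: v_def intro!: add_pos_pos\<close>)+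
qed

section \<open>The analytic continuation\<close>

lemma holomorphic_on_locally:
  assumes "\<And>z. z \<in> S \<Longrightarrow> \<exists>V. open V \<and> z \<in> V \<and> f holomorphic_on V"
  shows "f holomorphic_on S"
  unfolding holomorphic_on_def
proof
  fix z assume "z \<in> S"
  then obtain V where "open V" "z \<in> V" "f holomorphic_on V" using assms by blast
  hence "f field_differentiable at z" using holomorphic_on_imp_differentiable_at by blast
  thus "f field_differentiable at z within S" using field_differentiable_at_within by blast
qed

text \<open>Constant Laurent coefficient of Gamma at \<open>- i\<close>; apart from
  \<open>(-1)^i / i!\<close> it is the Digamma value at \<open>i + 1\<close>. The induction divides
  by the factor in \<open>Gamma (z + 1) = z Gamma z\<close>, and each division adds
  \<open>1 / (i + 1)\<close> to the harmonic number.\<close>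

lemma Gamma_pole_tendsto:
  "((\<lambda>w. Gamma (- of_nat i - w) + (-1) ^ i / fact i / w) \<longlongrightarrow> (-1) ^ i / fact i * (harm i - euler_mascheroni)) (at (0 :: complex))"
proof (induction i)
  have ev: "\<forall>\<^sub>F w in at (0 :: complex). w \<in> ball 0 1 - {0}"
    by (rule eventually_at_in_open) auto
  case 0
  have "((\<lambda>w. Gamma (1 - w)) has_field_derivative (euler_mascheroni :: complex)) (at 0)"
    by (auto intro!: derivative_eq_intros)
  hence "((\<lambda>w. (Gamma (1 - w) - 1) / w) \<longlongrightarrow> (euler_mascheroni :: complex)) (at 0)"
    by (simp add: has_field_derivative_iff)
  hence "((\<lambda>w. - ((Gamma (1 - w) - 1) / w)) \<longlongrightarrow> - (euler_mascheroni :: complex)) (at 0)"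
    by (intro tendsto_intros)
  moreover have "\<forall>\<^sub>F w in at 0. - ((Gamma (1 - w) - 1) / w) = Gamma (- of_nat 0 - w) + (-1) ^ 0 / fact 0 / (w :: complex)"
    using ev
  proof eventually_elim
    case (elim w)
    hence "- w \<notin> \<int>\<^sub>\<le>\<^sub>0"
      by (auto elim!: nonpos_Ints_cases' simp: minus_equation_iff[of w] norm_of_nat)
    hence "Gamma (1 - w) = - w * Gamma (- w)" using Gamma_plus1[of "- w"] by simp
    thus ?case using elim by (simp add: field_simps)
  qed
  ultimately show ?case by (simp add: harm_def filterlim_cong)
next
  have ev: "\<forall>\<^sub>F w in at (0 :: complex). w \<in> ball 0 1 - {0}"
    by (rule eventually_at_in_open) auto
  case (Suc i)
  define c where "c = ((-1) ^ i / fact i :: complex)"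
  define a where "a = (of_nat (Suc i) :: complex)"
  have a: "a \<noteq> 0" unfolding a_def by (rule of_nat_neq_0)
  have c': "(-1) ^ Suc i / fact (Suc i) = - c / a"
    by (simp add: c_def a_def)
  have "((\<lambda>w. - (Gamma (- of_nat i - w) + c / w) / (a + w) - c / (a * (a + w))) \<longlongrightarrow>
         - (c * (harm i - euler_mascheroni)) / (a + 0) - c / (a * (a + 0))) (at 0)"
    using Suc.IH a by (intro tendsto_intros) (auto simp: c_def)
  also have "- (c * (harm i - euler_mascheroni)) / (a + 0) - c / (a * (a + 0)) = - c / a * (harm (Suc i) - euler_mascheroni)"
    using a by (simp add: harm_Suc a_def[symmetric] field_simps del: of_nat_Suc)
  finally have "((\<lambda>w. - (Gamma (- of_nat i - w) + c / w) / (a + w) - c / (a * (a + w))) \<longlongrightarrow>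
       (-1) ^ Suc i / fact (Suc i) * (harm (Suc i) - euler_mascheroni)) (at 0)" by (simp only: c')
  moreover have "\<forall>\<^sub>F w in at 0. - (Gamma (- of_nat i - w) + c / w) / (a + w) - c / (a * (a + w)) =
       Gamma (- of_nat (Suc i) - w) + (-1) ^ Suc i / fact (Suc i) / w"
    using ev
  proof eventually_elim
    case (elim w)
    have aw: "- a - w \<notin> \<int>\<^sub>\<le>\<^sub>0"
    proof
      assume "- a - w \<in> \<int>\<^sub>\<le>\<^sub>0"
      then obtain n where "- a - w = - of_nat n" by (auto elim!: nonpos_Ints_cases')
      hence w: "w = of_int (int n - int (Suc i))" by (simp add: a_def algebra_simps)
      hence "norm w = real_of_int \<bar>int n - int (Suc i)\<bar>" by (simp only: norm_of_int)
      hence "\<bar>real n - real (Suc i)\<bar> < 1" using elim by simp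
      hence "n = Suc i" by linarith
      hence "w = 0" using w by simp
      thus False using elim by simp
    qed
    hence aw0: "a + w \<noteq> 0" by (metis add.inverse_neutral diff_conv_add_uminus minus_add_distrib zero_in_nonpos_Ints)
    define G where "G = Gamma (- a - w)"
    have "- of_nat i - w = (- a - w) + 1" by (simp add: a_def)
    hence "Gamma (- of_nat i - w) = (- a - w) * G"
      using Gamma_plus1[OF aw] by (simp only: G_def)
    moreover have "Gamma (- of_nat (Suc i) - w) = G" by (simp only: G_def a_def)
    moreover have "- ((- a - w) * G + c / w) / (a + w) - c / (a * (a + w)) = G + (- c / a) / w"
      using aw0 a elim by (simp add: divide_simps) (simp add: algebra_simps)
    ultimately show ?case unfolding c' by (simp only:)
  qed
  ultimately show ?case by (rule Lim_transform_eventually)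
qed

text \<open>The Mellin transform of the singular term over \<open>Gamma t\<close>, without its
  factor \<open>Gamma (1 - s)\<close>. What remains is regular at positive integers \<open>s\<close>
  off the hyperplanes, so the pole and the function it multiplies can be treated apart.
  \<open>mt_gam'\<close> is its \<open>s\<close>-derivative in closed form, ready for expansion in
  \<open>t\<close>.\<close>

definition mt_gam :: "complex \<Rightarrow> complex \<Rightarrow> complex \<Rightarrow> real \<Rightarrow> complex" where
  "mt_gam r s t x = of_real x powr (s - 1) * (rGamma t * Gamma (s + t - 1)) * riemann_zeta (r + s + t - 1)"

definition mt_gam' :: "complex \<Rightarrow> complex \<Rightarrow> complex \<Rightarrow> real \<Rightarrow> complex" where
  "mt_gam' r s t x = of_real x powr (s - 1) * (rGamma t * Gamma (s + t - 1)) *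
     ((of_real (ln x) + Digamma (s + t - 1)) * riemann_zeta (r + s + t - 1) + deriv riemann_zeta (r + s + t - 1))"

abbreviation mt_pole :: "nat \<Rightarrow> complex \<Rightarrow> complex \<Rightarrow> real \<Rightarrow> complex" where
  "mt_pole i r t x \<equiv> (-1) ^ i / fact i * (harm i * mt_gam r (of_nat (Suc i)) t x - mt_gam' r (of_nat (Suc i)) t x)"

text \<open>This is \<open>(-t choose j) x^j\<close>. The Pochhammer symbol stands for
  \<open>Gamma (t + j) / Gamma t\<close> and, being a polynomial in \<open>t\<close>, also makes
  sense where the Gamma values do not.\<close>

definition mt_coeff :: "nat \<Rightarrow> complex \<Rightarrow> real \<Rightarrow> complex" where
  "mt_coeff j t x = pochhammer t j * (- of_real x) ^ j / fact j"

definition mt_summand :: "nat \<Rightarrow> complex \<Rightarrow> complex \<Rightarrow> complex \<Rightarrow> real \<Rightarrow> complex" where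
  "mt_summand j r s t x = mt_coeff j t x * riemann_zeta (s - of_nat j) * riemann_zeta (r + t + of_nat j)"

text \<open>At \<open>s = i + 1\<close>, the value is the limit of the generic expression.\<close>

definition mt_sum :: "nat \<Rightarrow> complex \<Rightarrow> complex \<Rightarrow> complex \<Rightarrow> real \<Rightarrow> complex" where
  "mt_sum K r s t x = (if s \<in> of_nat ` {1..} then
       (let i = nat \<lfloor>Re s\<rfloor> - 1 in
          (-1) ^ i / fact i * (harm i * mt_gam r s t x - mt_gam' r s t x) + (\<Sum>j\<in>{..<K} - {i}. mt_summand j r s t x))
     else Gamma (1 - s) * mt_gam r s t x + (\<Sum>j<K. mt_summand j r s t x))"

definition mt_fun :: "nat \<Rightarrow> complex \<Rightarrow> complex \<Rightarrow> complex \<Rightarrow> real \<Rightarrow> complex" where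
  "mt_fun K r s t x = mt_sum K r s t x + rGamma t * mt_rem K r s t x"

text \<open>The functions of different order agree wherever both are defined, so the least
  admissible order is just a way of making a choice; locally any admissible \<open>K\<close>
  computes the value.\<close>

definition mt_cont :: "complex \<Rightarrow> complex \<Rightarrow> complex \<Rightarrow> real \<Rightarrow> complex" where
  "mt_cont r s t x = mt_fun (LEAST K. (r, s, t) \<in> mt_dom K) r s t x"

lemma mt_sum_of_nat:
  "mt_sum K r (of_nat (Suc i)) t x = mt_pole i r t x +
     (\<Sum>j\<in>{..<K} - {i}. mt_summand j r (of_nat (Suc i)) t x)"
proof -
  have "of_nat (Suc i) \<in> (of_nat :: nat \<Rightarrow> complex) ` {1..}" by (intro imageI) auto
  moreover have "nat \<lfloor>Re (of_nat (Suc i) :: complex)\<rfloor> - 1 = i"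
    by (simp only: complex_Re_of_nat floor_of_nat nat_int diff_Suc_1)
  ultimately show ?thesis by (simp only: mt_sum_def if_True Let_def)
qed

lemma of_nat_imageE:
  assumes "s \<in> of_nat ` {1..}"
  obtains i where "s = of_nat (Suc i)"
  using assms by (metis Suc_diff_le atLeast_iff diff_Suc_1 imageE One_nat_def)

lemma rGamma_mult_Gamma_shift:
  fixes t :: complex
  assumes "t + of_nat j \<notin> \<int>\<^sub>\<le>\<^sub>0"
  shows "rGamma t * Gamma (t + of_nat j) = pochhammer t j"
  using assms pochhammer_rGamma[of t j] by (simp add: rGamma_inverse_Gamma Gamma_eq_zero_iff)

lemma Re_pos_not_nonpos_Int: "Re z > 0 \<Longrightarrow> z \<notin> \<int>\<^sub>\<le>\<^sub>0"
  by (auto elim!: nonpos_Ints_cases simp: complex_eq_iff)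

text \<open>The summand of index \<open>K\<close> that joins the explicit part is what the remainder
  loses. At \<open>s = i + 1\<close> the condition of \<open>mt_dom K\<close> forces
  \<open>i < K\<close>, so the omitted index is never the new one.\<close>

lemma mt_fun_Suc:
  assumes d: "(r, s, t) \<in> mt_dom K" and x: "x > 0"
  shows "mt_fun (Suc K) r s t x = mt_fun K r s t x"
proof -
  have sum: "mt_sum (Suc K) r s t x = mt_sum K r s t x + mt_summand K r s t x"
  proof (cases "s \<in> of_nat ` {1..}")
    case True
    then obtain i where i: "s = of_nat (Suc i)" by (rule of_nat_imageE)
    have "real (Suc i) < real K + 1" using d by (simp add: mt_dom_def i)
    hence "i < K" by simp
    hence "{..<Suc K} - {i} = insert K ({..<K} - {i})" by auto
    thus ?thesis unfolding i mt_sum_of_nat by simp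
  qed (simp add: mt_sum_def)
  have "rGamma t * Gamma (t + of_nat K) = pochhammer t K"
    by (rule rGamma_mult_Gamma_shift, rule Re_pos_not_nonpos_Int) (use d in \<open>simp add: mt_dom_def\<close>)
  hence "rGamma t * (mt_rem K r s t x - mt_rem (Suc K) r s t x) = mt_summand K r s t x"
    unfolding mt_rem_diff[OF d x] by (simp add: mt_summand_def mt_coeff_def field_simps)
  thus ?thesis by (simp add: mt_fun_def sum algebra_simps)
qed

lemma mt_fun_add:
  assumes "(r, s, t) \<in> mt_dom K" "x > 0"
  shows "(r, s, t) \<in> mt_dom (K + n) \<and> mt_fun (K + n) r s t x = mt_fun K r s t x"
proof (induction n)
  case (Suc n)
  thus ?case using mt_dom_Suc[of r s t "K + n"] mt_fun_Suc[of r s t "K + n" x] assms(2) by simp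
qed (use assms in auto)

lemma mt_cont_eq:
  assumes "(r, s, t) \<in> mt_dom K" "x > 0"
  shows "mt_cont r s t x = mt_fun K r s t x"
proof -
  define L where "L = (LEAST K. (r, s, t) \<in> mt_dom K)"
  have "(r, s, t) \<in> mt_dom L" unfolding L_def by (rule LeastI[of _ K]) fact
  moreover have "L \<le> K" unfolding L_def by (rule Least_le) fact
  ultimately show ?thesis
    using mt_fun_add[of r s t L x "K - L"] assms(2) by (simp add: mt_cont_def L_def[symmetric])
qed

lemma mt_dom_exists: "\<exists>K. (r, s, t) \<in> mt_dom K \<and> K \<ge> K0"
proof -
  obtain K :: nat where "real K > max (Re s) (max (- Re t) (1 - Re (r + t)))"
    using reals_Archimedean2 by blast
  hence K: "Re s < real K" "- Re t < real K" "1 - Re (r + t) < real K" by auto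
  moreover have "real K \<le> real (max K K0)" by simp
  ultimately have "(r, s, t) \<in> mt_dom (max K K0)" unfolding mt_dom_def by auto
  thus ?thesis by (intro exI[of _ "max K K0"]) auto
qed

lemma mt_nonsingular_iff:
  "(r, s, t) \<notin> mt_singular_set \<longleftrightarrow> r + t - 1 \<notin> \<int>\<^sub>\<le>\<^sub>0 \<and> s + t - 1 \<notin> \<int>\<^sub>\<le>\<^sub>0 \<and> r + s + t \<noteq> 2"
proof -
  have "(\<exists>l::nat. z = 1 - of_nat l) \<longleftrightarrow> z - 1 \<in> \<int>\<^sub>\<le>\<^sub>0" for z :: complex
  proof
    assume "z - 1 \<in> \<int>\<^sub>\<le>\<^sub>0"
    then obtain l where "z - 1 = - of_nat l" by (auto elim!: nonpos_Ints_cases')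
    thus "\<exists>l::nat. z = 1 - of_nat l" by (intro exI[of _ l]) (simp add: algebra_simps)
  qed auto
  thus ?thesis by (simp add: mt_singular_set_def)
qed

lemma open_not_nonpos_Ints:
  fixes f :: "complex \<Rightarrow> complex"
  assumes "continuous_on UNIV f"
  shows "open {z. f z \<notin> \<int>\<^sub>\<le>\<^sub>0}"
proof -
  have "closed (\<int>\<^sub>\<le>\<^sub>0 :: complex set)" by (rule closed_nonpos_Ints)
  hence "open (f -` (- \<int>\<^sub>\<le>\<^sub>0))" using assms by (intro open_vimage) auto
  thus ?thesis by (simp add: vimage_def)
qed

lemma open_nonsingular_slices:
  "open {r. (r, s, t) \<notin> mt_singular_set}" "open {s. (r, s, t) \<notin> mt_singular_set}" "open {t. (r, s, t) \<notin> mt_singular_set}"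
  unfolding mt_nonsingular_iff
  by (intro open_Collect_conj open_not_nonpos_Ints open_Collect_neq open_Collect_const continuous_intros)+

lemma holomorphic_zeta_compose:
  assumes "f holomorphic_on A" "\<And>z. z \<in> A \<Longrightarrow> f z \<noteq> 1"
  shows "(\<lambda>z. riemann_zeta (f z)) holomorphic_on A" "(\<lambda>z. deriv riemann_zeta (f z)) holomorphic_on A"
proof -
  have im: "f ` A \<subseteq> - {1}" using assms(2) by auto
  show "(\<lambda>z. riemann_zeta (f z)) holomorphic_on A"
    using holomorphic_on_compose_gen[OF assms(1) holomorphic_riemann_zeta im] by (simp add: o_def)
  have "deriv riemann_zeta holomorphic_on - {1}"
    by (intro holomorphic_deriv holomorphic_riemann_zeta) auto
  from holomorphic_on_compose_gen[OF assms(1) this im]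
  show "(\<lambda>z. deriv riemann_zeta (f z)) holomorphic_on A" by (simp add: o_def)
qed

lemma nonsingular_zeta_args:
  assumes "(r, s, t) \<notin> mt_singular_set"
  shows "r + t + of_nat j \<noteq> 1" "r + s + t - 1 \<noteq> 1" "s + t - 1 \<notin> \<int>\<^sub>\<le>\<^sub>0"
proof -
  show "r + t + of_nat j \<noteq> 1"
  proof
    assume "r + t + of_nat j = 1"
    hence "r + t - 1 = - of_nat j" by (simp add: algebra_simps)
    thus False using assms by (simp add: mt_nonsingular_iff)
  qed
qed (use assms in \<open>auto simp: mt_nonsingular_iff algebra_simps\<close>)


lemma mt_coeff_holomorphic: "(\<lambda>t. mt_coeff j t x) holomorphic_on A"
  unfolding mt_coeff_def pochhammer_prod by (intro holomorphic_intros) auto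

lemma deriv_zeta:
  assumes "z \<noteq> 1"
  shows "(riemann_zeta has_field_derivative deriv riemann_zeta z) (at z)"
  by (rule holomorphic_derivI[OF holomorphic_riemann_zeta]) (use assms in auto)

lemma mt_gam_has_derivative:
  assumes n: "(r, s, t) \<notin> mt_singular_set" and x: "x > 0"
  shows "((\<lambda>s. mt_gam r s t x) has_field_derivative mt_gam' r s t x) (at s)"
proof -
  have z: "((\<lambda>s. riemann_zeta (r + s + t - 1)) has_field_derivative deriv riemann_zeta (r + s + t - 1) * 1) (at s)"
    by (rule DERIV_chain2[OF deriv_zeta]) (use nonsingular_zeta_args(2)[OF n] in \<open>auto intro!: derivative_eq_intros\<close>)
  have g: "((\<lambda>s. Gamma (s + t - 1)) has_field_derivative Gamma (s + t - 1) * Digamma (s + t - 1) * 1) (at s)"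
    by (rule DERIV_chain2[OF has_field_derivative_Gamma])
       (use nonsingular_zeta_args(3)[OF n] in \<open>auto intro!: derivative_eq_intros\<close>)
  have p: "((\<lambda>s. of_real x powr (s - 1)) has_field_derivative of_real x powr (s - 1) * of_real (ln x)) (at s)"
    using x by (auto intro!: derivative_eq_intros simp: powr_def Ln_of_real)
  have "((\<lambda>s. mt_gam r s t x) has_field_derivative
      (of_real x powr (s - 1) * of_real (ln x) * (rGamma t * Gamma (s + t - 1)) +
        rGamma t * (Gamma (s + t - 1) * Digamma (s + t - 1) * 1) * of_real x powr (s - 1)) * riemann_zeta (r + s + t - 1) +
      deriv riemann_zeta (r + s + t - 1) * 1 * (of_real x powr (s - 1) * (rGamma t * Gamma (s + t - 1)))) (at s)"
    unfolding mt_gam_def by (intro DERIV_mult DERIV_cmult p g z)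
  thus ?thesis by (rule DERIV_cong) (simp add: mt_gam'_def algebra_simps)
qed

text \<open>Near \<open>s0 = i + 1\<close> and with \<open>c = (-1)^i / i!\<close>, the Gamma factor
  behaves like \<open>- c / (s - s0) + c * (harm i - euler_mascheroni)\<close> and the zeta factor
  like \<open>1 / (s - s0) + euler_mascheroni\<close>. The polar parts combine to a difference
  quotient of \<open>mt_gam\<close>, and the two Euler constants cancel.\<close>

lemma mt_sum_tendsto:
  assumes n: "(r, of_nat (Suc i), t) \<notin> mt_singular_set" and x: "x > 0"
  shows "((\<lambda>s. Gamma (1 - s) * mt_gam r s t x + mt_summand i r s t x) \<longlongrightarrow>
           mt_pole i r t x) (at (of_nat (Suc i)))"
proof -
  define s0 where "s0 = (of_nat (Suc i) :: complex)"
  define c where "c = ((-1) ^ i / fact i :: complex)"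
  define g where "g = (\<lambda>s. mt_gam r s t x)"
  have "((\<lambda>s. (g s - g s0) / (s - s0)) \<longlongrightarrow> mt_gam' r s0 t x) (at s0)"
    using mt_gam_has_derivative[OF n x] by (simp add: has_field_derivative_iff g_def s0_def del: of_nat_Suc)
  moreover have "(g \<longlongrightarrow> g s0) (at s0)"
    using DERIV_isCont[OF mt_gam_has_derivative[OF n x]] by (simp add: isCont_def g_def s0_def del: of_nat_Suc)
  moreover have "((\<lambda>s. Gamma (1 - s) + c / (s - s0)) \<longlongrightarrow> c * (harm i - euler_mascheroni)) (at s0)"
  proof -
    have "filterlim (\<lambda>s. s - s0) (at 0) (at s0)"
      by (intro filterlim_atI tendsto_eq_intros) (auto simp: eventually_at_filter)
    from filterlim_compose[OF Gamma_pole_tendsto[of i] this]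
    have "((\<lambda>s. Gamma (- of_nat i - (s - s0)) + c / (s - s0)) \<longlongrightarrow> c * (harm i - euler_mascheroni)) (at s0)"
      by (simp add: c_def)
    moreover have "- of_nat i - (s - s0) = 1 - s" for s by (simp add: s0_def)
    ultimately show ?thesis by simp
  qed
  moreover have "((\<lambda>s. riemann_zeta (s - of_nat i) - 1 / (s - s0)) \<longlongrightarrow> euler_mascheroni) (at s0)"
  proof -
    have "filterlim (\<lambda>s. s - of_nat i) (at 1) (at s0)"
    proof (rule filterlim_atI)
      show "\<forall>\<^sub>F s in at s0. s - of_nat i \<noteq> 1"
        unfolding eventually_at_filter by (rule always_eventually) (auto simp: s0_def algebra_simps)
    qed (auto intro!: tendsto_eq_intros simp: s0_def)
    from filterlim_compose[OF zeta_minus_pole_tendsto this] show ?thesis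
      by (simp add: s0_def algebra_simps)
  qed
  ultimately have "((\<lambda>s. (Gamma (1 - s) + c / (s - s0)) * g s - c * ((g s - g s0) / (s - s0)) + c * (riemann_zeta (s - of_nat i) - 1 / (s - s0)) * g s0) \<longlongrightarrow>
      (c * (harm i - euler_mascheroni)) * g s0 - c * mt_gam' r s0 t x + c * euler_mascheroni * g s0) (at s0)"
    by (intro tendsto_intros)
  also have "(c * (harm i - euler_mascheroni)) * g s0 - c * mt_gam' r s0 t x + c * euler_mascheroni * g s0 =
      c * (harm i * g s0 - mt_gam' r s0 t x)" by (simp add: algebra_simps)
  finally have lim: "((\<lambda>s. (Gamma (1 - s) + c / (s - s0)) * g s - c * ((g s - g s0) / (s - s0)) + c * (riemann_zeta (s - of_nat i) - 1 / (s - s0)) * g s0) \<longlongrightarrow>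
      c * (harm i * g s0 - mt_gam' r s0 t x)) (at s0)" .
  \<comment> \<open>The point of the cancellation: at \<open>s = i + 1\<close> the Gamma quotient in
    \<open>mt_gam\<close> is the Pochhammer symbol of \<open>mt_coeff i\<close>, so the summand is
    \<open>c * riemann_zeta (s - i)\<close> times the value of \<open>mt_gam\<close> at
    \<open>s0\<close>.\<close>
  have "rGamma t * Gamma (t + of_nat i) = pochhammer t i"
    by (rule rGamma_mult_Gamma_shift) (use nonsingular_zeta_args(3)[OF n] in \<open>simp add: algebra_simps\<close>)
  hence "g s0 = of_real x powr (of_nat i) * pochhammer t i * riemann_zeta (r + t + of_nat i)"
    by (simp add: g_def mt_gam_def s0_def algebra_simps)
  also have "of_real x powr (of_nat i) = (of_real x ^ i :: complex)" using x by (simp add: powr_nat')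
  finally have "mt_summand i r s t x = c * riemann_zeta (s - of_nat i) * g s0" for s
    by (simp add: mt_summand_def mt_coeff_def c_def power_minus[of "of_real x"])
  hence "(Gamma (1 - s) + c / (s - s0)) * g s - c * ((g s - g s0) / (s - s0)) + c * (riemann_zeta (s - of_nat i) - 1 / (s - s0)) * g s0 =
         Gamma (1 - s) * mt_gam r s t x + mt_summand i r s t x" for s
    by (simp add: g_def diff_divide_distrib algebra_simps)
  with lim show ?thesis by (simp only: c_def g_def s0_def)
qed

lemma mt_fun_holomorphic_r:
  assumes x: "x > 0"
  shows "(\<lambda>r. mt_fun K r s t x) holomorphic_on {r. (r, s, t) \<in> mt_dom K \<and> (r, s, t) \<notin> mt_singular_set}" (is "_ holomorphic_on ?V")
proof -
  have g: "(\<lambda>r. mt_gam r s t x) holomorphic_on ?V" "(\<lambda>r. mt_gam' r s t x) holomorphic_on ?V"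
    unfolding mt_gam_def mt_gam'_def
    by (intro holomorphic_intros holomorphic_zeta_compose; use nonsingular_zeta_args(2) in blast)+
  have sm: "(\<lambda>r. mt_summand j r s t x) holomorphic_on ?V" for j
    unfolding mt_summand_def
    by (intro holomorphic_intros holomorphic_zeta_compose; use nonsingular_zeta_args(1) in blast)
  have "(\<lambda>r. mt_rem K r s t x) holomorphic_on ?V"
    by (rule holomorphic_on_subset[OF mt_rem_holomorphic(1)[OF x]]) auto
  thus ?thesis unfolding mt_fun_def mt_sum_def Let_def
    by (cases "s \<in> of_nat ` {1..}"; simp only: if_True if_False; intro holomorphic_intros g sm)
qed

lemma mt_gam_holomorphic_t:
  assumes "\<And>t. t \<in> V \<Longrightarrow> s + t - 1 \<notin> \<int>\<^sub>\<le>\<^sub>0" "\<And>t. t \<in> V \<Longrightarrow> r + s + t - 1 \<noteq> 1"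
  shows "(\<lambda>t. mt_gam r s t x) holomorphic_on V" "(\<lambda>t. mt_gam' r s t x) holomorphic_on V"
proof -
  have G: "(\<lambda>t. Gamma (s + t - 1)) holomorphic_on V"
    by (intro holomorphic_intros assms(1))
  have D: "(\<lambda>t. Digamma (s + t - 1)) holomorphic_on V"
  proof -
    have "Digamma \<circ> (\<lambda>t. s + t - 1) holomorphic_on V"
      by (rule holomorphic_on_compose_gen[OF _ holomorphic_on_Polygamma[of "- \<int>\<^sub>\<le>\<^sub>0"]])
         (use assms(1) in \<open>auto intro!: holomorphic_intros\<close>)
    thus ?thesis by (simp add: o_def)
  qed
  show "(\<lambda>t. mt_gam r s t x) holomorphic_on V" "(\<lambda>t. mt_gam' r s t x) holomorphic_on V"
    unfolding mt_gam_def mt_gam'_def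
    by (intro holomorphic_on_mult holomorphic_on_add holomorphic_on_const holomorphic_rGamma G D
          holomorphic_zeta_compose holomorphic_on_diff holomorphic_on_ident assms(2); assumption)+
qed

lemma mt_fun_holomorphic_t:
  assumes x: "x > 0"
  shows "(\<lambda>t. mt_fun K r s t x) holomorphic_on {t. (r, s, t) \<in> mt_dom K \<and> (r, s, t) \<notin> mt_singular_set}" (is "_ holomorphic_on ?V")
proof -
  have g: "(\<lambda>t. mt_gam r s t x) holomorphic_on ?V" "(\<lambda>t. mt_gam' r s t x) holomorphic_on ?V"
    by (rule mt_gam_holomorphic_t; use nonsingular_zeta_args(2,3) in blast)+
  have sm: "(\<lambda>t. mt_summand j r s t x) holomorphic_on ?V" for j
    unfolding mt_summand_def
    by (intro holomorphic_intros mt_coeff_holomorphic holomorphic_zeta_compose; use nonsingular_zeta_args(1) in blast)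
  have "(\<lambda>t. mt_rem K r s t x) holomorphic_on ?V"
    by (rule holomorphic_on_subset[OF mt_rem_holomorphic(3)[OF x]]) auto
  thus ?thesis unfolding mt_fun_def mt_sum_def Let_def
    by (cases "s \<in> of_nat ` {1..}"; simp only: if_True if_False; intro holomorphic_intros g sm)
qed

lemma of_nat_image_isolated:
  assumes "s \<in> ball s0 1" "s \<in> of_nat ` {1..}" "s0 \<in> of_nat ` {1..}"
  shows "s = (s0 :: complex)"
proof -
  obtain n m where nm: "s = of_nat n" "s0 = of_nat m" using assms by auto
  have "dist s0 s = \<bar>real m - real n\<bar>"
    unfolding nm dist_norm by (metis norm_of_real of_real_diff of_real_of_nat_eq)
  hence "\<bar>real m - real n\<bar> < 1" using assms(1) by simp
  hence "m = n" by linarith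
  thus ?thesis using nm by simp
qed

text \<open>Off the positive integers the generic formula is holomorphic. At a positive integer the
  cancellation of poles gives continuity, and a continuous isolated point is a removable
  singularity.\<close>

lemma mt_fun_holomorphic_s:
  assumes x: "x > 0"
  shows "(\<lambda>s. mt_fun K r s t x) holomorphic_on {s. (r, s, t) \<in> mt_dom K \<and> (r, s, t) \<notin> mt_singular_set}" (is "_ holomorphic_on ?V")
proof -
  have V: "open ?V" by (intro open_Collect_conj open_mt_dom_slices open_nonsingular_slices)
  have N: "closed (of_nat ` {1..} :: complex set)" by (rule closed_of_nat_image)
  define f where "f = (\<lambda>s. Gamma (1 - s) * mt_gam r s t x + (\<Sum>j<K. mt_summand j r s t x) + rGamma t * mt_rem K r s t x)"
  have f_eq: "mt_fun K r s t x = f s" if "s \<notin> of_nat ` {1..}" for s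
    using that by (simp add: mt_fun_def mt_sum_def f_def)
  have g: "(\<lambda>s. mt_gam r s t x) holomorphic_on ?V"
    using mt_gam_has_derivative[OF _ x] V by (subst holomorphic_on_open) blast+
  have sm: "(\<lambda>s. mt_summand j r s t x) holomorphic_on ?V - {of_nat (Suc j)}" for j
  proof -
    have "(\<lambda>s. riemann_zeta (s - of_nat j)) holomorphic_on ?V - {of_nat (Suc j)}"
      by (intro holomorphic_intros holomorphic_zeta_compose) (auto simp: algebra_simps)
    thus ?thesis unfolding mt_summand_def by (intro holomorphic_intros)
  qed
  have R: "(\<lambda>s. mt_rem K r s t x) holomorphic_on ?V"
    by (rule holomorphic_on_subset[OF mt_rem_holomorphic(2)[OF x]]) auto
  have fh: "f holomorphic_on ?V - of_nat ` {1..}"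
    unfolding f_def
  proof (intro holomorphic_intros)
    show "(\<lambda>s. mt_gam r s t x) holomorphic_on ?V - of_nat ` {1..}" by (rule holomorphic_on_subset[OF g]) auto
    show "(\<lambda>s. mt_rem K r s t x) holomorphic_on ?V - of_nat ` {1..}" by (rule holomorphic_on_subset[OF R]) auto
    show "(\<lambda>s. mt_summand j r s t x) holomorphic_on ?V - of_nat ` {1..}" for j
    proof (rule holomorphic_on_subset[OF sm])
      have "of_nat (Suc j) \<in> (of_nat :: nat \<Rightarrow> complex) ` {1..}" by (intro imageI) auto
      thus "?V - of_nat ` {1..} \<subseteq> ?V - {of_nat (Suc j)}" by blast
    qed
  qed (auto simp: one_minus_nonpos_Ints_iff)
  have mh: "(\<lambda>s. mt_fun K r s t x) holomorphic_on ?V - of_nat ` {1..}"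
    by (rule holomorphic_transform[OF fh]) (simp add: f_eq)
  show ?thesis
  proof (rule holomorphic_on_locally)
    fix s0 assume s0: "s0 \<in> ?V"
    show "\<exists>W. open W \<and> s0 \<in> W \<and> (\<lambda>s. mt_fun K r s t x) holomorphic_on W"
    proof (cases "s0 \<in> of_nat ` {1..}")
      case False
      thus ?thesis using s0 V N mh by (intro exI[of _ "?V - of_nat ` {1..}"]) (simp add: open_Diff)
    next
      case True
      then obtain i where i: "s0 = of_nat (Suc i)" by (rule of_nat_imageE)
      have "real (Suc i) < real K + 1" using s0 by (simp add: mt_dom_def i)
      hence iK: "i < K" by simp
      define W where "W = ?V \<inter> ball s0 1"
      have W: "open W" "s0 \<in> W" using V s0 by (auto simp: W_def)
      have notN: "s \<notin> of_nat ` {1..}" if "s \<in> W - {s0}" for s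
        using of_nat_image_isolated[of s s0] True that by (auto simp: W_def)
      have n: "(r, of_nat (Suc i), t) \<notin> mt_singular_set" using s0 by (simp add: i del: of_nat_Suc)
      have "((\<lambda>s. mt_fun K r s t x) \<longlongrightarrow> mt_fun K r s0 t x) (at s0)"
      proof (rule Lim_transform_eventually)
        have contR: "((\<lambda>s. mt_rem K r s t x) \<longlongrightarrow> mt_rem K r s0 t x) (at s0)"
          using holomorphic_on_imp_continuous_on[OF R] V s0
          by (simp add: continuous_on_eq_continuous_at isCont_def)
        have contS: "((\<lambda>s. mt_summand j r s t x) \<longlongrightarrow> mt_summand j r s0 t x) (at s0)" if "j \<noteq> i" for j
        proof -
          have "of_nat j \<noteq> (of_nat i :: complex)" using that by simp
          hence "s0 \<in> ?V - {of_nat (Suc j)}" using s0 by (auto simp: i)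
          thus ?thesis
            using holomorphic_on_imp_continuous_on[OF sm[of j]] V
            by (simp add: continuous_on_eq_continuous_at isCont_def open_Diff)
        qed
        show "((\<lambda>s. (Gamma (1 - s) * mt_gam r s t x + mt_summand i r s t x) + (\<Sum>j\<in>{..<K} - {i}. mt_summand j r s t x) + rGamma t * mt_rem K r s t x)
            \<longlongrightarrow> mt_fun K r s0 t x) (at s0)"
          unfolding mt_fun_def i mt_sum_of_nat
          by (intro tendsto_add tendsto_mult tendsto_const tendsto_sum mt_sum_tendsto n x)
             (use contR contS in \<open>auto simp: i simp del: of_nat_Suc\<close>)
        have "\<forall>\<^sub>F s in at s0. s \<in> W - {s0}" by (rule eventually_at_in_open[OF W])
        thus "\<forall>\<^sub>F s in at s0. (Gamma (1 - s) * mt_gam r s t x + mt_summand i r s t x) + (\<Sum>j\<in>{..<K} - {i}. mt_summand j r s t x) + rGamma t * mt_rem K r s t x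
              = mt_fun K r s t x"
        proof eventually_elim
          case (elim s)
          have "(\<Sum>j<K. mt_summand j r s t x) = mt_summand i r s t x + (\<Sum>j\<in>{..<K} - {i}. mt_summand j r s t x)"
            using iK by (intro sum.remove) auto
          thus ?case unfolding f_eq[OF notN[OF elim]] f_def by simp
        qed
      qed
      hence lim: "((\<lambda>s. mt_fun K r s t x) \<longlongrightarrow> mt_fun K r s0 t x) (at s0 within W)"
        by (rule tendsto_within_subset) auto
      have hol: "(\<lambda>s. mt_fun K r s t x) holomorphic_on W - {s0}"
      proof (rule holomorphic_on_subset[OF mh], rule subsetI)
        fix s assume s: "s \<in> W - {s0}"
        hence "s \<in> ?V" by (simp add: W_def)
        with notN[OF s] show "s \<in> ?V - of_nat ` {1..}" by (rule DiffI[rotated])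
      qed
      have "(\<lambda>s. mt_fun K r s t x) holomorphic_on W"
        by (rule no_isolated_singularity'[OF _ hol W(1)]) (simp_all only: singleton_iff lim finite.intros)
      thus ?thesis using W by blast
    qed
  qed
qed


lemma mt_cont_holomorphic:
  assumes x: "x > 0"
  shows "(\<lambda>r. mt_cont r s t x) holomorphic_on {r. (r, s, t) \<notin> mt_singular_set}"
    and "(\<lambda>s. mt_cont r s t x) holomorphic_on {s. (r, s, t) \<notin> mt_singular_set}"
    and "(\<lambda>t. mt_cont r s t x) holomorphic_on {t. (r, s, t) \<notin> mt_singular_set}"
proof -
  \<comment> \<open>The three maps allow one argument for all three variables: one map is the
    identity, the other two are constant.\<close>
  have step: "(\<lambda>z. mt_cont (R z) (S z) (T z) x) holomorphic_on {z. (R z, S z, T z) \<notin> mt_singular_set}"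
    if "\<And>K. open {z. (R z, S z, T z) \<in> mt_dom K}" "open {z. (R z, S z, T z) \<notin> mt_singular_set}"
      "\<And>K. (\<lambda>z. mt_fun K (R z) (S z) (T z) x) holomorphic_on
         {z. (R z, S z, T z) \<in> mt_dom K \<and> (R z, S z, T z) \<notin> mt_singular_set}" for R S T
  proof (rule holomorphic_on_locally)
    fix z assume z: "z \<in> {z. (R z, S z, T z) \<notin> mt_singular_set}"
    obtain K where K: "(R z, S z, T z) \<in> mt_dom K" using mt_dom_exists by blast
    let ?V = "{z. (R z, S z, T z) \<in> mt_dom K \<and> (R z, S z, T z) \<notin> mt_singular_set}"
    have "open ?V" by (intro open_Collect_conj that)
    moreover have "(\<lambda>z. mt_cont (R z) (S z) (T z) x) holomorphic_on ?V"
      by (rule holomorphic_transform[OF that(3)]) (use mt_cont_eq[OF _ x] in auto)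
    ultimately show "\<exists>V. open V \<and> z \<in> V \<and> (\<lambda>z. mt_cont (R z) (S z) (T z) x) holomorphic_on V"
      using z K by (intro exI[of _ ?V]) simp
  qed
  show "(\<lambda>r. mt_cont r s t x) holomorphic_on {r. (r, s, t) \<notin> mt_singular_set}"
    "(\<lambda>s. mt_cont r s t x) holomorphic_on {s. (r, s, t) \<notin> mt_singular_set}"
    "(\<lambda>t. mt_cont r s t x) holomorphic_on {t. (r, s, t) \<notin> mt_singular_set}"
    by (rule step; intro open_mt_dom_slices open_nonsingular_slices
          mt_fun_holomorphic_r mt_fun_holomorphic_s mt_fun_holomorphic_t x)+
qed

section \<open>Agreement with the series, and uniqueness of the continuation\<close>

lemma region_nonsingular:
  assumes "(r, s, t) \<in> mt_convergence_region"
  shows "(r, s, t) \<notin> mt_singular_set"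
proof -
  have "Re (r + t - 1) > 0" "Re (s + t - 1) > 0" "Re (r + s + t) \<noteq> Re 2"
    using assms by (auto simp: mt_convergence_region_def)
  thus ?thesis unfolding mt_nonsingular_iff using Re_pos_not_nonpos_Int by metis
qed

text \<open>The expansion of the second factor is inserted and integrated term by term. The
  inequalities of the convergence region, together with \<open>Re t > 0\<close>, are the convergence
  conditions of the individual Mellin transforms.\<close>

lemma mt_cont_eq_series_generic:
  assumes d: "(r, s, t) \<in> mt_convergence_region" and x: "x > 0" and t: "Re t > 0" and s: "s \<notin> of_nat ` {1..}"
  shows "mt_cont r s t x = mt_series r s t x"
proof -
  obtain K where K: "(r, s, t) \<in> mt_dom K" using mt_dom_exists by blast
  hence sK: "Re s < real K + 1" by (simp add: mt_dom_def)
  have dr: "Re (s + t - 1) > 0" "Re (r + (s + t - 1)) > 1" "Re (r + t) > 1"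
    using d by (auto simp: mt_convergence_region_def)
  define a where "a = Gamma (1 - s) * of_real x powr (s - 1)"
  define b where "b = (\<lambda>j. riemann_zeta (s - of_nat j) * (- of_real x) ^ j / fact j)"
  have tn: "t \<notin> \<int>\<^sub>\<le>\<^sub>0" by (rule Re_pos_not_nonpos_Int[OF t])
  have int1: "integrable lpos (\<lambda>u. of_real u powr ((s + t - 1) - 1) * lsum r (of_real u))"
    by (rule mellin_lsum(1)) (use dr in auto)
  have int2: "integrable lpos (\<lambda>u. of_real u powr ((t + of_nat j) - 1) * lsum r (of_real u))" for j
    by (rule mellin_lsum(1)) (use dr t in auto)
  have "Gamma t * mt_series r s t x = (\<integral>u. of_real u powr (t - 1) * (lsum r (of_real u) * lsum s (of_real (x * u))) \<partial>lpos)"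
    by (rule mellin_lsum_product(2)[OF d x t, symmetric])
  also have "\<dots> = (\<integral>u. a * (of_real u powr ((s + t - 1) - 1) * lsum r (of_real u)) +
        (\<Sum>j<K. b j * (of_real u powr ((t + of_nat j) - 1) * lsum r (of_real u))) +
        of_real u powr (t - 1) * (lsum r (of_real u) * lrem K s (x * u)) \<partial>lpos)"
  proof (intro Bochner_Integration.integral_cong refl)
    fix u assume "u \<in> space lpos"
    hence u: "u > 0" by (simp add: space_restrict_space)
    have p1: "of_real u powr ((s + t - 1) - 1) = of_real u powr (t - 1) * (of_real u powr (s - 1) :: complex)"
      unfolding powr_add[symmetric] by (simp add: algebra_simps)
    have p2: "of_real u powr ((t + of_nat j) - 1) = of_real u powr (t - 1) * (of_real u ^ j :: complex)" for j
    proof -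
      have "of_real u powr ((t + of_nat j) - 1) = of_real u powr (t - 1) * (of_real u powr (of_nat j) :: complex)"
        unfolding powr_add[symmetric] by (simp add: algebra_simps)
      thus ?thesis using u by (simp add: powr_nat')
    qed
    have m: "(- complex_of_real (x * u)) ^ j = (- of_real x) ^ j * of_real u ^ j" for j
      by (simp flip: power_mult_distrib)
    have xu: "of_real (x * u) powr (s - 1) = of_real x powr (s - 1) * (of_real u powr (s - 1) :: complex)"
      using x u by (simp add: powr_times_real)
    have "lsum s (of_real (x * u)) = a * of_real u powr (s - 1) + (\<Sum>j<K. b j * of_real u ^ j) + lrem K s (x * u)"
      using lsum_expansion[OF s sK, of "x * u"] u x unfolding a_def b_def xu m by (simp add: mult_ac)
    thus "of_real u powr (t - 1) * (lsum r (of_real u) * lsum s (of_real (x * u))) =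
       a * (of_real u powr ((s + t - 1) - 1) * lsum r (of_real u)) +
        (\<Sum>j<K. b j * (of_real u powr ((t + of_nat j) - 1) * lsum r (of_real u))) +
        of_real u powr (t - 1) * (lsum r (of_real u) * lrem K s (x * u))"
      unfolding p1 p2 by (simp add: ring_distribs sum_distrib_left sum_distrib_right mult_ac)
  qed
  also have "\<dots> = a * (Gamma (s + t - 1) * riemann_zeta (r + (s + t - 1))) +
       (\<Sum>j<K. b j * (Gamma (t + of_nat j) * riemann_zeta (r + (t + of_nat j)))) + mt_rem K r s t x"
  proof -
    have "(\<integral>u. of_real u powr ((s + t - 1) - 1) * lsum r (of_real u) \<partial>lpos) = Gamma (s + t - 1) * riemann_zeta (r + (s + t - 1))"
      by (rule mellin_lsum(2)) (use dr in auto)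
    moreover have "(\<integral>u. of_real u powr ((t + of_nat j) - 1) * lsum r (of_real u) \<partial>lpos) = Gamma (t + of_nat j) * riemann_zeta (r + (t + of_nat j))" for j
      by (rule mellin_lsum(2)) (use dr t in auto)
    ultimately show ?thesis
      unfolding mt_rem_def using int1 int2 mt_rem_integrable[OF K x]
      by (simp del: One_nat_def)
  qed
  finally have E: "Gamma t * mt_series r s t x = a * (Gamma (s + t - 1) * riemann_zeta (r + (s + t - 1))) +
       (\<Sum>j<K. b j * (Gamma (t + of_nat j) * riemann_zeta (r + (t + of_nat j)))) + mt_rem K r s t x" .
  have "mt_series r s t x = rGamma t * (Gamma t * mt_series r s t x)"
    using tn by (simp add: rGamma_inverse_Gamma Gamma_eq_zero_iff)
  also have "\<dots> = Gamma (1 - s) * mt_gam r s t x + (\<Sum>j<K. mt_summand j r s t x) + rGamma t * mt_rem K r s t x"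
  proof -
    have "rGamma t * (a * (Gamma (s + t - 1) * riemann_zeta (r + (s + t - 1)))) = Gamma (1 - s) * mt_gam r s t x"
      by (simp add: a_def mt_gam_def algebra_simps)
    moreover have "rGamma t * (b j * (Gamma (t + of_nat j) * riemann_zeta (r + (t + of_nat j)))) = mt_summand j r s t x" for j
    proof -
      have "rGamma t * Gamma (t + of_nat j) = pochhammer t j"
        by (rule rGamma_mult_Gamma_shift, rule Re_pos_not_nonpos_Int) (use t in simp)
      thus ?thesis by (simp add: mt_summand_def mt_coeff_def b_def add.assoc)
    qed
    ultimately show ?thesis unfolding E by (simp only: distrib_left sum_distrib_left)
  qed
  also have "\<dots> = mt_cont r s t x"
    using s by (simp add: mt_cont_eq[OF K x] mt_fun_def mt_sum_def)
  finally show ?thesis ..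
qed

text \<open>Positive integers \<open>s\<close> are isolated and both sides are continuous in
  \<open>s\<close>, so the generic identity extends to them.\<close>

lemma mt_cont_eq_series_pos:
  assumes d: "(r, s, t) \<in> mt_convergence_region" and x: "x > 0" and t: "Re t > 0"
  shows "mt_cont r s t x = mt_series r s t x"
proof (cases "s \<in> of_nat ` {1..}")
  case True
  let ?V = "{s. (r, s, t) \<in> mt_convergence_region}"
  have V: "open (?V \<inter> ball s 1)" "s \<in> ?V \<inter> ball s 1" using open_region_slices d by auto
  have V1: "open ?V" "s \<in> ?V" using V open_region_slices by auto
  have V2: "open {s. (r, s, t) \<notin> mt_singular_set}" "s \<in> {s. (r, s, t) \<notin> mt_singular_set}"
    using open_nonsingular_slices region_nonsingular[OF d] by auto
  have 1: "((\<lambda>s. mt_series r s t x) \<longlongrightarrow> mt_series r s t x) (at s)"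
    using holomorphic_on_imp_continuous_on[OF mt_series_holomorphic(1)[OF x]] V1
    by (metis continuous_on_eq_continuous_at isCont_def)
  have 2: "((\<lambda>s. mt_cont r s t x) \<longlongrightarrow> mt_cont r s t x) (at s)"
    using holomorphic_on_imp_continuous_on[OF mt_cont_holomorphic(2)[OF x]] V2
    by (metis continuous_on_eq_continuous_at isCont_def)
  have "\<forall>\<^sub>F s' in at s. s' \<in> (?V \<inter> ball s 1) - {s}" by (rule eventually_at_in_open[OF V])
  hence "\<forall>\<^sub>F s' in at s. mt_series r s' t x = mt_cont r s' t x"
  proof eventually_elim
    case (elim s')
    hence "s' \<notin> of_nat ` {1..}" using of_nat_image_isolated[of s' s] True by auto
    thus ?case using elim by (intro mt_cont_eq_series_generic[symmetric] x t) auto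
  qed
  from Lim_transform_eventually[OF 1 this] 2 show ?thesis
    using tendsto_unique trivial_limit_at by metis
qed (use assms mt_cont_eq_series_generic in blast)

lemma region_slice:
  "{t. (r, s, t) \<in> mt_convergence_region} = {t. Re t > max (1 - Re r) (max (1 - Re s) (2 - Re r - Re s))}"
  by (auto simp: mt_convergence_region_def)

text \<open>For fixed \<open>r\<close> and \<open>s\<close> the region is a half-plane in
  \<open>t\<close>; the identity theorem there removes the restriction
  \<open>Re t > 0\<close>.\<close>

lemma mt_cont_eq_series:
  assumes d: "(r, s, t) \<in> mt_convergence_region" and x: "x > 0"
  shows "mt_cont r s t x = mt_series r s t x"
proof (rule analytic_continuation_open[where f = "\<lambda>t. mt_cont r s t x" and g = "\<lambda>t. mt_series r s t x" and z = t
    and s = "{t. (r, s, t) \<in> mt_convergence_region} \<inter> {t. Re t > 0}" and s' = "{t. (r, s, t) \<in> mt_convergence_region}"])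
  show "open ({t. (r, s, t) \<in> mt_convergence_region} \<inter> {t. Re t > 0})"
    by (intro open_Int open_region_slices open_Re_gt)
  show "connected {t. (r, s, t) \<in> mt_convergence_region}"
    unfolding region_slice by (intro convex_connected convex_halfspace_Re_gt)
  have "of_real (max 0 (max (1 - Re r) (max (1 - Re s) (2 - Re r - Re s))) + 1) \<in>
          {t. (r, s, t) \<in> mt_convergence_region} \<inter> {t. Re t > 0}"
    unfolding region_slice by auto
  thus "{t. (r, s, t) \<in> mt_convergence_region} \<inter> {t. Re t > 0} \<noteq> {}" by blast
  show "(\<lambda>t. mt_cont r s t x) holomorphic_on {t. (r, s, t) \<in> mt_convergence_region}"
    by (rule holomorphic_on_subset[OF mt_cont_holomorphic(3)[OF x]]) (use region_nonsingular in auto)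
  show "(\<lambda>t. mt_series r s t x) holomorphic_on {t. (r, s, t) \<in> mt_convergence_region}"
    by (rule mt_series_holomorphic(2)[OF x])
qed (use d x mt_cont_eq_series_pos in \<open>auto intro: open_region_slices\<close>)

lemma mt_continuation_mt_cont:
  assumes x: "x > 0"
  shows "mt_continuation x (\<lambda>r s t. mt_cont r s t x)"
  unfolding mt_continuation_def holomorphic3_on_def
  using mt_cont_holomorphic[OF x] mt_cont_eq_series[OF _ x] by auto

text \<open>Infinitely many points may be missing, but only countably many, and a plane without a
  countable set is connected. This makes the continuation in \<open>t\<close> unique.\<close>

lemma connected_nonsingular: "connected {t. (r, s, t) \<notin> mt_singular_set}"
proof -
  have "{t. (r, s, t) \<in> mt_singular_set} \<subseteq> range (\<lambda>l::nat. 1 - of_nat l - r) \<union> range (\<lambda>l::nat. 1 - of_nat l - s) \<union> {2 - r - s}"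
    by (auto simp: mt_singular_set_def algebra_simps image_iff)
  hence "countable {t. (r, s, t) \<in> mt_singular_set}" by (rule countable_subset) auto
  hence "connected (UNIV - {t. (r, s, t) \<in> mt_singular_set})"
    by (intro connected_open_diff_countable) auto
  also have "UNIV - {t. (r, s, t) \<in> mt_singular_set} = {t. (r, s, t) \<notin> mt_singular_set}" by auto
  finally show ?thesis .
qed

lemma Theta_eq_mt_cont:
  assumes n: "(r, s, t) \<notin> mt_singular_set" and x: "x > 0"
  shows "Theta r s t x = mt_cont r s t x"
proof -
  define F where "F = (SOME F. mt_continuation x F)"
  have F: "mt_continuation x F"
    unfolding F_def by (rule someI[of "mt_continuation x"]) (rule mt_continuation_mt_cont[OF x])
  have "F r s t = mt_cont r s t x"
  proof (rule analytic_continuation_open[where f = "F r s" and g = "\<lambda>t. mt_cont r s t x" and z = t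
      and s = "{t. (r, s, t) \<in> mt_convergence_region}" and s' = "{t. (r, s, t) \<notin> mt_singular_set}"])
    show "open {t. (r, s, t) \<in> mt_convergence_region}" by (rule open_region_slices)
    show "open {t. (r, s, t) \<notin> mt_singular_set}" by (rule open_nonsingular_slices)
    show "connected {t. (r, s, t) \<notin> mt_singular_set}" by (rule connected_nonsingular)
    have "of_real (max (1 - Re r) (max (1 - Re s) (2 - Re r - Re s)) + 1) \<in> {t. (r, s, t) \<in> mt_convergence_region}"
      unfolding region_slice mem_Collect_eq Re_complex_of_real by (rule less_add_one)
    thus "{t. (r, s, t) \<in> mt_convergence_region} \<noteq> {}" by blast
    show "{t. (r, s, t) \<in> mt_convergence_region} \<subseteq> {t. (r, s, t) \<notin> mt_singular_set}"
      using region_nonsingular by auto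
    show "F r s holomorphic_on {t. (r, s, t) \<notin> mt_singular_set}"
      using F by (auto simp: mt_continuation_def holomorphic3_on_def)
    show "(\<lambda>t. mt_cont r s t x) holomorphic_on {t. (r, s, t) \<notin> mt_singular_set}"
      by (rule mt_cont_holomorphic(3)[OF x])
    fix t assume "t \<in> {t. (r, s, t) \<in> mt_convergence_region}"
    thus "F r s t = mt_cont r s t x"
      using F mt_cont_eq_series[OF _ x] by (auto simp: mt_continuation_def)
  qed (use n in auto)
  thus ?thesis by (simp add: Theta_def F_def)
qed

section \<open>Expansions around a nonpositive integer\<close>

definition zeta_reg :: "complex \<Rightarrow> complex" where
  "zeta_reg s = (if s = 1 then euler_mascheroni else riemann_zeta s - 1 / (s - 1))"

lemma zeta_reg_holomorphic: "zeta_reg holomorphic_on UNIV"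
proof (rule no_isolated_singularity'[of "{1}"])
  fix z :: complex assume "z \<in> {1}"
  moreover have "(zeta_reg \<longlongrightarrow> euler_mascheroni) (at 1)"
    by (rule Lim_transform_eventually[OF zeta_minus_pole_tendsto])
       (auto simp: eventually_at_filter zeta_reg_def)
  ultimately show "(zeta_reg \<longlongrightarrow> zeta_reg z) (at z within UNIV)" by (simp add: zeta_reg_def)
next
  have "(\<lambda>s. riemann_zeta s - 1 / (s - 1)) holomorphic_on UNIV - {1}"
    by (intro holomorphic_intros holomorphic_on_subset[OF holomorphic_riemann_zeta]) auto
  thus "zeta_reg holomorphic_on UNIV - {1}"
    by (rule holomorphic_transform) (auto simp: zeta_reg_def)
qed auto

text \<open>The quotient \<open>h\<close> is a difference quotient on the whole plane, so the
  identity holds for every \<open>u\<close>, although analyticity is claimed at \<open>0\<close>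
  only. Applied repeatedly, it gives Taylor expansions with exact remainders.\<close>

lemma analytic_split:
  assumes "f analytic_on {0 :: complex}"
  obtains h where "h analytic_on {0}" "h 0 = deriv f 0" "\<And>u. f u = f 0 + u * h u"
proof -
  obtain S where S: "open S" "0 \<in> S" "f holomorphic_on S" using assms unfolding analytic_at by blast
  define h where "h = (\<lambda>z. if z = 0 then deriv f 0 else (f z - f 0) / (z - 0))"
  have "h holomorphic_on S" unfolding h_def by (rule pole_lemma_open) (use S in auto)
  hence "h analytic_on {0}" using S unfolding analytic_at by blast
  thus ?thesis by (rule that) (auto simp: h_def)
qed

text \<open>Equality up to \<open>u\<close> times an analytic function, where \<open>g\<close> may
  have a pole. An exact remainder turns products of Laurent expansions into algebraic identities;
  the bound by \<open>t - t0\<close> is drawn from it only at the end.\<close>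

definition eqO :: "(complex \<Rightarrow> complex) \<Rightarrow> (complex \<Rightarrow> complex) \<Rightarrow> bool" where
  "eqO f g \<longleftrightarrow> (\<exists>h. h analytic_on {0} \<and> (\<forall>\<^sub>F u in at 0. f u = g u + u * h u))"

lemma eqOI: "h analytic_on {0} \<Longrightarrow> \<forall>\<^sub>F u in at 0. f u = g u + u * h u \<Longrightarrow> eqO f g"
  by (auto simp: eqO_def)

lemma eqO_analytic:
  assumes "f analytic_on {0}"
  shows "eqO f (\<lambda>_. f 0)"
proof -
  obtain h where h: "h analytic_on {0}" "\<And>u. f u = f 0 + u * h u" using analytic_split[OF assms] by blast
  show ?thesis by (rule eqOI[OF h(1)]) (intro always_eventually allI h(2))
qed

lemma eqO_add:
  assumes "eqO f g" "eqO f' g'"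
  shows "eqO (\<lambda>u. f u + f' u) (\<lambda>u. g u + g' u)"
proof -
  from assms obtain h h' where h: "h analytic_on {0}" "h' analytic_on {0}"
    and ev: "\<forall>\<^sub>F u in at 0. f u = g u + u * h u" "\<forall>\<^sub>F u in at 0. f' u = g' u + u * h' u"
    unfolding eqO_def by blast
  show ?thesis
  proof (rule eqOI)
    show "(\<lambda>u. h u + h' u) analytic_on {0}" by (intro analytic_intros h)
    show "\<forall>\<^sub>F u in at 0. f u + f' u = g u + g' u + u * (h u + h' u)"
      using ev by eventually_elim (simp add: algebra_simps)
  qed
qed

lemma eqO_sum:
  assumes "\<And>i. i \<in> A \<Longrightarrow> eqO (f i) (g i)"
  shows "eqO (\<lambda>u. \<Sum>i\<in>A. f i u) (\<lambda>u. \<Sum>i\<in>A. g i u)"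
  using assms
proof (induction A rule: infinite_finite_induct)
  case (insert i A)
  thus ?case using eqO_add[of "f i" "g i" "\<lambda>u. \<Sum>i\<in>A. f i u" "\<lambda>u. \<Sum>i\<in>A. g i u"] by simp
qed (use eqO_analytic[of "\<lambda>_. 0"] in \<open>auto intro: analytic_intros\<close>)

lemma eqO_cong:
  assumes "eqO f g" "\<forall>\<^sub>F u in at 0. f' u = f u" "\<And>u. g' u = g u"
  shows "eqO f' g'"
proof -
  from assms(1) obtain h where "h analytic_on {0}" "\<forall>\<^sub>F u in at 0. f u = g u + u * h u"
    unfolding eqO_def by blast
  with assms(2,3) show ?thesis by (intro eqOI[of h]) (auto elim: eventually_elim2)
qed

lemma eqO_imp_bigo:
  assumes "eqO (\<lambda>u. f (t0 + u)) (\<lambda>u. g (t0 + u))"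
  shows "(\<lambda>t. f t - g t) \<in> O[at t0](\<lambda>t. t - t0)"
proof -
  from assms obtain h where h: "h analytic_on {0}" and ev: "\<forall>\<^sub>F u in at 0. f (t0 + u) = g (t0 + u) + u * h u"
    unfolding eqO_def by blast
  have "isCont h 0" using analytic_at_imp_isCont[OF h] .
  hence "(h \<longlongrightarrow> h 0) (at 0)" by (simp add: isCont_def)
  from tendstoD[OF this, of 1] have "\<forall>\<^sub>F u in at 0. dist (h u) (h 0) < 1" by simp
  hence bd: "\<forall>\<^sub>F u in at 0. norm (h u) \<le> norm (h 0) + 1"
  proof eventually_elim
    case (elim u)
    thus ?case using norm_triangle_ineq2[of "h u" "h 0"] by (simp add: dist_norm)
  qed
  have "\<forall>\<^sub>F u in at 0. norm (f (u + t0) - g (u + t0)) \<le> (norm (h 0) + 1) * norm ((u + t0) - t0)"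
    using ev bd by eventually_elim (simp add: norm_mult add.commute mult.commute mult_left_mono)
  hence "\<forall>\<^sub>F t in at t0. norm (f t - g t) \<le> (norm (h 0) + 1) * norm (t - t0)"
    by (subst eventually_at_to_0)
  thus ?thesis by (rule bigoI)
qed

section \<open>Local expansions of the coefficients, of zeta and of Digamma\<close>

lemma eventually_not_nonpos_Int: "\<forall>\<^sub>F u in at (0 :: complex). w + u \<notin> \<int>\<^sub>\<le>\<^sub>0"
proof (cases "w \<in> \<int>\<^sub>\<le>\<^sub>0")
  case True
  then obtain n where n: "w = - of_nat n" by (auto elim!: nonpos_Ints_cases')
  have "\<forall>\<^sub>F u in at (0 :: complex). u \<in> ball 0 1 - {0}" by (rule eventually_at_in_open) auto
  thus ?thesis
  proof eventually_elim
    case (elim u)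
    show ?case
    proof
      assume "w + u \<in> \<int>\<^sub>\<le>\<^sub>0"
      then obtain m where "w + u = - of_nat m" by (auto elim!: nonpos_Ints_cases')
      hence u: "u = of_int (int n - int m)" by (simp add: n algebra_simps)
      hence "norm u = real_of_int \<bar>int n - int m\<bar>" by (simp only: norm_of_int)
      hence "\<bar>real n - real m\<bar> < 1" using elim by simp
      hence "n = m" by linarith
      thus False using u elim by simp
    qed
  qed
next
  case False
  have "open {u. w + u \<notin> \<int>\<^sub>\<le>\<^sub>0}" by (intro open_not_nonpos_Ints continuous_intros)
  hence "\<forall>\<^sub>F u in at 0. u \<in> {u. w + u \<notin> \<int>\<^sub>\<le>\<^sub>0} - {0}" by (rule eventually_at_in_open) (use False in simp)
  thus ?thesis by eventually_elim simp
qed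

text \<open>At \<open>t = - N\<close> the binomial series is finite: coefficients with
  \<open>j > N\<close> vanish. This is why the sums in the theorem end at
  \<open>r + l - 1\<close>.\<close>

lemma mt_coeff_at_neg_nat: "mt_coeff j (- of_nat N) x = of_nat (N choose j) * of_real x ^ j"
proof -
  have "of_nat (N choose j) = (-1) ^ j * pochhammer (- of_nat N) j / (fact j :: complex)"
    by (simp add: binomial_gbinomial gbinomial_pochhammer)
  thus ?thesis by (simp add: mt_coeff_def power_minus[of "of_real x"])
qed

lemma sum_top_diff:
  fixes f :: "nat \<Rightarrow> complex"
  assumes "i \<le> N"
  shows "(\<Sum>k<i. f (N - k)) = (\<Sum>k=1..N. f k) - (\<Sum>k=1..N-i. f k)"
  using assms
proof (induction i)
  case (Suc i)
  hence "N - i = Suc (N - Suc i)" by simp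
  hence "(\<Sum>k=1..N-i. f k) = (\<Sum>k=1..N - Suc i. f k) + f (N - i)" by simp
  with Suc show ?case by simp
qed auto

text \<open>The coefficient of \<open>u^2\<close> is the second elementary symmetric polynomial,
  written by Newton's identity through power sums; those turn into harmonic numbers and sums of
  inverse squares.\<close>

lemma prod_one_minus_expansion:
  fixes v :: "nat \<Rightarrow> complex"
  shows "\<exists>q. q analytic_on {0} \<and> (\<forall>u. (\<Prod>k<i. 1 - u * v k) =
           1 - (\<Sum>k<i. v k) * u + ((\<Sum>k<i. v k)\<^sup>2 - (\<Sum>k<i. (v k)\<^sup>2)) / 2 * u ^ 2 + u ^ 3 * q u)"
proof (induction i)
  case 0
  show ?case by (intro exI[of _ "\<lambda>_. 0"]) auto
next
  case (Suc i)
  then obtain q where q: "q analytic_on {0}" and e: "\<And>u. (\<Prod>k<i. 1 - u * v k) =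
           1 - (\<Sum>k<i. v k) * u + ((\<Sum>k<i. v k)\<^sup>2 - (\<Sum>k<i. (v k)\<^sup>2)) / 2 * u ^ 2 + u ^ 3 * q u" by blast
  define a b w where "a = (\<Sum>k<i. v k)" and "b = (\<Sum>k<i. (v k)\<^sup>2)" and "w = v i"
  have "(\<lambda>u. q u - u * q u * w - (a\<^sup>2 - b) / 2 * w) analytic_on {0}" by (intro analytic_intros q) auto
  moreover have "(1 - a * u + (a\<^sup>2 - b) / 2 * u ^ 2 + u ^ 3 * Q) * (1 - u * w) =
      1 - (a + w) * u + ((a + w)\<^sup>2 - (b + w\<^sup>2)) / 2 * u ^ 2 + u ^ 3 * (Q - u * Q * w - (a\<^sup>2 - b) / 2 * w)" for u Q
    by (simp add: field_simps power2_eq_square power3_eq_cube)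
  ultimately show ?case
    by (intro exI[of _ "\<lambda>u. q u - u * q u * w - (a\<^sup>2 - b) / 2 * w"]) (simp add: e a_def b_def w_def)
qed

abbreviation inv_sq_sum :: "nat \<Rightarrow> complex" where
  "inv_sq_sum n \<equiv> \<Sum>k=1..n. inverse (of_nat k) ^ 2"

text \<open>Each factor \<open>- N + k + u\<close> is \<open>(- N + k) * (1 - u / (N - k))\<close>,
  so the power sums run over the reciprocals of \<open>N, ..., N - i + 1\<close>. Order
  \<open>u^2\<close> is enough against a double pole.\<close>

lemma mt_coeff_expansion:
  assumes "i \<le> N"
  obtains q where "q analytic_on {0}"
    "\<And>u. mt_coeff i (- of_nat N + u) x = of_nat (N choose i) * of_real x ^ i *
       (1 - (harm N - harm (N - i)) * u +
         ((harm N - harm (N - i))\<^sup>2 - (inv_sq_sum N - inv_sq_sum (N - i))) / 2 * u ^ 2 + u ^ 3 * q u)"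
proof -
  define v :: "nat \<Rightarrow> complex" where "v = (\<lambda>k. inverse (of_nat (N - k)))"
  obtain q where q: "q analytic_on {0}" and e: "\<And>u. (\<Prod>k<i. 1 - u * v k) =
           1 - (\<Sum>k<i. v k) * u + ((\<Sum>k<i. v k)\<^sup>2 - (\<Sum>k<i. (v k)\<^sup>2)) / 2 * u ^ 2 + u ^ 3 * q u"
    using prod_one_minus_expansion by blast
  have a: "(\<Sum>k<i. v k) = harm N - harm (N - i)"
    unfolding v_def harm_def by (rule sum_top_diff[OF assms])
  have b: "(\<Sum>k<i. (v k)\<^sup>2) = inv_sq_sum N - inv_sq_sum (N - i)"
    unfolding v_def by (rule sum_top_diff[OF assms, of "\<lambda>k. inverse (of_nat k) ^ 2"])
  have "mt_coeff i (- of_nat N + u) x = mt_coeff i (- of_nat N) x * (\<Prod>k<i. 1 - u * v k)" for u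
  proof -
    have "pochhammer (- of_nat N + u) i = (\<Prod>k<i. (- of_nat N + of_nat k) * (1 - u * v k))"
      unfolding pochhammer_prod lessThan_atLeast0
    proof (intro prod.cong refl)
      fix k assume k: "k \<in> {0..<i}"
      have "(of_nat (N - k) :: complex) \<noteq> 0" using k assms by simp
      moreover have "(of_nat N :: complex) = of_nat (N - k) + of_nat k" using k assms by (simp add: of_nat_diff)
      ultimately show "- of_nat N + u + of_nat k = (- of_nat N + of_nat k) * (1 - u * v k)"
        by (simp add: v_def field_simps)
    qed
    thus ?thesis by (simp add: mt_coeff_def prod.distrib pochhammer_prod lessThan_atLeast0)
  qed
  hence "\<And>u. mt_coeff i (- of_nat N + u) x = of_nat (N choose i) * of_real x ^ i *
       (1 - (harm N - harm (N - i)) * u +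
         ((harm N - harm (N - i))\<^sup>2 - (inv_sq_sum N - inv_sq_sum (N - i))) / 2 * u ^ 2 + u ^ 3 * q u)"
    unfolding mt_coeff_at_neg_nat e a b .
  with q show ?thesis by (rule that)
qed

lemma analytic_at_shift:
  assumes "f holomorphic_on S" "open S" "a \<in> S"
  shows "(\<lambda>u. f (a + u)) analytic_on {0}"
proof -
  have "f analytic_on S" using assms by (simp add: analytic_on_open)
  hence "f \<circ> (\<lambda>u. a + u) analytic_on {0}"
    by (rule analytic_on_compose_gen[rotated]) (use assms(3) in \<open>auto intro!: analytic_intros\<close>)
  thus ?thesis by (simp add: o_def)
qed

text \<open>The same \<open>z1\<close> occurs in both expansions. It cancels in the double-pole
  case, which is why no higher Stieltjes constant appears in the result.\<close>

lemma zeta_reg_expansion: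
  obtains z1 z2 z3 where "z2 analytic_on {0}" "z3 analytic_on {0}"
    "\<And>u. u \<noteq> 0 \<Longrightarrow> riemann_zeta (1 + u) = 1 / u + euler_mascheroni + z1 * u + u ^ 2 * z2 u"
    "\<And>u. u \<noteq> 0 \<Longrightarrow> deriv riemann_zeta (1 + u) = - 1 / u ^ 2 + z1 + u * z3 u"
proof -
  have an: "(\<lambda>u. zeta_reg (1 + u)) analytic_on {0}"
    by (rule analytic_at_shift[OF zeta_reg_holomorphic]) auto
  have dan: "(\<lambda>u. deriv zeta_reg (1 + u)) analytic_on {0}"
    by (rule analytic_at_shift[OF holomorphic_deriv[OF zeta_reg_holomorphic]]) auto
  obtain h where h: "h analytic_on {0}" "h 0 = deriv (\<lambda>u. zeta_reg (1 + u)) 0" "\<And>u. zeta_reg (1 + u) = zeta_reg (1 + 0) + u * h u"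
    using analytic_split[OF an] by blast
  obtain h2 where h2: "h2 analytic_on {0}" "\<And>u. h u = h 0 + u * h2 u"
    using analytic_split[OF h(1)] by blast
  obtain h3 where h3: "h3 analytic_on {0}" "\<And>u. deriv zeta_reg (1 + u) = deriv zeta_reg (1 + 0) + u * h3 u"
    using analytic_split[OF dan] by blast
  have zd: "(zeta_reg has_field_derivative deriv zeta_reg z) (at z)" for z
    by (rule holomorphic_derivI[OF zeta_reg_holomorphic]) auto
  have "((\<lambda>u. zeta_reg (1 + u)) has_field_derivative deriv zeta_reg (1 + 0) * 1) (at 0)"
    by (rule DERIV_chain2[OF zd]) (auto intro!: derivative_eq_intros)
  hence h0: "h 0 = deriv zeta_reg (1 + 0)" unfolding h(2) using DERIV_imp_deriv by fastforce
  have Z: "riemann_zeta s = 1 / (s - 1) + zeta_reg s" if "s \<noteq> 1" for s using that by (simp add: zeta_reg_def)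
  show ?thesis
  proof (rule that[of h2 h3 "h 0"])
    fix u :: complex assume u: "u \<noteq> 0"
    show "riemann_zeta (1 + u) = 1 / u + euler_mascheroni + h 0 * u + u ^ 2 * h2 u"
      using Z[of "1 + u"] h(3)[of u] h2(2)[of u] u by (simp add: zeta_reg_def[of 1] algebra_simps power2_eq_square)
    have "deriv riemann_zeta (1 + u) = deriv (\<lambda>s. 1 / (s - 1) + zeta_reg s) (1 + u)"
      by (rule deriv_cong_ev)
         (use u in \<open>auto intro!: eventually_mono[OF eventually_nhds_in_open[of "- {1}" "1 + u"]] Z\<close>)
    also have "\<dots> = - 1 / u ^ 2 + deriv zeta_reg (1 + u)"
    proof (rule DERIV_imp_deriv, rule DERIV_add[OF _ zd])
      show "((\<lambda>s. 1 / (s - 1)) has_field_derivative - 1 / u ^ 2) (at (1 + u))"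
        using u by (auto intro!: derivative_eq_intros simp: power2_eq_square)
    qed
    finally show "deriv riemann_zeta (1 + u) = - 1 / u ^ 2 + h 0 + u * h3 u" using h3(2)[of u] h0 by simp
  qed (use h2 h3 in auto)
qed

lemma Polygamma_1_1: "Polygamma 1 (1 :: complex) = of_real (pi ^ 2 / 6)"
proof -
  have "Polygamma 1 (1 :: real) = pi ^ 2 / 6"
    using Polygamma_LIMSEQ[of "1 :: real" 1] inverse_squares_sums
    by (simp add: sums_iff add_ac power2_eq_square field_simps)
  moreover have "Polygamma 1 (1 :: complex) = of_real (Polygamma 1 (1 :: real))"
    using Polygamma_of_real[of 1 1, where ?'a = complex] by simp
  ultimately show ?thesis by (simp only:)
qed

lemma Polygamma_1_of_nat:
  "Polygamma 1 (of_nat (Suc n) :: complex) = of_real (pi ^ 2 / 6) - inv_sq_sum n"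
proof -
  have "Polygamma 1 (1 + of_nat n :: complex) = Polygamma 1 1 - (\<Sum>k<n. 1 / (1 + of_nat k)\<^sup>2)"
    by (subst Polygamma_plus_of_nat) (auto simp: power2_eq_square add_eq_0_iff2 complex_eq_iff)
  also have "(\<Sum>k<n. 1 / (1 + of_nat k :: complex)\<^sup>2) = inv_sq_sum n"
    by (rule sum.reindex_bij_witness[of _ "\<lambda>k. k - 1" Suc]) (auto simp: divide_inverse power_inverse)
  finally show ?thesis by (simp only: Polygamma_1_1 of_nat_Suc)
qed

text \<open>The recurrence moves the argument from \<open>- n + u\<close> to \<open>1 + u\<close>;
  one of the \<open>n + 1\<close> reciprocals is \<open>1 / u\<close>, and the others join
  \<open>Digamma (1 + u)\<close> in the regular function \<open>P\<close>, whose Taylor coefficients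
  at \<open>0\<close> are those shown.\<close>

lemma Digamma_pole_expansion:
  obtains p where "p analytic_on {0}"
    "\<forall>\<^sub>F u in at 0. Digamma (- of_nat n + u) = - 1 / u + (harm n - euler_mascheroni) +
        (of_real (pi ^ 2 / 6) + inv_sq_sum n) * u + u ^ 2 * p (u :: complex)"
proof -
  define P where "P = (\<lambda>u::complex. Digamma (1 + u) + (\<Sum>k=1..n. inverse (of_nat k - u)))"
  have Pan: "P analytic_on {0}"
    unfolding P_def
    by (intro analytic_intros analytic_on_Polygamma') auto
  obtain h where h: "h analytic_on {0}" "h 0 = deriv P 0" "\<And>u. P u = P 0 + u * h u"
    using analytic_split[OF Pan] by blast
  obtain p where p: "p analytic_on {0}" "\<And>u. h u = h 0 + u * p u"
    using analytic_split[OF h(1)] by blast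
  have "(P has_field_derivative Polygamma 1 1 + inv_sq_sum n) (at 0)"
    unfolding P_def
    by (auto intro!: derivative_eq_intros sum.cong simp: power2_eq_square)
  hence h0: "h 0 = of_real (pi ^ 2 / 6) + inv_sq_sum n"
    unfolding h(2) Polygamma_1_1 by (rule DERIV_imp_deriv)
  have P0: "P 0 = harm n - euler_mascheroni" by (simp add: P_def harm_def)
  have "\<forall>\<^sub>F u in at 0. Digamma (- of_nat n + u) = - 1 / u + P u"
    using eventually_not_nonpos_Int[of "- of_nat n"] eventually_neq_at_within[of 0 0 UNIV]
  proof eventually_elim
    case (elim u)
    have ne: "- of_nat n + u \<noteq> - of_nat k" for k using elim(1) by (metis minus_of_nat_in_nonpos_Ints)
    have "Digamma ((- of_nat n + u) + of_nat (Suc n)) = Digamma (- of_nat n + u) + (\<Sum>k<Suc n. 1 / (- of_nat n + u + of_nat k))"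
      by (subst Polygamma_plus_of_nat) (use ne in auto)
    moreover have "(- of_nat n + u) + of_nat (Suc n) = 1 + u" by simp
    moreover have "(\<Sum>k<n. 1 / (- of_nat n + u + of_nat k)) = - (\<Sum>k=1..n. inverse (of_nat k - u))"
      unfolding sum_negf[symmetric]
    proof (rule sum.reindex_bij_witness[of _ "\<lambda>k. n - k" "\<lambda>k. n - k"])
      fix k assume "k \<in> {..<n}"
      hence "of_nat (n - k) - u = - (- of_nat n + u + of_nat k)" by (simp add: of_nat_diff)
      thus "- inverse (of_nat (n - k) - u) = 1 / (- of_nat n + u + of_nat k)"
        by (simp only: inverse_minus_eq minus_minus inverse_eq_divide divide_minus_right)
    qed auto
    ultimately show ?case by (simp add: P_def algebra_simps)
  qed
  hence "\<forall>\<^sub>F u in at 0. Digamma (- of_nat n + u) = - 1 / u + (harm n - euler_mascheroni) +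
        (of_real (pi ^ 2 / 6) + inv_sq_sum n) * u + u ^ 2 * p u"
  proof eventually_elim
    case (elim u)
    have "P u = P 0 + u * (h 0 + u * p u)" using h(3)[of u] p(2)[of u] by (simp only:)
    thus ?case unfolding elim P0 h0 by (simp add: power2_eq_square algebra_simps)
  qed
  with p(1) show ?thesis by (rule that)
qed


section \<open>Expansions of the single terms of the continuation\<close>

lemma open_pole_free: "open {t. s + t - 1 \<notin> \<int>\<^sub>\<le>\<^sub>0 \<and> r + s + t - 1 \<noteq> (1 :: complex)}"
  by (intro open_Collect_conj open_not_nonpos_Ints open_Collect_neq continuous_intros)

lemma eventually_nonsingular: "\<forall>\<^sub>F u in at 0. (r, s, t0 + u) \<notin> mt_singular_set"
proof -
  have "\<forall>\<^sub>F u in at 0. (r + t0 - 1) + u \<notin> \<int>\<^sub>\<le>\<^sub>0" "\<forall>\<^sub>F u in at 0. (s + t0 - 1) + u \<notin> \<int>\<^sub>\<le>\<^sub>0"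
    by (rule eventually_not_nonpos_Int)+
  moreover have "\<forall>\<^sub>F u in at 0. u \<noteq> 2 - r - s - t0" by (rule eventually_neq_at_within)
  ultimately show ?thesis
    by eventually_elim (auto simp: mt_nonsingular_iff algebra_simps)
qed

lemma Theta_eventually_eq_mt_fun:
  assumes "(r, s, t0) \<in> mt_dom K" "x > 0"
  shows "\<forall>\<^sub>F u in at 0. Theta r s (t0 + u) x = mt_fun K r s (t0 + u) x"
proof -
  have "open ((\<lambda>u. t0 + u) -` {t. (r, s, t) \<in> mt_dom K})"
    by (intro open_vimage open_mt_dom_slices continuous_intros)
  hence "\<forall>\<^sub>F u in at 0. u \<in> (\<lambda>u. t0 + u) -` {t. (r, s, t) \<in> mt_dom K} - {0}"
    by (rule eventually_at_in_open) (use assms in simp)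
  with eventually_nonsingular[of r s t0] show ?thesis
    by eventually_elim (use assms(2) in \<open>simp add: Theta_eq_mt_cont mt_cont_eq\<close>)
qed

lemma rGamma_neg_nat: "rGamma (- of_nat N :: complex) = 0"
  by (simp add: rGamma_eq_zero_iff)

lemma mt_rem_eqO:
  assumes "(r, s, - of_nat N) \<in> mt_dom K" "x > 0"
  shows "eqO (\<lambda>u. rGamma (- of_nat N + u) * mt_rem K r s (- of_nat N + u) x) (\<lambda>_. 0)"
proof -
  have "(\<lambda>t. rGamma t * mt_rem K r s t x) holomorphic_on {t. (r, s, t) \<in> mt_dom K}"
    by (intro holomorphic_intros mt_rem_holomorphic(3) assms)
  from analytic_at_shift[OF this open_mt_dom_slices(3), of "- of_nat N"]
  have "(\<lambda>u. rGamma (- of_nat N + u) * mt_rem K r s (- of_nat N + u) x) analytic_on {0}"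
    using assms by simp
  from eqO_analytic[OF this] show ?thesis by (simp add: rGamma_neg_nat)
qed

lemma mt_summand_at_neg_nat:
  "mt_summand j r s (- of_nat N) x = of_nat (N choose j) * of_real x ^ j * riemann_zeta (s - of_nat j) * riemann_zeta (r - of_nat N + of_nat j)"
  by (simp add: mt_summand_def mt_coeff_at_neg_nat)

lemma mt_summand_eqO:
  assumes "r + t0 + of_nat j \<noteq> 1"
  shows "eqO (\<lambda>u. mt_summand j r s (t0 + u) x) (\<lambda>_. mt_summand j r s t0 x)"
proof -
  have h: "(\<lambda>t. mt_summand j r s t x) holomorphic_on {t. r + t + of_nat j \<noteq> 1}"
    unfolding mt_summand_def by (intro holomorphic_intros mt_coeff_holomorphic holomorphic_zeta_compose) auto
  have "open {t. r + t + of_nat j \<noteq> 1}" by (intro open_Collect_neq continuous_intros)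
  from analytic_at_shift[OF h this, of t0] have "(\<lambda>u. mt_summand j r s (t0 + u) x) analytic_on {0}"
    using assms by simp
  from eqO_analytic[OF this] show ?thesis by simp
qed

text \<open>Every term with a pole is such a product, so the multiplication is done once, for a pole
  of order at most two. The numbers \<open>a\<close> and \<open>b\<close> are minus the linear and
  the quadratic coefficient of the normalised \<open>mt_coeff\<close>, the latter with its own
  sign.\<close>

lemma mt_coeff_mult_eqO:
  assumes i: "i \<le> N" and W: "W analytic_on {0}"
    and E: "\<forall>\<^sub>F u in at 0. E u = e2 / u ^ 2 + e1 / u + e0 + u * W u"
  defines "a \<equiv> harm N - harm (N - i)"
  defines "b \<equiv> (a\<^sup>2 - (inv_sq_sum N - inv_sq_sum (N - i))) / 2"
  shows "eqO (\<lambda>u. mt_coeff i (- of_nat N + u) x * E u)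
     (\<lambda>u. of_nat (N choose i) * of_real x ^ i * (e2 / u ^ 2 + (e1 - a * e2) / u + (e0 - a * e1 + b * e2)))"
proof -
  define C where "C = (of_nat (N choose i) * of_real x ^ i :: complex)"
  obtain q where q: "q analytic_on {0}"
    "\<And>u. mt_coeff i (- of_nat N + u) x = C * (1 - a * u + b * u ^ 2 + u ^ 3 * q u)"
    unfolding C_def a_def b_def using mt_coeff_expansion[OF i] by blast
  define h where "h = (\<lambda>u. C * (W u * (1 - a * u + b * u ^ 2 + u ^ 3 * q u) - a * e0 + b * e1 + q u * e2 +
       u * (b * e0 + q u * e1) + u ^ 2 * (q u * e0)))"
  show ?thesis
    unfolding C_def[symmetric]
  proof (rule eqOI)
    show "h analytic_on {0}" unfolding h_def by (intro analytic_intros W q)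
    have alg: "C * (1 - a * u + b * u ^ 2 + u ^ 3 * Q) * (e2 / u ^ 2 + e1 / u + e0 + u * w) =
       C * (e2 / u ^ 2 + (e1 - a * e2) / u + (e0 - a * e1 + b * e2)) +
       u * (C * (w * (1 - a * u + b * u ^ 2 + u ^ 3 * Q) - a * e0 + b * e1 + Q * e2 +
         u * (b * e0 + Q * e1) + u ^ 2 * (Q * e0)))" if "u \<noteq> 0" for u Q w
      using that by (simp add: field_simps power2_eq_square power3_eq_cube)
    show "\<forall>\<^sub>F u in at 0. mt_coeff i (- of_nat N + u) x * E u =
        C * (e2 / u ^ 2 + (e1 - a * e2) / u + (e0 - a * e1 + b * e2)) + u * h u"
      using E eventually_neq_at_within[of 0 0 UNIV]
    proof eventually_elim
      case (elim u)
      show ?case unfolding q(2) elim(1) h_def by (rule alg[OF elim(2)])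
    qed
  qed
qed

text \<open>With \<open>r = N - l + 1\<close> the second zeta factor has argument
  \<open>1 + u\<close>: the index \<open>l\<close> is the one at which a summand has a pole.\<close>

lemma mt_summand_pole_eqO:
  assumes "l \<le> N"
  shows "eqO (\<lambda>u. mt_summand l (of_nat (N - l) + 1) s (- of_nat N + u) x)
     (\<lambda>u. of_nat (N choose l) * of_real x ^ l * riemann_zeta (s - of_nat l) *
            (1 / u + (euler_mascheroni - (harm N - harm (N - l)))))"
proof -
  obtain z1 z2 z3 where z: "z2 analytic_on {0}"
    "\<And>u. u \<noteq> 0 \<Longrightarrow> riemann_zeta (1 + u) = 1 / u + euler_mascheroni + z1 * u + u ^ 2 * z2 u"
    using zeta_reg_expansion by metis
  define Z where "Z = riemann_zeta (s - of_nat l)"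
  have "eqO (\<lambda>u. mt_coeff l (- of_nat N + u) x * (Z * riemann_zeta (1 + u)))
     (\<lambda>u. of_nat (N choose l) * of_real x ^ l * (0 / u ^ 2 + (Z - (harm N - harm (N - l)) * 0) / u + (Z * euler_mascheroni - (harm N - harm (N - l)) * Z +
        ((harm N - harm (N - l))\<^sup>2 - (inv_sq_sum N - inv_sq_sum (N - l))) / 2 * 0)))"
  proof (rule mt_coeff_mult_eqO[OF assms])
    show "(\<lambda>u. Z * (z1 + u * z2 u)) analytic_on {0}" by (intro analytic_intros z)
    show "\<forall>\<^sub>F u in at 0. Z * riemann_zeta (1 + u) = 0 / u ^ 2 + Z / u + Z * euler_mascheroni + u * (Z * (z1 + u * z2 u))"
      using eventually_neq_at_within[of 0 0 UNIV]
    proof eventually_elim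
      case (elim u)
      show ?case unfolding z(2)[OF elim] using elim by (simp add: field_simps power2_eq_square)
    qed
  qed
  thus ?thesis
  proof (rule eqO_cong, intro always_eventually allI)
    fix u :: complex
    have e: "of_nat (N - l) + 1 + (- of_nat N + u) + of_nat l = 1 + u" using assms by (simp add: of_nat_diff)
    show "mt_summand l (of_nat (N - l) + 1) s (- of_nat N + u) x = mt_coeff l (- of_nat N + u) x * (Z * riemann_zeta (1 + u))"
      unfolding mt_summand_def e Z_def by (simp only: mult.assoc)
  qed (simp add: Z_def algebra_simps)
qed

text \<open>\<open>rGamma\<close> vanishes at \<open>- N\<close>, and under the two hypotheses all
  other factors are regular. The combination covers the generic Gamma term and, at large positive
  integers \<open>s\<close>, the derivative term.\<close>

lemma mt_gam_eqO_0:
  assumes "s - of_nat N - 1 \<notin> \<int>\<^sub>\<le>\<^sub>0" "r + s - of_nat N - 1 \<noteq> 1"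
  shows "eqO (\<lambda>u. c * mt_gam r s (- of_nat N + u) x + d * mt_gam' r s (- of_nat N + u) x) (\<lambda>_. 0)"
proof -
  let ?V = "{t. s + t - 1 \<notin> \<int>\<^sub>\<le>\<^sub>0 \<and> r + s + t - 1 \<noteq> 1}"
  have "(\<lambda>t. c * mt_gam r s t x + d * mt_gam' r s t x) holomorphic_on ?V"
    by (intro holomorphic_intros mt_gam_holomorphic_t) auto
  from analytic_at_shift[OF this open_pole_free, of "- of_nat N"]
  have "(\<lambda>u. c * mt_gam r s (- of_nat N + u) x + d * mt_gam' r s (- of_nat N + u) x) analytic_on {0}"
    using assms by simp
  from eqO_analytic[OF this] show ?thesis by (simp add: mt_gam_def mt_gam'_def rGamma_neg_nat)
qed

text \<open>The pole of \<open>Gamma (s + t - 1)\<close> meets the zero of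
  \<open>1 / Gamma t\<close>, and their quotient is the reciprocal of the product
  \<open>(t - M - 1) ... (t - 1)\<close>. Its finite value at \<open>- N\<close> is the origin of
  the extra term for nonpositive integers \<open>s\<close>.\<close>

lemma mt_gam_nonpos_eqO:
  assumes s: "s = - of_nat M" and n: "r + s - of_nat N - 1 \<noteq> 1"
  shows "eqO (\<lambda>u. Gamma (1 - s) * mt_gam r s (- of_nat N + u) x)
     (\<lambda>_. (-1) ^ Suc M * (fact N * fact M / fact (N + Suc M)) * of_real x powr (s - 1) * riemann_zeta (r + s - of_nat N - 1))"
proof -
  define P where "P = (\<lambda>t::complex. pochhammer (t - of_nat (Suc M)) (Suc M))"
  have P_prod: "P t = (\<Prod>i<Suc M. t - of_nat (Suc M) + of_nat i)" for t
    by (simp only: P_def pochhammer_prod lessThan_atLeast0)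
  \<comment> \<open>At \<open>- N\<close> the product is, up to sign, \<open>(M + 1)!\<close> times
    the binomial coefficient of \<open>N + M + 1\<close> over \<open>M + 1\<close>.\<close>
  have P0: "P (- of_nat N) = (-1) ^ Suc M * (fact (N + Suc M) / fact N)"
  proof -
    have "of_nat ((N + Suc M) choose Suc M) = (-1) ^ Suc M * pochhammer (- of_nat (N + Suc M)) (Suc M) / (fact (Suc M) :: complex)"
      by (simp only: binomial_gbinomial gbinomial_pochhammer)
    moreover have "of_nat ((N + Suc M) choose Suc M) = (fact (N + Suc M) / (fact (Suc M) * fact N) :: complex)"
      by (subst binomial_fact) auto
    moreover have "P (- of_nat N) = pochhammer (- of_nat (N + Suc M)) (Suc M)"
      by (simp only: P_def of_nat_add minus_add_distrib diff_conv_add_uminus)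
    ultimately have "(-1) ^ Suc M * P (- of_nat N) / (fact (Suc M) :: complex) = fact (N + Suc M) / (fact (Suc M) * fact N)" by simp
    moreover have "y = w / c" if "y / z = w / (z * c)" "z \<noteq> 0" "c \<noteq> 0" for y z w c :: complex
      using that by (simp add: field_simps)
    ultimately have "(-1) ^ Suc M * P (- of_nat N) = (fact (N + Suc M) / fact N :: complex)"
      using fact_nonzero by blast
    hence "(-1) ^ Suc M * ((-1) ^ Suc M * P (- of_nat N)) = (-1) ^ Suc M * (fact (N + Suc M) / fact N :: complex)" by simp
    thus ?thesis by (simp add: power_mult_distrib[symmetric] flip: mult.assoc del: power_Suc fact_Suc)
  qed
  let ?V = "{t. P t \<noteq> 0 \<and> r + s + t - 1 \<noteq> 1}"
  define f where "f = (\<lambda>t. fact M * (of_real x powr (s - 1) * (1 / P t) * riemann_zeta (r + s + t - 1)))"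
  have "f holomorphic_on ?V"
    unfolding f_def P_prod by (intro holomorphic_intros holomorphic_zeta_compose) (auto simp: P_prod)
  moreover have "open ?V"
    unfolding P_prod by (intro open_Collect_conj open_Collect_neq continuous_intros)
  moreover have "- of_nat N \<in> ?V" using n by (simp add: P0 del: fact_Suc)
  ultimately have "(\<lambda>u. f (- of_nat N + u)) analytic_on {0}" by (rule analytic_at_shift)
  from eqO_analytic[OF this] have "eqO (\<lambda>u. f (- of_nat N + u)) (\<lambda>_. f (- of_nat N))" by simp
  thus ?thesis
  proof (rule eqO_cong)
    have "\<forall>\<^sub>F u in at 0. (- of_nat N) + u \<notin> (\<int>\<^sub>\<le>\<^sub>0 :: complex set)" by (rule eventually_not_nonpos_Int)
    thus "\<forall>\<^sub>F u in at 0. Gamma (1 - s) * mt_gam r s (- of_nat N + u) x = f (- of_nat N + u)"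
    proof eventually_elim
      case (elim u)
      define t where "t = - of_nat N + u"
      have "Gamma (1 - s) = fact M" by (simp add: s flip: Gamma_fact)
      have rG: "rGamma (t - of_nat (Suc M)) = P t * rGamma t"
        using pochhammer_rGamma[of "t - of_nat (Suc M)" "Suc M"] by (simp add: P_def del: pochhammer_Suc of_nat_Suc)
      have st: "s + t - 1 = t - of_nat (Suc M)" by (simp add: s)
      have "rGamma t * Gamma (s + t - 1) = rGamma t * inverse (P t * rGamma t)"
        by (simp only: Gamma_def st rG)
      also have "\<dots> = 1 / P t"
        using elim by (simp add: rGamma_eq_zero_iff t_def inverse_eq_divide)
      finally have "rGamma t * Gamma (s + t - 1) = 1 / P t" .
      with \<open>Gamma (1 - s) = fact M\<close> show ?case
        unfolding t_def[symmetric] mt_gam_def f_def by (simp only:)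
    qed
    show "(-1) ^ Suc M * (fact N * fact M / fact (N + Suc M)) * of_real x powr (s - 1) * riemann_zeta (r + s - of_nat N - 1) = f (- of_nat N)" for u :: complex
    proof -
      have "1 / P (- of_nat N) = (-1) ^ Suc M * (fact N / fact (N + Suc M))"
        unfolding P0 by (cases "even M") (simp_all del: fact_Suc)
      show ?thesis unfolding f_def \<open>1 / P (- of_nat N) = _\<close> by (simp add: algebra_simps del: power_Suc fact_Suc)
    qed
  qed
qed

text \<open>At \<open>s = i + 1\<close> the Gamma quotient is a polynomial in \<open>t\<close>, so
  the poles that remain near \<open>- N\<close> come from Digamma, and from zeta if its argument
  tends to \<open>1\<close>.\<close>

lemma mt_pole_eventually:
  assumes i: "i \<le> N" and x: "x > 0"
  shows "\<forall>\<^sub>F u in at 0. mt_pole i r (- of_nat N + u) x =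
     mt_coeff i (- of_nat N + u) x * ((harm i - of_real (ln x) - Digamma (- of_nat (N - i) + u)) * riemann_zeta (r - of_nat N + of_nat i + u)
        - deriv riemann_zeta (r - of_nat N + of_nat i + u))"
  using eventually_not_nonpos_Int[of "- of_nat (N - i)"]
proof eventually_elim
  case (elim u)
  define t where "t = - of_nat N + u"
  have ti: "t + of_nat i = - of_nat (N - i) + u" using i by (simp add: t_def of_nat_diff)
  hence "t + of_nat i \<notin> \<int>\<^sub>\<le>\<^sub>0" using elim by simp
  hence G: "rGamma t * Gamma (t + of_nat i) = pochhammer t i" by (rule rGamma_mult_Gamma_shift)
  have st: "of_nat (Suc i) + t - 1 = t + of_nat i" and rst: "r + of_nat (Suc i) + t - 1 = r - of_nat N + of_nat i + u"
    by (simp_all add: t_def)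
  have xp: "of_real x powr (of_nat (Suc i) - 1) = (of_real x ^ i :: complex)"
    using x powr_nat'[of "of_real x :: complex" i] by simp
  have "(-1) ^ i / fact i * (of_real x ^ i * pochhammer t i) = mt_coeff i t x"
    by (simp add: mt_coeff_def power_minus[of "of_real x"])
  moreover have "mt_pole i r t x =
     ((-1) ^ i / fact i * (of_real x ^ i * pochhammer t i)) * ((harm i - of_real (ln x) - Digamma (t + of_nat i)) * riemann_zeta (r - of_nat N + of_nat i + u)
        - deriv riemann_zeta (r - of_nat N + of_nat i + u))"
    unfolding mt_gam_def mt_gam'_def st rst xp G by (simp add: algebra_simps)
  ultimately show ?case unfolding t_def[symmetric] ti by simp
qed

lemma zeta_expansion_regular:
  assumes "e \<noteq> 1"
  obtains Z2 Z3 where "Z2 analytic_on {0}" "Z3 analytic_on {0}"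
    "\<And>u. riemann_zeta (e + u) = riemann_zeta e + u * deriv riemann_zeta e + u ^ 2 * Z2 u"
    "\<And>u. deriv riemann_zeta (e + u) = deriv riemann_zeta e + u * Z3 u"
proof -
  have an: "(\<lambda>u. riemann_zeta (e + u)) analytic_on {0}"
    by (rule analytic_at_shift[OF holomorphic_riemann_zeta]) (use assms in auto)
  have dan: "(\<lambda>u. deriv riemann_zeta (e + u)) analytic_on {0}"
    by (rule analytic_at_shift[OF holomorphic_deriv[OF holomorphic_riemann_zeta]]) (use assms in auto)
  obtain h where h: "h analytic_on {0}" "h 0 = deriv (\<lambda>u. riemann_zeta (e + u)) 0" "\<And>u. riemann_zeta (e + u) = riemann_zeta (e + 0) + u * h u"
    using analytic_split[OF an] by blast
  obtain h2 where h2: "h2 analytic_on {0}" "\<And>u. h u = h 0 + u * h2 u"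
    using analytic_split[OF h(1)] by blast
  obtain h3 where h3: "h3 analytic_on {0}" "\<And>u. deriv riemann_zeta (e + u) = deriv riemann_zeta (e + 0) + u * h3 u"
    using analytic_split[OF dan] by blast
  have "((\<lambda>u. riemann_zeta (e + u)) has_field_derivative deriv riemann_zeta e * 1) (at 0)"
    by (rule DERIV_chain2[where g = "\<lambda>u. e + u"]) (use deriv_zeta[OF assms] in \<open>auto intro!: derivative_eq_intros\<close>)
  hence h0: "h 0 = deriv riemann_zeta e" unfolding h(2) using DERIV_imp_deriv by fastforce
  show ?thesis
  proof (rule that[of h2 h3])
    fix u show "riemann_zeta (e + u) = riemann_zeta e + u * deriv riemann_zeta e + u ^ 2 * h2 u"
      using h(3)[of u] h2(2)[of u] h0 by (simp add: algebra_simps power2_eq_square)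
    show "deriv riemann_zeta (e + u) = deriv riemann_zeta e + u * h3 u" using h3(2)[of u] by simp
  qed (use h2 h3 in auto)
qed

text \<open>The Digamma pole multiplies the linear term of zeta and produces the derivative
  \<open>D\<close>, which cancels against the explicit derivative term. Thus the answer has zeta
  values but no zeta derivative.\<close>

lemma mt_pole_eqO_simple:
  assumes i: "i \<le> N" and x: "x > 0" and e: "r - of_nat N + of_nat i \<noteq> 1"
  shows "eqO (\<lambda>u. mt_pole i r (- of_nat N + u) x)
     (\<lambda>u. of_nat (N choose i) * of_real x ^ i * riemann_zeta (r - of_nat N + of_nat i) *
        (1 / u + (euler_mascheroni + harm i - harm N - of_real (ln x))))"
proof -
  define E where "E = r - of_nat N + of_nat i"
  define Z D where "Z = riemann_zeta E" and "D = deriv riemann_zeta E"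
  define A where "A = harm i - complex_of_real (ln x) - (harm (N - i) - euler_mascheroni)"
  define p1 where "p1 = of_real (pi ^ 2 / 6) + inv_sq_sum (N - i)"
  obtain p where p: "p analytic_on {0}"
    "\<forall>\<^sub>F u in at 0. Digamma (- of_nat (N - i) + u) = - 1 / u + (harm (N - i) - euler_mascheroni) + p1 * u + u ^ 2 * p u"
    unfolding p1_def by (rule Digamma_pole_expansion)
  obtain Z2 Z3 where z: "Z2 analytic_on {0}" "Z3 analytic_on {0}"
    "\<And>u. riemann_zeta (E + u) = Z + u * D + u ^ 2 * Z2 u"
    "\<And>u. deriv riemann_zeta (E + u) = D + u * Z3 u"
    using zeta_expansion_regular[OF e[folded E_def]] unfolding Z_def D_def by metis
  define W where "W = (\<lambda>u. Z2 u + A * (D + u * Z2 u) - (p1 + u * p u) * (Z + u * D + u ^ 2 * Z2 u) - Z3 u)"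
  have "eqO (\<lambda>u. mt_coeff i (- of_nat N + u) x * ((harm i - of_real (ln x) - Digamma (- of_nat (N - i) + u)) * riemann_zeta (E + u) - deriv riemann_zeta (E + u)))
     (\<lambda>u. of_nat (N choose i) * of_real x ^ i * (0 / u ^ 2 + (Z - (harm N - harm (N - i)) * 0) / u + (A * Z - (harm N - harm (N - i)) * Z +
        ((harm N - harm (N - i))\<^sup>2 - (inv_sq_sum N - inv_sq_sum (N - i))) / 2 * 0)))"
  proof (rule mt_coeff_mult_eqO[OF i])
    show "W analytic_on {0}" unfolding W_def by (intro analytic_intros z p)
    show "\<forall>\<^sub>F u in at 0. (harm i - of_real (ln x) - Digamma (- of_nat (N - i) + u)) * riemann_zeta (E + u) - deriv riemann_zeta (E + u) =
        0 / u ^ 2 + Z / u + A * Z + u * W u"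
      using p(2) eventually_neq_at_within[of 0 0 UNIV]
    proof eventually_elim
      case (elim u)
      have "(B - (- 1 / u + P + p1 * u + u ^ 2 * p u)) * (Z + u * D + u ^ 2 * Z2 u) - (D + u * Z3 u) =
         0 / u ^ 2 + Z / u + (B - P) * Z + u * (Z2 u + (B - P) * (D + u * Z2 u) - (p1 + u * p u) * (Z + u * D + u ^ 2 * Z2 u) - Z3 u)" for B P
        using elim(2) by (simp add: field_simps power2_eq_square)
      thus ?case unfolding elim(1) z(3,4) W_def A_def by (simp only:)
    qed
  qed
  thus ?thesis
  proof (rule eqO_cong)
    show "\<forall>\<^sub>F u in at 0. mt_pole i r (- of_nat N + u) x =
       mt_coeff i (- of_nat N + u) x * ((harm i - of_real (ln x) - Digamma (- of_nat (N - i) + u)) * riemann_zeta (E + u) - deriv riemann_zeta (E + u))"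
      unfolding E_def by (rule mt_pole_eventually[OF i x])
    show "of_nat (N choose i) * of_real x ^ i * riemann_zeta (r - of_nat N + of_nat i) * (1 / u + (euler_mascheroni + harm i - harm N - of_real (ln x))) =
      of_nat (N choose i) * of_real x ^ i * (0 / u ^ 2 + (Z - (harm N - harm (N - i)) * 0) / u + (A * Z - (harm N - harm (N - i)) * Z +
        ((harm N - harm (N - i))\<^sup>2 - (inv_sq_sum N - inv_sq_sum (N - i))) / 2 * 0))" for u
      unfolding Z_def[symmetric] E_def[symmetric] A_def by (simp add: algebra_simps)
  qed
qed

text \<open>The Digamma pole times the zeta pole gives one \<open>1 / u^2\<close>, the derivative of
  zeta a second one; hence the factor \<open>2\<close> at the double pole.\<close>

lemma mt_pole_eqO_double:
  assumes i: "i \<le> N" and x: "x > 0" and e: "r - of_nat N + of_nat i = 1"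
  shows "eqO (\<lambda>u. mt_pole i r (- of_nat N + u) x)
     (\<lambda>u. of_nat (N choose i) * of_real x ^ i *
        (2 / u ^ 2 + (2 * euler_mascheroni + harm i + harm (N - i) - 2 * harm N - of_real (ln x)) / u +
         1 / 3 * (- (of_real pi ^ 2) + 3 * (euler_mascheroni + harm i - harm N - of_real (ln x)) * (euler_mascheroni + harm (N - i) - harm N)
           + 3 * deriv Digamma (of_nat (Suc N)))))"
proof -
  define P where "P = (harm (N - i) - euler_mascheroni :: complex)"
  define B where "B = harm i - complex_of_real (ln x)"
  define p1 where "p1 = of_real (pi ^ 2 / 6) + inv_sq_sum (N - i)"
  define g where "g = (euler_mascheroni :: complex)"
  obtain p where p: "p analytic_on {0}"
    "\<forall>\<^sub>F u in at 0. Digamma (- of_nat (N - i) + u) = - 1 / u + P + p1 * u + u ^ 2 * p u"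
    unfolding p1_def P_def by (rule Digamma_pole_expansion)
  obtain z1 z2 z3 where z: "z2 analytic_on {0}" "z3 analytic_on {0}"
    "\<And>u. u \<noteq> 0 \<Longrightarrow> riemann_zeta (1 + u) = 1 / u + g + z1 * u + u ^ 2 * z2 u"
    "\<And>u. u \<noteq> 0 \<Longrightarrow> deriv riemann_zeta (1 + u) = - 1 / u ^ 2 + z1 + u * z3 u"
    unfolding g_def using zeta_reg_expansion by metis
  define a where "a = (harm N - harm (N - i) :: complex)"
  define b where "b = (a\<^sup>2 - (inv_sq_sum N - inv_sq_sum (N - i))) / 2"
  define W where "W = (\<lambda>u. (B - P) * (z1 + u * z2 u) - p u - (p1 + u * p u) * (g + z1 * u + u ^ 2 * z2 u) + z2 u - z3 u)"
  have main: "eqO (\<lambda>u. mt_coeff i (- of_nat N + u) x * ((B - Digamma (- of_nat (N - i) + u)) * riemann_zeta (1 + u) - deriv riemann_zeta (1 + u)))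
     (\<lambda>u. of_nat (N choose i) * of_real x ^ i * (2 / u ^ 2 + ((g + B - P) - a * 2) / u + ((B - P) * g - p1 - a * (g + B - P) + b * 2)))"
    unfolding b_def a_def
  proof (rule mt_coeff_mult_eqO[OF i])
    show "W analytic_on {0}" unfolding W_def by (intro analytic_intros z p)
    show "\<forall>\<^sub>F u in at 0. (B - Digamma (- of_nat (N - i) + u)) * riemann_zeta (1 + u) - deriv riemann_zeta (1 + u) =
        2 / u ^ 2 + (g + B - P) / u + ((B - P) * g - p1) + u * W u"
      using p(2) eventually_neq_at_within[of 0 0 UNIV]
    proof eventually_elim
      case (elim u)
      have "(B - (- 1 / u + P + p1 * u + u ^ 2 * q)) * (1 / u + g + z1 * u + u ^ 2 * y2) - (- 1 / u ^ 2 + z1 + u * y3) =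
         2 / u ^ 2 + (g + B - P) / u + ((B - P) * g - p1) + u * ((B - P) * (z1 + u * y2) - q - (p1 + u * q) * (g + z1 * u + u ^ 2 * y2) + y2 - y3)" for q y2 y3
        using elim(2) by (simp add: field_simps power2_eq_square)
      thus ?case unfolding elim(1) z(3)[OF elim(2)] z(4)[OF elim(2)] W_def by (simp only:)
    qed
  qed
  show ?thesis
  proof (rule eqO_cong[OF main])
    show "\<forall>\<^sub>F u in at 0. mt_pole i r (- of_nat N + u) x =
       mt_coeff i (- of_nat N + u) x * ((B - Digamma (- of_nat (N - i) + u)) * riemann_zeta (1 + u) - deriv riemann_zeta (1 + u))"
      using mt_pole_eventually[OF i x, of r] unfolding e B_def .
    have "deriv Digamma (of_nat (Suc N) :: complex) = Polygamma (Suc 0) (of_nat (Suc N))"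
      by (rule deriv_Polygamma) (rule Re_pos_not_nonpos_Int, simp)
    hence dD: "deriv Digamma (of_nat (Suc N) :: complex) = of_real (pi ^ 2 / 6) - inv_sq_sum N"
      using Polygamma_1_of_nat[of N] by (simp only: One_nat_def)
    define S T where "S = inv_sq_sum N" and "T = inv_sq_sum (N - i)"
    define H H' where "H = (harm N :: complex)" and "H' = (harm (N - i) :: complex)"
    define Q where "Q = complex_of_real pi ^ 2"
    have p1': "p1 = Q / 6 + T" and dD': "deriv Digamma (of_nat (Suc N) :: complex) = Q / 6 - S"
      by (simp_all add: p1_def dD Q_def S_def T_def del: of_nat_Suc)
    have c1: "(g + B - P) - a * 2 = 2 * g + B + H' - 2 * H"
      by (simp add: P_def a_def g_def H_def H'_def)
    \<comment> \<open>The inverse squares up to \<open>N - i\<close> cancel between the Digamma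
      coefficient and the quadratic coefficient of \<open>mt_coeff\<close>. What is left,
      \<open>- Q / 6 - S\<close>, is rewritten with the trigamma value
      \<open>Q / 6 - S\<close>.\<close>
    have c0: "(B - P) * g - p1 - a * (g + B - P) + b * 2 = 1 / 3 * (- Q + 3 * (g + B - H) * (g + H' - H) + 3 * (Q / 6 - S))"
      unfolding p1' b_def a_def P_def g_def[symmetric] H_def[symmetric] H'_def[symmetric] S_def[symmetric] T_def[symmetric]
      by (simp add: field_simps power2_eq_square)
    show "of_nat (N choose i) * of_real x ^ i *
        (2 / u ^ 2 + (2 * euler_mascheroni + harm i + harm (N - i) - 2 * harm N - of_real (ln x)) / u +
         1 / 3 * (- (of_real pi ^ 2) + 3 * (euler_mascheroni + harm i - harm N - of_real (ln x)) * (euler_mascheroni + harm (N - i) - harm N)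
           + 3 * deriv Digamma (of_nat (Suc N)))) =
      of_nat (N choose i) * of_real x ^ i * (2 / u ^ 2 + ((g + B - P) - a * 2) / u + ((B - P) * g - p1 - a * (g + B - P) + b * 2))" for u
      unfolding c0 c1 dD' unfolding g_def B_def H_def H'_def Q_def by (simp add: algebra_simps del: of_nat_Suc)
  qed
qed

section \<open>The four cases\<close>

abbreviation mt_tail :: "nat \<Rightarrow> nat \<Rightarrow> nat \<Rightarrow> complex \<Rightarrow> real \<Rightarrow> nat set \<Rightarrow> complex" where
  "mt_tail N r l s x A \<equiv> \<Sum>k\<in>A. of_nat (N choose k) * of_real x ^ (N - k)
     * riemann_zeta (of_nat r - of_nat k) * riemann_zeta (1 + of_nat k - of_nat l - of_nat r + s)"

text \<open>The substitution \<open>k = N - j\<close> passes to the indexing of the theorem; the set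
  \<open>D\<close> of omitted indices is carried along by the same map.\<close>

lemma mt_sum_at_neg_nat:
  fixes r l N K :: nat
  assumes r: "r \<ge> 1" and N: "N = r + l - 1" and K: "K > N"
  shows "(\<Sum>j\<in>{..<K} - D. mt_summand j (of_nat r) s (- of_nat N) x) =
     (\<Sum>k\<in>{0..N} - (\<lambda>j. N - j) ` (D \<inter> {..N}). of_nat (N choose k) * of_real x ^ (N - k)
              * riemann_zeta (of_nat r - of_nat k) * riemann_zeta (1 + of_nat k - of_nat l - of_nat r + s))"
proof -
  have "(\<Sum>j\<in>{..<K} - D. mt_summand j (of_nat r) s (- of_nat N) x) = (\<Sum>j\<in>{..N} - D. mt_summand j (of_nat r) s (- of_nat N) x)"
    by (rule sum.mono_neutral_right) (use K in \<open>auto simp: mt_summand_at_neg_nat\<close>)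
  also have "\<dots> = (\<Sum>k\<in>{0..N} - (\<lambda>j. N - j) ` (D \<inter> {..N}). of_nat (N choose k) * of_real x ^ (N - k)
              * riemann_zeta (of_nat r - of_nat k) * riemann_zeta (1 + of_nat k - of_nat l - of_nat r + s))"
  proof (rule sum.reindex_bij_witness[of _ "\<lambda>k. N - k" "\<lambda>k. N - k"])
    fix j assume j: "j \<in> {..N} - D"
    hence jN: "j \<le> N" by simp
    have NN: "of_nat N = of_nat r + of_nat l - (1 :: complex)" using r by (simp add: N of_nat_diff)
    have c: "of_nat (N - j) = of_nat N - (of_nat j :: complex)" using jN by (rule of_nat_diff)
    have z: "of_nat r - of_nat (N - j) = of_nat r - of_nat N + (of_nat j :: complex)"
        "1 + of_nat (N - j) - of_nat l - of_nat r + s = s - of_nat j"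
      unfolding c NN by simp_all
    show "of_nat (N choose (N - j)) * of_real x ^ (N - (N - j))
              * riemann_zeta (of_nat r - of_nat (N - j)) * riemann_zeta (1 + of_nat (N - j) - of_nat l - of_nat r + s) =
          mt_summand j (of_nat r) s (- of_nat N) x"
      unfolding z mt_summand_at_neg_nat binomial_symmetric[OF jN, symmetric] using jN by simp
    show "N - j \<in> {0..N} - (\<lambda>j. N - j) ` (D \<inter> {..N})"
    proof -
      have "N - j \<noteq> N - i" if "i \<in> D \<inter> {..N}" for i
      proof
        assume "N - j = N - i"
        moreover have "i \<le> N" using that by simp
        ultimately have "j = i" using jN by linarith
        thus False using that j by blast
      qed
      thus ?thesis by auto
    qed
  next
    fix k assume k: "k \<in> {0..N} - (\<lambda>j. N - j) ` (D \<inter> {..N})"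
    have "N - k \<notin> D"
    proof
      assume "N - k \<in> D"
      hence "N - (N - k) \<in> (\<lambda>j. N - j) ` (D \<inter> {..N})"
        by (intro imageI) simp
      moreover have "N - (N - k) = k" using k by auto
      ultimately show False using k by simp
    qed
    thus "N - k \<in> {..N} - D" by simp
  qed auto
  finally show ?thesis .
qed

text \<open>Common frame of all cases. \<open>D\<close> holds the omitted indices, always including
  \<open>l\<close>, where a summand has its pole; \<open>P\<close> collects the terms expanded
  separately. All other summands are regular at \<open>- N\<close> and contribute their values, and
  the remainder contributes nothing.\<close>

lemma Theta_eqO:
  fixes r l N :: nat
  assumes r: "r \<ge> 1" and N: "N = r + l - 1" and x: "x > 0" and l: "l \<in> D"
    and K: "K > N" "(of_nat r, s, - of_nat N) \<in> mt_dom K"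
    and P: "\<And>u. mt_sum K (of_nat r) s (- of_nat N + u) x =
              P u + (\<Sum>j\<in>{..<K} - D. mt_summand j (of_nat r) s (- of_nat N + u) x)"
    and Q: "eqO P Q"
  shows "eqO (\<lambda>u. Theta (of_nat r) s (- of_nat N + u) x)
     (\<lambda>u. Q u + (\<Sum>k\<in>{0..N} - (\<lambda>j. N - j) ` (D \<inter> {..N}). of_nat (N choose k) * of_real x ^ (N - k)
              * riemann_zeta (of_nat r - of_nat k) * riemann_zeta (1 + of_nat k - of_nat l - of_nat r + s)))"
proof -
  have S: "eqO (\<lambda>u. \<Sum>j\<in>{..<K} - D. mt_summand j (of_nat r) s (- of_nat N + u) x)
        (\<lambda>u. \<Sum>j\<in>{..<K} - D. mt_summand j (of_nat r) s (- of_nat N) x)"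
  proof (rule eqO_sum)
    fix j assume "j \<in> {..<K} - D"
    hence "j \<noteq> l" using l by auto
    show "eqO (\<lambda>u. mt_summand j (of_nat r) s (- of_nat N + u) x) (\<lambda>_. mt_summand j (of_nat r) s (- of_nat N) x)"
    proof (rule mt_summand_eqO)
      have "of_nat N = of_nat r + of_nat l - (1 :: complex)" using r by (simp add: N of_nat_diff)
      hence "of_nat r + - of_nat N + of_nat j = 1 + (of_nat j - of_nat l :: complex)" by simp
      thus "of_nat r + - of_nat N + of_nat j \<noteq> (1 :: complex)" using \<open>j \<noteq> l\<close> by simp
    qed
  qed
  from eqO_add[OF eqO_add[OF Q S] mt_rem_eqO[OF K(2) x]]
  show ?thesis
  proof (rule eqO_cong)
    show "\<forall>\<^sub>F u in at 0. Theta (of_nat r) s (- of_nat N + u) x =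
       P u + (\<Sum>j\<in>{..<K} - D. mt_summand j (of_nat r) s (- of_nat N + u) x) + rGamma (- of_nat N + u) * mt_rem K (of_nat r) s (- of_nat N + u) x"
      using Theta_eventually_eq_mt_fun[OF K(2) x]
    proof eventually_elim
      case (elim u)
      show ?case unfolding elim mt_fun_def P by simp
    qed
  qed (simp add: mt_sum_at_neg_nat[OF r N K(1)])
qed

theorem theorem2p5:
  fixes x :: real and r l :: nat and t0 :: complex
  assumes "x > 0" and "r \<ge> 1" and "int l \<ge> 1 - int r"
    and "t0 = 1 - of_nat r - of_nat l"
  shows
    "(\<forall>s::complex. (\<exists>a::int. s = of_int a \<and> a > int r + int l) \<or> s \<notin> \<int> \<longrightarrow>
       (\<lambda>t. Theta (of_nat r) s t x -
          (of_nat ((r + l - 1) choose l) * of_real x ^ l * riemann_zeta (s - of_nat l) / (t - t0)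
         + of_nat ((r + l - 1) choose l) * of_real x ^ l * riemann_zeta (s - of_nat l)
             * (euler_mascheroni + harm (r - 1) - harm (r + l - 1))
         + (\<Sum>k\<in>{0..r + l - 1} - {r - 1}.
              of_nat ((r + l - 1) choose k) * of_real x ^ (r + l - 1 - k)
              * riemann_zeta (of_nat r - of_nat k)
              * riemann_zeta (1 + of_nat k - of_nat l - of_nat r + s))))
       \<in> O[at t0](\<lambda>t. t - t0))
   \<and>
     (\<forall>s::int. s \<notin> {1..} \<and> s \<le> int r + int l \<longrightarrow>
       (\<lambda>t. Theta (of_nat r) (of_int s) t x -
          (of_nat ((r + l - 1) choose l) * of_real x ^ l * riemann_zeta (of_int s - of_nat l) / (t - t0)
         + of_nat ((r + l - 1) choose l) * of_real x ^ l * riemann_zeta (of_int s - of_nat l)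
             * (euler_mascheroni + harm (r - 1) - harm (r + l - 1))
         + (\<Sum>k\<in>{0..r + l - 1} - {r - 1}.
              of_nat ((r + l - 1) choose k) * of_real x ^ (r + l - 1 - k)
              * riemann_zeta (of_nat r - of_nat k)
              * riemann_zeta (1 + of_nat k - of_nat l - of_nat r + of_int s))
         + (-1) powi (s - 1)
             * (fact (r + l - 1) * fact (nat (- s)) / fact (nat (int r + int l - s)))
             * of_real x powi (s - 1) * riemann_zeta (of_int s - of_nat l)))
       \<in> O[at t0](\<lambda>t. t - t0))
   \<and>
     (\<forall>s::nat. s \<ge> 1 \<and> s \<le> r + l \<and> s \<noteq> l + 1 \<longrightarrow>
       (\<lambda>t. Theta (of_nat r) (of_nat s) t x -
          (of_nat ((r + l - 1) choose l) * of_real x ^ l * riemann_zeta (of_nat s - of_nat l) / (t - t0)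
         + of_nat ((r + l - 1) choose l) * of_real x ^ l * riemann_zeta (of_nat s - of_nat l)
             * (euler_mascheroni + harm (r - 1) - harm (r + l - 1))
         + of_nat ((r + l - 1) choose (s - 1)) * of_real x ^ (s - 1)
             * riemann_zeta (of_nat s - of_nat l) / (t - t0)
         + of_nat ((r + l - 1) choose (s - 1)) * of_real x ^ (s - 1)
             * riemann_zeta (of_nat s - of_nat l)
             * (euler_mascheroni + harm (s - 1) - harm (r + l - 1) - of_real (ln x))
         + (\<Sum>k\<in>{0..r + l - 1} - {r - 1, r + l - s}.
              of_nat ((r + l - 1) choose k) * of_real x ^ (r + l - 1 - k)
              * riemann_zeta (of_nat r - of_nat k)
              * riemann_zeta (1 + of_nat k - of_nat l - of_nat r + of_nat s))))
       \<in> O[at t0](\<lambda>t. t - t0))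
   \<and>
     (\<lambda>t. Theta (of_nat r) (of_nat l + 1) t x -
        (of_nat ((r + l - 1) choose l) * (2 * of_real x ^ l / (t - t0) ^ 2)
       + of_nat ((r + l - 1) choose l)
           * (of_real x ^ l
              * (2 * euler_mascheroni + harm l + harm (r - 1) - 2 * harm (r + l - 1) - of_real (ln x))
              / (t - t0))
       + 1 / 3 * of_nat ((r + l - 1) choose l) * of_real x ^ l
           * (- (of_real pi ^ 2)
              + 3 * (euler_mascheroni + harm l - harm (r + l - 1) - of_real (ln x))
                  * (euler_mascheroni + harm (r - 1) - harm (r + l - 1))
              + 3 * deriv Digamma (of_nat (r + l)))
       + (\<Sum>k\<in>{0..r + l - 1} - {r - 1}.
            of_nat ((r + l - 1) choose k) * of_real x ^ (r + l - 1 - k)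
            * riemann_zeta (of_nat r - of_nat k)
            * riemann_zeta (of_nat k - of_nat r + 2))))
     \<in> O[at t0](\<lambda>t. t - t0)"
proof (intro conjI allI impI, goal_cases)
  \<comment> \<open>The point of expansion is \<open>t0 = - N\<close>, and
    \<open>r - N + l = 1\<close> puts the pole of the second zeta factor at the index
    \<open>l\<close>.\<close>
  define N where "N = r + l - 1"
  have r: "r \<ge> 1" and x: "x > 0" and lN: "l \<le> N" and Nl: "N - l = r - 1" and rl: "r + l = Suc N"
    using assms by (auto simp: N_def)
  have NN: "of_nat N = of_nat r + of_nat l - (1 :: complex)" using r by (simp add: N_def of_nat_diff)
  have t0: "t0 = - of_nat N" using assms(4) NN by simp
  have rC: "of_nat (r - 1) + 1 = (of_nat r :: complex)" using r by (simp add: of_nat_diff)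
  have arg: "of_nat r + s - of_nat N - 1 = s - of_nat l" for s :: complex by (simp add: NN)
  have img: "(\<lambda>j. N - j) ` ({l} \<inter> {..N}) = {r - 1}" using lN Nl by auto
  have pole_l: "eqO (\<lambda>u. mt_summand l (of_nat r) s (- of_nat N + u) x)
     (\<lambda>u. of_nat (N choose l) * of_real x ^ l * riemann_zeta (s - of_nat l) * (1 / u + (euler_mascheroni - (harm N - harm (r - 1)))))" for s
    using mt_summand_pole_eqO[OF lN, of s x] unfolding Nl rC .
  \<comment> \<open>For \<open>s\<close> outside the positive integers the Gamma term enters through
    its value \<open>V\<close> alone: \<open>0\<close> at nonintegers, the extra term at nonpositive
    integers.\<close>
  have generic: "eqO (\<lambda>u. Theta (of_nat r) s (- of_nat N + u) x)
     (\<lambda>u. (V + of_nat (N choose l) * of_real x ^ l * riemann_zeta (s - of_nat l) * (1 / u + (euler_mascheroni - (harm N - harm (r - 1))))) +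
        mt_tail N r l s x ({0..N} - {r - 1}))"
    if s: "s \<notin> of_nat ` {1..}" and V: "eqO (\<lambda>u. Gamma (1 - s) * mt_gam (of_nat r) s (- of_nat N + u) x) (\<lambda>_. V)" for s V
  proof -
    obtain K where K: "(of_nat r, s, - of_nat N) \<in> mt_dom K" "K \<ge> Suc N" using mt_dom_exists by blast
    show ?thesis
      unfolding img[symmetric]
    proof (rule Theta_eqO[OF r N_def x _ _ K(1) _ eqO_add[OF V pole_l]])
      fix u
      have "(\<Sum>j<K. mt_summand j (of_nat r) s (- of_nat N + u) x) = mt_summand l (of_nat r) s (- of_nat N + u) x +
          (\<Sum>j\<in>{..<K} - {l}. mt_summand j (of_nat r) s (- of_nat N + u) x)"
        using K(2) lN by (intro sum.remove) auto
      thus "mt_sum K (of_nat r) s (- of_nat N + u) x = Gamma (1 - s) * mt_gam (of_nat r) s (- of_nat N + u) x + mt_summand l (of_nat r) s (- of_nat N + u) x +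
          (\<Sum>j\<in>{..<K} - {l}. mt_summand j (of_nat r) s (- of_nat N + u) x)"
        using s by (simp add: mt_sum_def)
    qed (use K in auto)
  qed
  \<comment> \<open>At \<open>s = i + 1\<close> with \<open>i \<noteq> l\<close> two indices are set
    apart: \<open>i\<close>, whose summand is absorbed by the pole term, and \<open>l\<close>, whose
    zeta factor has a pole in \<open>t\<close>.\<close>
  have integral: "eqO (\<lambda>u. Theta (of_nat r) (of_nat (Suc i)) (- of_nat N + u) x)
     (\<lambda>u. (Q u + of_nat (N choose l) * of_real x ^ l * riemann_zeta (of_nat (Suc i) - of_nat l) * (1 / u + (euler_mascheroni - (harm N - harm (r - 1))))) +
        (\<Sum>k\<in>{0..N} - (\<lambda>j. N - j) ` ({l, i} \<inter> {..N}). of_nat (N choose k) * of_real x ^ (N - k)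
              * riemann_zeta (of_nat r - of_nat k) * riemann_zeta (1 + of_nat k - of_nat l - of_nat r + of_nat (Suc i))))"
    if i: "i \<noteq> l" and Q: "eqO (\<lambda>u. mt_pole i (of_nat r) (- of_nat N + u) x) Q" for i Q
  proof -
    obtain K where K: "(of_nat r, of_nat (Suc i), - of_nat N) \<in> mt_dom K" "K \<ge> Suc N" using mt_dom_exists by blast
    show ?thesis
    proof (rule Theta_eqO[OF r N_def x _ _ K(1) _ eqO_add[OF Q pole_l]])
      fix u
      have "(\<Sum>j\<in>{..<K} - {i}. mt_summand j (of_nat r) (of_nat (Suc i)) (- of_nat N + u) x) = mt_summand l (of_nat r) (of_nat (Suc i)) (- of_nat N + u) x +
          (\<Sum>j\<in>{..<K} - {i} - {l}. mt_summand j (of_nat r) (of_nat (Suc i)) (- of_nat N + u) x)"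
        using K(2) lN i by (intro sum.remove) auto
      moreover have "{..<K} - {i} - {l} = {..<K} - {l, i}" by auto
      ultimately show "mt_sum K (of_nat r) (of_nat (Suc i)) (- of_nat N + u) x =
          mt_pole i (of_nat r) (- of_nat N + u) x + mt_summand l (of_nat r) (of_nat (Suc i)) (- of_nat N + u) x +
          (\<Sum>j\<in>{..<K} - {l, i}. mt_summand j (of_nat r) (of_nat (Suc i)) (- of_nat N + u) x)"
        unfolding mt_sum_of_nat by simp
    qed (use K in auto)
  qed
  {
    case s: (1 s)
    have "eqO (\<lambda>u. Theta (of_nat r) s (- of_nat N + u) x)
     (\<lambda>u. (0 + of_nat (N choose l) * of_real x ^ l * riemann_zeta (s - of_nat l) * (1 / u + (euler_mascheroni - (harm N - harm (r - 1))))) +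
        mt_tail N r l s x ({0..N} - {r - 1}))"
    proof (cases "s \<in> \<int>")
      case False
      have notint: "s - of_nat n \<noteq> of_int m" for n m
      proof
        assume "s - of_nat n = of_int m"
        hence "s = of_int (m + int n)" by (simp add: algebra_simps)
        thus False using False by simp
      qed
      have "s - of_nat N - 1 \<notin> \<int>\<^sub>\<le>\<^sub>0"
        using notint[of "Suc N"] by (auto elim!: nonpos_Ints_cases simp: algebra_simps)
      moreover have "of_nat r + s - of_nat N - 1 \<noteq> 1" unfolding arg using notint[of l 1] by simp
      ultimately have "eqO (\<lambda>u. Gamma (1 - s) * mt_gam (of_nat r) s (- of_nat N + u) x) (\<lambda>_. 0)"
        using mt_gam_eqO_0[of s N "of_nat r" "Gamma (1 - s)" x 0] by simp
      moreover have "s \<notin> of_nat ` {1..}" using False by auto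
      ultimately show ?thesis by (intro generic)
    next
      case True
      then obtain a where a: "s = of_int a" "a > int r + int l" using s by blast
      define i where "i = nat a - 1"
      have i: "s = of_nat (Suc i)" "i > N" using a rl by (auto simp: i_def)
      have "of_nat (Suc i) - of_nat N - 1 \<notin> (\<int>\<^sub>\<le>\<^sub>0 :: complex set)"
        by (rule Re_pos_not_nonpos_Int) (use i(2) in simp)
      moreover have "of_nat r + of_nat (Suc i) - of_nat N - 1 \<noteq> (1 :: complex)"
        unfolding arg using i(2) lN by simp
      ultimately have "eqO (\<lambda>u. mt_pole i (of_nat r) (- of_nat N + u) x) (\<lambda>_. 0)"
        using mt_gam_eqO_0[of "of_nat (Suc i)" N "of_nat r" "(-1) ^ i / fact i * harm i" x "- ((-1) ^ i / fact i)"]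
        by (simp add: algebra_simps del: of_nat_Suc)
      from integral[OF _ this] have "eqO (\<lambda>u. Theta (of_nat r) s (- of_nat N + u) x)
        (\<lambda>u. (0 + of_nat (N choose l) * of_real x ^ l * riemann_zeta (s - of_nat l) * (1 / u + (euler_mascheroni - (harm N - harm (r - 1))))) +
        (\<Sum>k\<in>{0..N} - (\<lambda>j. N - j) ` ({l, i} \<inter> {..N}). of_nat (N choose k) * of_real x ^ (N - k)
              * riemann_zeta (of_nat r - of_nat k) * riemann_zeta (1 + of_nat k - of_nat l - of_nat r + s)))"
        using i lN by simp
      \<comment> \<open>Here \<open>i > N\<close>, where the binomial coefficient is
        \<open>0\<close>; omitting this index does not change the finite sum.\<close>
      moreover have "{l, i} \<inter> {..N} = {l} \<inter> {..N}" using i by auto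
      ultimately show ?thesis by (simp only: img)
    qed
    thus ?case
      unfolding N_def[symmetric] t0
      by (intro eqO_imp_bigo) (elim eqO_cong; simp add: algebra_simps)
  }
  {
    case prems: (2 s)
    define M where "M = nat (- s)"
    have s: "s = - int M" "complex_of_int s = - of_nat M"
      using prems by (auto simp: M_def)
    have "- of_nat M - of_nat l \<noteq> (1 :: complex)"
    proof
      assume "- of_nat M - of_nat l = (1 :: complex)"
      hence "Re (- of_nat M - of_nat l) = Re 1" by (simp only:)
      thus False by simp
    qed
    hence "eqO (\<lambda>u. Gamma (1 - of_int s) * mt_gam (of_nat r) (of_int s) (- of_nat N + u) x)
       (\<lambda>_. (-1) ^ Suc M * (fact N * fact M / fact (N + Suc M)) * of_real x powr (of_int s - 1) * riemann_zeta (of_int s - of_nat l))"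
      using mt_gam_nonpos_eqO[OF s(2), of "of_nat r" N x] unfolding arg s(2) by blast
    moreover have "complex_of_int s \<notin> of_nat ` {1..}"
    proof
      assume "complex_of_int s \<in> of_nat ` {1..}"
      then obtain n where "complex_of_int s = of_nat n" "n \<ge> 1" by auto
      hence "s = int n" by (metis of_int_eq_iff of_int_of_nat_eq)
      thus False using s(1) \<open>n \<ge> 1\<close> by simp
    qed
    ultimately have G: "eqO (\<lambda>u. Theta (of_nat r) (of_int s) (- of_nat N + u) x)
     (\<lambda>u. ((-1) ^ Suc M * (fact N * fact M / fact (N + Suc M)) * of_real x powr (of_int s - 1) * riemann_zeta (of_int s - of_nat l) +
         of_nat (N choose l) * of_real x ^ l * riemann_zeta (of_int s - of_nat l) * (1 / u + (euler_mascheroni - (harm N - harm (r - 1))))) +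
        mt_tail N r l (of_int s) x ({0..N} - {r - 1}))"
      by (intro generic)
    have sgn: "(-1) powi (s - 1) = ((-1) ^ Suc M :: complex)"
    proof -
      have "s - 1 = - int (Suc M)" using s(1) by simp
      thus ?thesis by (simp only: power_int_minus power_int_of_nat) (simp add: power_inverse[symmetric])
    qed
    have xp: "of_real x powi (s - 1) = (of_real x powr (of_int s - 1) :: complex)"
      using complex_powr_of_int[of "of_real x" "s - 1"] x by simp
    have fc: "nat (int r + int l - s) = N + Suc M" "nat (- s) = M" using s(1) rl by auto
    show ?case
      unfolding sgn xp fc N_def[symmetric] t0
      by (rule eqO_imp_bigo, rule eqO_cong[OF G]) (simp_all add: algebra_simps del: power_Suc fact_Suc)
  }
  {
    case (3 s)
    then obtain i where i: "s = Suc i" "i \<le> N" "i \<noteq> l" using rl by (cases s) auto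
    have e: "of_nat r - of_nat N + of_nat i = (of_nat s - of_nat l :: complex)" by (simp add: NN i)
    have "of_nat s - of_nat l \<noteq> (1 :: complex)" using i by (simp add: algebra_simps)
    hence "eqO (\<lambda>u. mt_pole i (of_nat r) (- of_nat N + u) x)
      (\<lambda>u. of_nat (N choose i) * of_real x ^ i * riemann_zeta (of_nat s - of_nat l) * (1 / u + (euler_mascheroni + harm i - harm N - of_real (ln x))))"
      using mt_pole_eqO_simple[OF i(2) x, of "of_nat r"] unfolding e by blast
    note G = integral[OF i(3) this]
    \<comment> \<open>In the reversed indexing, \<open>l\<close> becomes \<open>r - 1\<close> and
      \<open>i = s - 1\<close> becomes \<open>r + l - s\<close>.\<close>
    have "(\<lambda>j. N - j) ` ({l, i} \<inter> {..N}) = {r - 1, r + l - s}"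
      using i lN Nl rl by auto
    note G = G[unfolded this i(1)[symmetric]]
    have si: "s - 1 = i" by (simp add: i)
    show ?case
      unfolding N_def[symmetric] t0 si
      by (rule eqO_imp_bigo, rule eqO_cong[OF G]) (simp_all add: algebra_simps)
  }
  {
    case 4
  \<comment> \<open>At \<open>s = l + 1\<close> the two special indices coincide, so only one index
    is omitted and the pole term acquires its double pole.\<close>
  have e: "of_nat r - of_nat N + of_nat l = (1 :: complex)" by (simp add: NN)
  obtain K where K: "(of_nat r, of_nat (Suc l), - of_nat N) \<in> mt_dom K" "K \<ge> Suc N" using mt_dom_exists by blast
  have G: "eqO (\<lambda>u. Theta (of_nat r) (of_nat (Suc l)) (- of_nat N + u) x)
     (\<lambda>u. of_nat (N choose l) * of_real x ^ l *
        (2 / u ^ 2 + (2 * euler_mascheroni + harm l + harm (N - l) - 2 * harm N - of_real (ln x)) / u +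
         1 / 3 * (- (of_real pi ^ 2) + 3 * (euler_mascheroni + harm l - harm N - of_real (ln x)) * (euler_mascheroni + harm (N - l) - harm N)
           + 3 * deriv Digamma (of_nat (Suc N)))) +
       mt_tail N r l (of_nat (Suc l)) x ({0..N} - {r - 1}))"
    unfolding img[symmetric]
    by (rule Theta_eqO[OF r N_def x _ _ K(1) mt_sum_of_nat mt_pole_eqO_double[OF lN x e]]) (use K in auto)
  have z: "1 + of_nat k - of_nat l - of_nat r + of_nat (Suc l) = (of_nat k - of_nat r + 2 :: complex)" for k by simp
  note G = G[unfolded z Nl]
  have "complex_of_nat l + 1 = of_nat (Suc l)" by simp
  show ?case
    unfolding \<open>complex_of_nat l + 1 = of_nat (Suc l)\<close> N_def[symmetric] t0
    unfolding rl
    by (rule eqO_imp_bigo, rule eqO_cong[OF G]) (simp_all add: ring_distribs mult_ac del: of_nat_Suc)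
  }
qed

end
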